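(* Let $T$ be a recursively enumerable theory in the language of arithmetic augmented with a function symbol $\textsf{exp}$ (interpreted as the standard exponential function), with no further assumption on its strength (it need not contain Robinson's arithmetic). If $T$ is $\Sigma_1$-sound, then $T\nvdash\Sigma_1\text{-}\textsf{Sound}(T)$.
   Context: $T$ is $\Sigma_1$-sound if it proves no $\Sigma_1$-sentence false in the standard model $\mathbb{N}$ (equivalently, $T\cup\Pi_1\text{-}\mathrm{Th}(\mathbb{N})$ is consistent). With $\textsf{Axiom}_T(x)$ a $\Sigma_1$-formula defining (the codes of) the axioms of $T$, $\textsf{ConjAx}_T(x)$ says that $x$ codes a conjunction of axioms of $T$, $\textsf{Proof}(y,x)$ is the standard first-order proof relation, and $\Pi_1\text{-}\textsf{True}(x)$ defines the set of true $\Pi_1$-sentences; $\Sigma_1\text{-}\textsf{Sound}(T)$ is the sentence $\forall s,t,u\,[\textsf{ConjAx}_T(s)\wedge\Pi_1\text{-}\textsf{True}(t)\rightarrow\neg\textsf{Proof}(u,\ulcorner s\wedge t\rightarrow\bot\urcorner)]$. *)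

theory Defs
  imports Main "HOL-Library.Nat_Bijection"
begin

section \<open>The language of arithmetic with exp\<close>

text \<open>Bound variables are de Bruijn indices. The remaining connectives, the existential
  quantifier and the bounded quantifiers are introduced below as abbreviations.\<close>

datatype tm = Zero | Var nat | Succ tm | Exp tm
  | Add tm tm (infixl "\<oplus>" 65) | Mul tm tm (infixl "\<otimes>" 70)

datatype fm = Bot | Eq tm tm (infix "\<doteq>" 50) | Le tm tm (infix "\<preceq>" 50)
  | Imp fm fm (infixr "\<rightharpoonup>" 25) | All fm

primrec nval :: "(nat \<Rightarrow> nat) \<Rightarrow> tm \<Rightarrow> nat" where
  "nval e Zero = 0"
| "nval e (Var n) = e n"
| "nval e (Succ t) = Suc (nval e t)"
| "nval e (Exp t) = 2 ^ nval e t"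
| "nval e (s \<oplus> t) = nval e s + nval e t"
| "nval e (s \<otimes> t) = nval e s * nval e t"

primrec sat :: "(nat \<Rightarrow> nat) \<Rightarrow> fm \<Rightarrow> bool" where
  "sat e Bot \<longleftrightarrow> False"
| "sat e (s \<doteq> t) \<longleftrightarrow> nval e s = nval e t"
| "sat e (s \<preceq> t) \<longleftrightarrow> nval e s \<le> nval e t"
| "sat e (A \<rightharpoonup> B) \<longleftrightarrow> (sat e A \<longrightarrow> sat e B)"
| "sat e (All A) \<longleftrightarrow> (\<forall>n. sat (case_nat n e) A)"

text \<open>Truth in the standard model (used for sentences, where the assignment is irrelevant).\<close>

definition true_N :: "fm \<Rightarrow> bool" where
  "true_N A \<longleftrightarrow> (\<forall>e. sat e A)"

primrec fvt :: "tm \<Rightarrow> nat set" where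
  "fvt Zero = {}"
| "fvt (Var n) = {n}"
| "fvt (Succ t) = fvt t"
| "fvt (Exp t) = fvt t"
| "fvt (s \<oplus> t) = fvt s \<union> fvt t"
| "fvt (s \<otimes> t) = fvt s \<union> fvt t"

primrec fv :: "fm \<Rightarrow> nat set" where
  "fv Bot = {}"
| "fv (s \<doteq> t) = fvt s \<union> fvt t"
| "fv (s \<preceq> t) = fvt s \<union> fvt t"
| "fv (A \<rightharpoonup> B) = fv A \<union> fv B"
| "fv (All A) = {n. Suc n \<in> fv A}"

definition sentence :: "fm \<Rightarrow> bool" where
  "sentence A \<longleftrightarrow> fv A = {}"

text \<open>\<open>lift_tm c d\<close> adds \<open>d\<close> to all variables from the cutoff \<open>c\<close> on; \<open>subst_fm k s A\<close> replaces
  the variable \<open>k\<close> by \<open>s\<close> and closes the gap, where \<open>s\<close> lives in the context outside the \<open>k\<close>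
  innermost binders and is therefore lifted by \<open>k\<close> at the leaves.\<close>

primrec lift_tm :: "nat \<Rightarrow> nat \<Rightarrow> tm \<Rightarrow> tm" where
  "lift_tm c d Zero = Zero"
| "lift_tm c d (Var n) = Var (if n < c then n else n + d)"
| "lift_tm c d (Succ t) = Succ (lift_tm c d t)"
| "lift_tm c d (Exp t) = Exp (lift_tm c d t)"
| "lift_tm c d (s \<oplus> t) = lift_tm c d s \<oplus> lift_tm c d t"
| "lift_tm c d (s \<otimes> t) = lift_tm c d s \<otimes> lift_tm c d t"

primrec lift_fm :: "nat \<Rightarrow> nat \<Rightarrow> fm \<Rightarrow> fm" where
  "lift_fm c d Bot = Bot"
| "lift_fm c d (s \<doteq> t) = (lift_tm c d s \<doteq> lift_tm c d t)"
| "lift_fm c d (s \<preceq> t) = (lift_tm c d s \<preceq> lift_tm c d t)"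
| "lift_fm c d (A \<rightharpoonup> B) = (lift_fm c d A \<rightharpoonup> lift_fm c d B)"
| "lift_fm c d (All A) = All (lift_fm (Suc c) d A)"

primrec subst_tm :: "nat \<Rightarrow> tm \<Rightarrow> tm \<Rightarrow> tm" where
  "subst_tm k s Zero = Zero"
| "subst_tm k s (Var n) =
     (if n < k then Var n else if n = k then lift_tm 0 k s else Var (n - 1))"
| "subst_tm k s (Succ t) = Succ (subst_tm k s t)"
| "subst_tm k s (Exp t) = Exp (subst_tm k s t)"
| "subst_tm k s (t \<oplus> u) = subst_tm k s t \<oplus> subst_tm k s u"
| "subst_tm k s (t \<otimes> u) = subst_tm k s t \<otimes> subst_tm k s u"

primrec subst_fm :: "nat \<Rightarrow> tm \<Rightarrow> fm \<Rightarrow> fm" where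
  "subst_fm k s Bot = Bot"
| "subst_fm k s (t \<doteq> u) = (subst_tm k s t \<doteq> subst_tm k s u)"
| "subst_fm k s (t \<preceq> u) = (subst_tm k s t \<preceq> subst_tm k s u)"
| "subst_fm k s (A \<rightharpoonup> B) = (subst_fm k s A \<rightharpoonup> subst_fm k s B)"
| "subst_fm k s (All A) = All (subst_fm (Suc k) s A)"

abbreviation up :: "nat \<Rightarrow> tm \<Rightarrow> tm" where
  "up k t \<equiv> lift_tm 0 k t"

definition Top :: fm where "Top = (Bot \<rightharpoonup> Bot)"
definition Neg :: "fm \<Rightarrow> fm" where "Neg A = (A \<rightharpoonup> Bot)"
definition And :: "fm \<Rightarrow> fm \<Rightarrow> fm" (infixr "\<sqinter>" 35) where "(A \<sqinter> B) = Neg (A \<rightharpoonup> Neg B)"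
definition Or :: "fm \<Rightarrow> fm \<Rightarrow> fm" (infixr "\<squnion>" 30) where "(A \<squnion> B) = (Neg A \<rightharpoonup> B)"
definition Exi :: "fm \<Rightarrow> fm" where "Exi A = Neg (All (Neg A))"

text \<open>Bounded quantifiers; the bound does not contain the quantified variable, hence the lifting.\<close>

definition BAll :: "tm \<Rightarrow> fm \<Rightarrow> fm" where
  "BAll t A = All (Var 0 \<preceq> up 1 t \<rightharpoonup> A)"
definition BExi :: "tm \<Rightarrow> fm \<Rightarrow> fm" where
  "BExi t A = Neg (BAll t (Neg A))"

text \<open>A block of \<open>n\<close> existential quantifiers with the same bound \<open>t\<close>.\<close>

primrec BExis :: "nat \<Rightarrow> tm \<Rightarrow> fm \<Rightarrow> fm" where
  "BExis 0 t A = A"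
| "BExis (Suc n) t A = BExi t (BExis n (up 1 t) A)"

primrec num :: "nat \<Rightarrow> tm" where
  "num 0 = Zero"
| "num (Suc n) = Succ (num n)"

inductive delta0 :: "fm \<Rightarrow> bool" where
  "delta0 Bot"
| "delta0 (s \<doteq> t)"
| "delta0 (s \<preceq> t)"
| "delta0 A \<Longrightarrow> delta0 B \<Longrightarrow> delta0 (A \<rightharpoonup> B)"
| "delta0 A \<Longrightarrow> delta0 (BAll t A)"

inductive sigma1 :: "fm \<Rightarrow> bool" where
  "delta0 A \<Longrightarrow> sigma1 A"
| "sigma1 A \<Longrightarrow> sigma1 (Exi A)"

inductive pi1 :: "fm \<Rightarrow> bool" where
  "delta0 A \<Longrightarrow> pi1 A"
| "pi1 A \<Longrightarrow> pi1 (All A)"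


section \<open>First-order logic with equality\<close>

text \<open>A Mendelson-style Hilbert calculus with the rules modus ponens and generalisation.\<close>

inductive log_ax :: "fm \<Rightarrow> bool" where
  K: "log_ax (A \<rightharpoonup> B \<rightharpoonup> A)"
| S: "log_ax ((A \<rightharpoonup> B \<rightharpoonup> C) \<rightharpoonup> (A \<rightharpoonup> B) \<rightharpoonup> A \<rightharpoonup> C)"
| DN: "log_ax (((A \<rightharpoonup> Bot) \<rightharpoonup> Bot) \<rightharpoonup> A)"
| Inst: "log_ax (All A \<rightharpoonup> subst_fm 0 s A)"
| Dist: "log_ax (All (lift_fm 0 1 A \<rightharpoonup> B) \<rightharpoonup> A \<rightharpoonup> All B)"
| Refl: "log_ax (s \<doteq> s)"
| Eucl: "log_ax (s \<doteq> t \<rightharpoonup> s \<doteq> u \<rightharpoonup> t \<doteq> u)"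
| CongSucc: "log_ax (s \<doteq> t \<rightharpoonup> Succ s \<doteq> Succ t)"
| CongExp: "log_ax (s \<doteq> t \<rightharpoonup> Exp s \<doteq> Exp t)"
| CongAdd: "log_ax (s \<doteq> t \<rightharpoonup> u \<doteq> v \<rightharpoonup> s \<oplus> u \<doteq> t \<oplus> v)"
| CongMul: "log_ax (s \<doteq> t \<rightharpoonup> u \<doteq> v \<rightharpoonup> s \<otimes> u \<doteq> t \<otimes> v)"
| CongLe: "log_ax (s \<doteq> t \<rightharpoonup> u \<doteq> v \<rightharpoonup> s \<preceq> u \<rightharpoonup> t \<preceq> v)"

inductive proves :: "fm set \<Rightarrow> fm \<Rightarrow> bool" (infix "\<turnstile>" 40) for T where
  Ax: "A \<in> T \<Longrightarrow> T \<turnstile> A"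
| Log: "log_ax A \<Longrightarrow> T \<turnstile> A"
| MP: "T \<turnstile> A \<Longrightarrow> T \<turnstile> (A \<rightharpoonup> B) \<Longrightarrow> T \<turnstile> B"
| Gen: "T \<turnstile> A \<Longrightarrow> T \<turnstile> All A"

definition sigma1_sound :: "fm set \<Rightarrow> bool" where
  "sigma1_sound T \<longleftrightarrow> (\<forall>A. sentence A \<and> sigma1 A \<and> T \<turnstile> A \<longrightarrow> true_N A)"


section \<open>Goedel numbering\<close>

text \<open>Both numberings are bijections onto the natural numbers, so that every number is the
  code of a term and of a formula, and no well-formedness tests are needed below.\<close>

primrec tcode :: "tm \<Rightarrow> nat" where
  "tcode Zero = 0"
| "tcode (Var n) = 5 * n + 1"
| "tcode (Succ t) = 5 * tcode t + 2"
| "tcode (Exp t) = 5 * tcode t + 3"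
| "tcode (s \<oplus> t) = 5 * prod_encode (tcode s, tcode t) + 4"
| "tcode (s \<otimes> t) = 5 * prod_encode (tcode s, tcode t) + 5"

primrec fcode :: "fm \<Rightarrow> nat" where
  "fcode Bot = 0"
| "fcode (s \<doteq> t) = 4 * prod_encode (tcode s, tcode t) + 1"
| "fcode (s \<preceq> t) = 4 * prod_encode (tcode s, tcode t) + 2"
| "fcode (A \<rightharpoonup> B) = 4 * prod_encode (fcode A, fcode B) + 3"
| "fcode (All A) = 4 * fcode A + 4"


section \<open>Arithmetisation\<close>

text \<open>All formulas below are functions of terms: \<open>Foo t u\<close> is the formula \<open>Foo\<close> with its
  argument places filled by \<open>t\<close> and \<open>u\<close>. Under \<open>k\<close> quantifiers an argument \<open>t\<close> is written
  \<open>up k t\<close>, and \<open>Var 0\<close> is the innermost quantified variable.\<close>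

text \<open>\<open>dbl a b\<close> denotes twice the code of the pair of \<open>a\<close> and \<open>b\<close>; doubling avoids the division
  by two in \<open>prod_encode\<close>.\<close>

definition dbl :: "tm \<Rightarrow> tm \<Rightarrow> tm" where
  "dbl a b = (a \<oplus> b) \<otimes> Succ (a \<oplus> b) \<oplus> (a \<oplus> a)"

definition isPair :: "tm \<Rightarrow> tm \<Rightarrow> tm \<Rightarrow> fm" where
  "isPair p a b = (p \<oplus> p \<doteq> dbl a b)"

definition varT :: "tm \<Rightarrow> tm" where "varT n = num 5 \<otimes> n \<oplus> num 1"
definition succT :: "tm \<Rightarrow> tm" where "succT a = num 5 \<otimes> a \<oplus> num 2"
definition expT :: "tm \<Rightarrow> tm" where "expT a = num 5 \<otimes> a \<oplus> num 3"
definition allT :: "tm \<Rightarrow> tm" where "allT a = num 4 \<otimes> a \<oplus> num 4"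

definition isAdd :: "tm \<Rightarrow> tm \<Rightarrow> tm \<Rightarrow> fm" where
  "isAdd x a b = (x \<oplus> x \<doteq> num 5 \<otimes> dbl a b \<oplus> num 8)"
definition isMul :: "tm \<Rightarrow> tm \<Rightarrow> tm \<Rightarrow> fm" where
  "isMul x a b = (x \<oplus> x \<doteq> num 5 \<otimes> dbl a b \<oplus> num 10)"
definition isEq :: "tm \<Rightarrow> tm \<Rightarrow> tm \<Rightarrow> fm" where
  "isEq x a b = (x \<oplus> x \<doteq> num 4 \<otimes> dbl a b \<oplus> num 2)"
definition isLe :: "tm \<Rightarrow> tm \<Rightarrow> tm \<Rightarrow> fm" where
  "isLe x a b = (x \<oplus> x \<doteq> num 4 \<otimes> dbl a b \<oplus> num 4)"
definition isImp :: "tm \<Rightarrow> tm \<Rightarrow> tm \<Rightarrow> fm" where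
  "isImp x a b = (x \<oplus> x \<doteq> num 4 \<otimes> dbl a b \<oplus> num 6)"

definition isAnd :: "tm \<Rightarrow> tm \<Rightarrow> tm \<Rightarrow> fm" where
  "isAnd x a b = BExis 2 x
     (isImp (Var 1) (up 2 b) Zero \<sqinter> isImp (Var 0) (up 2 a) (Var 1) \<sqinter> isImp (up 2 x) (Var 0) Zero)"

text \<open>Finite sets of numbers are coded by binary expansions, as in \<open>set_decode\<close>;
  \<open>Mem2\<close> and \<open>Mem3\<close> express membership of a coded pair and triple.\<close>

definition Mem :: "tm \<Rightarrow> tm \<Rightarrow> fm" where
  "Mem z y = BExis 2 y
     (up 2 y \<doteq> Var 1 \<otimes> Exp (Succ (up 2 z)) \<oplus> (Exp (up 2 z) \<oplus> Var 0)
      \<sqinter> Succ (Var 0) \<preceq> Exp (up 2 z))"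

definition Mem2 :: "tm \<Rightarrow> tm \<Rightarrow> tm \<Rightarrow> fm" where
  "Mem2 a b y = BExi y (isPair (Var 0) (up 1 a) (up 1 b) \<sqinter> Mem (Var 0) (up 1 y))"

definition Mem3 :: "tm \<Rightarrow> tm \<Rightarrow> tm \<Rightarrow> tm \<Rightarrow> fm" where
  "Mem3 a b c y = BExi y (isPair (Var 0) (up 1 b) (up 1 c) \<sqinter> Mem2 (up 1 a) (Var 0) (up 1 y))"

text \<open>Syntactic functions defined by recursion are expressed by the existence of a finite set \<open>F\<close>
  of coded tuples in the graph, closed under passing to the arguments of the recursive calls.
  \<open>MapT\<close> and \<open>MapF\<close> treat the recursions underlying lifting and substitution uniformly:
  \<open>leaf q c n b\<close> expresses that the variable \<open>n\<close> is mapped to the term \<open>b\<close>, and \<open>g q c s t\<close>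
  that the term \<open>s\<close> is mapped to \<open>t\<close>, with a parameter \<open>q\<close> and at depth \<open>c\<close>.\<close>

definition MapT_step :: "(tm \<Rightarrow> tm \<Rightarrow> tm \<Rightarrow> tm \<Rightarrow> fm) \<Rightarrow> tm \<Rightarrow> tm \<Rightarrow> tm \<Rightarrow> tm \<Rightarrow> tm \<Rightarrow> fm" where
  "MapT_step leaf q c F a b =
     ((a \<doteq> Zero \<sqinter> b \<doteq> Zero)
   \<squnion> BExi a (up 1 a \<doteq> varT (Var 0) \<sqinter> leaf (up 1 q) (up 1 c) (Var 0) (up 1 b))
   \<squnion> BExis 2 F (Mem2 (Var 1) (Var 0) (up 2 F) \<sqinter>
       ((up 2 a \<doteq> succT (Var 1) \<sqinter> up 2 b \<doteq> succT (Var 0))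
      \<squnion> (up 2 a \<doteq> expT (Var 1) \<sqinter> up 2 b \<doteq> expT (Var 0))))
   \<squnion> BExis 4 F (Mem2 (Var 3) (Var 1) (up 4 F) \<sqinter> Mem2 (Var 2) (Var 0) (up 4 F) \<sqinter>
       ((isAdd (up 4 a) (Var 3) (Var 2) \<sqinter> isAdd (up 4 b) (Var 1) (Var 0))
      \<squnion> (isMul (up 4 a) (Var 3) (Var 2) \<sqinter> isMul (up 4 b) (Var 1) (Var 0)))))"

definition MapT :: "(tm \<Rightarrow> tm \<Rightarrow> tm \<Rightarrow> tm \<Rightarrow> fm) \<Rightarrow> tm \<Rightarrow> tm \<Rightarrow> tm \<Rightarrow> tm \<Rightarrow> fm" where
  "MapT leaf q c a b = BExi (Exp (Succ (dbl a b)))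
     (Mem2 (up 1 a) (up 1 b) (Var 0) \<sqinter>
      BAll (Var 0) (BAll (Var 1) (Mem2 (Var 1) (Var 0) (Var 2) \<rightharpoonup>
        MapT_step leaf (up 3 q) (up 3 c) (Var 2) (Var 1) (Var 0))))"

text \<open>\<open>LiftT d c a b\<close>: lifting the term \<open>a\<close> by \<open>d\<close> with cutoff \<open>c\<close> yields \<open>b\<close>.
  \<open>SubstT s k a b\<close>: substituting \<open>s\<close> for the variable \<open>k\<close> in the term \<open>a\<close> yields \<open>b\<close>.\<close>

definition LiftT :: "tm \<Rightarrow> tm \<Rightarrow> tm \<Rightarrow> tm \<Rightarrow> fm" where
  "LiftT = MapT (\<lambda>d c n b. (Succ n \<preceq> c \<sqinter> b \<doteq> varT n) \<squnion> (c \<preceq> n \<sqinter> b \<doteq> varT (n \<oplus> d)))"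

definition SubstT :: "tm \<Rightarrow> tm \<Rightarrow> tm \<Rightarrow> tm \<Rightarrow> fm" where
  "SubstT = MapT (\<lambda>s k n b. (Succ n \<preceq> k \<sqinter> b \<doteq> varT n) \<squnion> (n \<doteq> k \<sqinter> LiftT k Zero s b)
     \<squnion> (Succ k \<preceq> n \<sqinter> BExi n (up 1 n \<doteq> Succ (Var 0) \<sqinter> up 1 b \<doteq> varT (Var 0))))"

definition MapF_step :: "(tm \<Rightarrow> tm \<Rightarrow> tm \<Rightarrow> tm \<Rightarrow> fm) \<Rightarrow> tm \<Rightarrow> tm \<Rightarrow> tm \<Rightarrow> tm \<Rightarrow> tm \<Rightarrow> fm" where
  "MapF_step g q F c a b =
     ((a \<doteq> Zero \<sqinter> b \<doteq> Zero)
   \<squnion> BExis 4 F (g (up 4 q) (up 4 c) (Var 3) (Var 1) \<sqinter> g (up 4 q) (up 4 c) (Var 2) (Var 0) \<sqinter>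
       ((isEq (up 4 a) (Var 3) (Var 2) \<sqinter> isEq (up 4 b) (Var 1) (Var 0))
      \<squnion> (isLe (up 4 a) (Var 3) (Var 2) \<sqinter> isLe (up 4 b) (Var 1) (Var 0))))
   \<squnion> BExis 4 F (Mem3 (up 4 c) (Var 3) (Var 1) (up 4 F) \<sqinter> Mem3 (up 4 c) (Var 2) (Var 0) (up 4 F) \<sqinter>
       isImp (up 4 a) (Var 3) (Var 2) \<sqinter> isImp (up 4 b) (Var 1) (Var 0))
   \<squnion> BExis 2 F (Mem3 (Succ (up 2 c)) (Var 1) (Var 0) (up 2 F) \<sqinter>
       up 2 a \<doteq> allT (Var 1) \<sqinter> up 2 b \<doteq> allT (Var 0)))"

definition MapF :: "(tm \<Rightarrow> tm \<Rightarrow> tm \<Rightarrow> tm \<Rightarrow> fm) \<Rightarrow> tm \<Rightarrow> tm \<Rightarrow> tm \<Rightarrow> tm \<Rightarrow> fm" where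
  "MapF g q c a b = BExi (Exp (Succ (dbl (c \<oplus> a) (dbl a b))))
     (Mem3 (up 1 c) (up 1 a) (up 1 b) (Var 0) \<sqinter>
      BAll (Var 0) (BAll (Var 1) (BAll (Var 2) (Mem3 (Var 2) (Var 1) (Var 0) (Var 3) \<rightharpoonup>
        MapF_step g (up 4 q) (Var 3) (Var 2) (Var 1) (Var 0)))))"

definition LiftF :: "tm \<Rightarrow> tm \<Rightarrow> tm \<Rightarrow> tm \<Rightarrow> fm" where "LiftF = MapF LiftT"
definition SubstF :: "tm \<Rightarrow> tm \<Rightarrow> tm \<Rightarrow> tm \<Rightarrow> fm" where "SubstF = MapF SubstT"

text \<open>A formula is closed iff lifting all its free variables does not change it.\<close>

definition Closed :: "tm \<Rightarrow> fm" where
  "Closed x = LiftF (num 1) Zero x x"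

text \<open>In the bounded quantifier case \<open>Var 4\<close> is the bound, \<open>Var 3\<close> the lifted bound, \<open>Var 2\<close> the
  inequality, \<open>Var 1\<close> the body and \<open>Var 0\<close> the implication; \<open>num 1\<close> is the code of the variable 0.\<close>

definition isDelta0_step :: "tm \<Rightarrow> tm \<Rightarrow> fm" where
  "isDelta0_step D z =
     (z \<doteq> Zero
   \<squnion> BExis 2 z (isEq (up 2 z) (Var 1) (Var 0) \<squnion> isLe (up 2 z) (Var 1) (Var 0))
   \<squnion> BExis 2 z (Mem (Var 1) (up 2 D) \<sqinter> Mem (Var 0) (up 2 D) \<sqinter> isImp (up 2 z) (Var 1) (Var 0))
   \<squnion> BExis 5 z (LiftT (num 1) Zero (Var 4) (Var 3) \<sqinter> isLe (Var 2) (num 1) (Var 3) \<sqinter>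
       isImp (Var 0) (Var 2) (Var 1) \<sqinter> up 5 z \<doteq> allT (Var 0) \<sqinter> Mem (Var 1) (up 5 D)))"

definition isDelta0 :: "tm \<Rightarrow> fm" where
  "isDelta0 x = BExi (Exp (Succ x)) (Mem (up 1 x) (Var 0) \<sqinter>
     BAll (Var 0) (Mem (Var 0) (Var 1) \<rightharpoonup> isDelta0_step (Var 1) (Var 0)))"

definition isPi1 :: "tm \<Rightarrow> fm" where
  "isPi1 x = BExi (Exp (Succ x)) (Mem (up 1 x) (Var 0) \<sqinter>
     BAll (Var 0) (Mem (Var 0) (Var 1) \<rightharpoonup>
       isDelta0 (Var 0) \<squnion> BExi (Var 0) (Var 1 \<doteq> allT (Var 0) \<sqinter> Mem (Var 0) (Var 2))))"


subsection \<open>Truth for \<open>\<Pi>\<^sub>1\<close>-sentences\<close>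

text \<open>An assignment is coded by iterated pairing: \<open>\<langle>a, d\<rangle>\<close> codes the assignment \<open>case_nat a d\<close>.
  \<open>ValTable V\<close> says that \<open>V\<close> is a finite partial table of triples (term, assignment, value),
  and \<open>TruthTable V W\<close> that \<open>W\<close> is one of triples (formula, assignment, truth value),
  each entry being justified by other entries through Tarski's clauses.
  The value 0 at a universal formula is justified by a single instance; the value 1 is only
  available for bounded quantifiers.\<close>

definition ValTable_step :: "tm \<Rightarrow> tm \<Rightarrow> tm \<Rightarrow> tm \<Rightarrow> fm" where
  "ValTable_step V t e v =
     ((t \<doteq> Zero \<sqinter> v \<doteq> Zero)
   \<squnion> BExis 3 V (isPair (up 3 e) (Var 2) (Var 1) \<sqinter>
       ((up 3 t \<doteq> varT Zero \<sqinter> up 3 v \<doteq> Var 2)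
      \<squnion> (up 3 t \<doteq> varT (Succ (Var 0)) \<sqinter> Mem3 (varT (Var 0)) (Var 1) (up 3 v) (up 3 V))))
   \<squnion> BExis 2 V (Mem3 (Var 1) (up 2 e) (Var 0) (up 2 V) \<sqinter>
       ((up 2 t \<doteq> succT (Var 1) \<sqinter> up 2 v \<doteq> Succ (Var 0))
      \<squnion> (up 2 t \<doteq> expT (Var 1) \<sqinter> up 2 v \<doteq> Exp (Var 0))))
   \<squnion> BExis 4 V (Mem3 (Var 3) (up 4 e) (Var 1) (up 4 V) \<sqinter> Mem3 (Var 2) (up 4 e) (Var 0) (up 4 V) \<sqinter>
       ((isAdd (up 4 t) (Var 3) (Var 2) \<sqinter> up 4 v \<doteq> Var 1 \<oplus> Var 0)
      \<squnion> (isMul (up 4 t) (Var 3) (Var 2) \<sqinter> up 4 v \<doteq> Var 1 \<otimes> Var 0))))"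

definition ValTable :: "tm \<Rightarrow> fm" where
  "ValTable V = BAll V (BAll (up 1 V) (BAll (up 2 V) (Mem3 (Var 2) (Var 1) (Var 0) (up 3 V) \<rightharpoonup>
     ValTable_step (up 3 V) (Var 2) (Var 1) (Var 0))))"

text \<open>In the last clause \<open>Var 5\<close>, \<open>Var 4\<close>, \<open>Var 3\<close> are the matrix of the bounded quantifier, its
  inequality and its body, \<open>Var 2\<close> is the lifted bound, \<open>Var 1\<close> the bound and \<open>Var 0\<close> its value.\<close>

definition TruthTable_step :: "tm \<Rightarrow> tm \<Rightarrow> tm \<Rightarrow> tm \<Rightarrow> tm \<Rightarrow> fm" where
  "TruthTable_step V W x e b =
     ((x \<doteq> Zero \<sqinter> b \<doteq> Zero)
   \<squnion> BExis 4 (V \<oplus> W) (Mem3 (Var 3) (up 4 e) (Var 1) (up 4 V) \<sqinter> Mem3 (Var 2) (up 4 e) (Var 0) (up 4 V) \<sqinter>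
       ((isEq (up 4 x) (Var 3) (Var 2) \<sqinter>
           ((Var 1 \<doteq> Var 0 \<sqinter> up 4 b \<doteq> num 1) \<squnion> (Neg (Var 1 \<doteq> Var 0) \<sqinter> up 4 b \<doteq> Zero)))
      \<squnion> (isLe (up 4 x) (Var 3) (Var 2) \<sqinter>
           ((Var 1 \<preceq> Var 0 \<sqinter> up 4 b \<doteq> num 1) \<squnion> (Neg (Var 1 \<preceq> Var 0) \<sqinter> up 4 b \<doteq> Zero)))))
   \<squnion> BExis 4 (V \<oplus> W) (Mem3 (Var 3) (up 4 e) (Var 1) (up 4 W) \<sqinter> Mem3 (Var 2) (up 4 e) (Var 0) (up 4 W) \<sqinter>
       isImp (up 4 x) (Var 3) (Var 2) \<sqinter>
       ((Var 1 \<doteq> num 1 \<sqinter> Var 0 \<doteq> Zero \<sqinter> up 4 b \<doteq> Zero)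
      \<squnion> (Neg (Var 1 \<doteq> num 1 \<sqinter> Var 0 \<doteq> Zero) \<sqinter> up 4 b \<doteq> num 1)))
   \<squnion> BExis 3 (V \<oplus> W) (up 3 x \<doteq> allT (Var 2) \<sqinter> up 3 b \<doteq> Zero \<sqinter>
       isPair (Var 0) (Var 1) (up 3 e) \<sqinter> Mem3 (Var 2) (Var 0) Zero (up 3 W))
   \<squnion> BExis 6 (V \<oplus> W) (up 6 x \<doteq> allT (Var 5) \<sqinter> up 6 b \<doteq> num 1 \<sqinter>
       isImp (Var 5) (Var 4) (Var 3) \<sqinter> isLe (Var 4) (num 1) (Var 2) \<sqinter>
       LiftT (num 1) Zero (Var 1) (Var 2) \<sqinter> Mem3 (Var 1) (up 6 e) (Var 0) (up 6 V) \<sqinter>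
       BAll (Var 0) (BExi (up 7 (V \<oplus> W)) (isPair (Var 0) (Var 1) (up 8 e) \<sqinter>
         Mem3 (Var 7) (Var 0) (num 1) (up 8 W)))))"

definition TruthTable :: "tm \<Rightarrow> tm \<Rightarrow> fm" where
  "TruthTable V W = BAll W (BAll (up 1 W) (BAll (up 2 W) (Mem3 (Var 2) (Var 1) (Var 0) (up 3 W) \<rightharpoonup>
     TruthTable_step (up 3 V) (up 3 W) (Var 2) (Var 1) (Var 0))))"

text \<open>\<open>x\<close> is a \<open>\<Pi>\<^sub>1\<close>-sentence and no pair of tables gives it the truth value 0; the second
  \<open>Zero\<close> is the code of an assignment, which is irrelevant for a sentence.\<close>

definition Pi1_True :: "tm \<Rightarrow> fm" where
  "Pi1_True x = All (All (Closed (up 2 x) \<sqinter> isPi1 (up 2 x) \<sqinter>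
     (ValTable (Var 1) \<sqinter> TruthTable (Var 1) (Var 0) \<rightharpoonup> Neg (Mem3 (up 2 x) Zero Zero (Var 0)))))"


subsection \<open>Proofs\<close>

definition isLogAx :: "tm \<Rightarrow> fm" where
  "isLogAx x =
     (BExis 3 x (isImp (Var 0) (Var 1) (Var 2) \<sqinter> isImp (up 3 x) (Var 2) (Var 0))
   \<squnion> BExis 8 x (isImp (Var 4) (Var 6) (Var 5) \<sqinter> isImp (Var 3) (Var 7) (Var 4) \<sqinter>
       isImp (Var 2) (Var 7) (Var 6) \<sqinter> isImp (Var 1) (Var 7) (Var 5) \<sqinter>
       isImp (Var 0) (Var 2) (Var 1) \<sqinter> isImp (up 8 x) (Var 3) (Var 0))
   \<squnion> BExis 3 x (isImp (Var 1) (Var 2) Zero \<sqinter> isImp (Var 0) (Var 1) Zero \<sqinter>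
       isImp (up 3 x) (Var 0) (Var 2))
   \<squnion> BExis 3 x (SubstF (Var 1) Zero (Var 2) (Var 0) \<sqinter> isImp (up 3 x) (allT (Var 2)) (Var 0))
   \<squnion> BExis 5 x (LiftF (num 1) Zero (Var 4) (Var 2) \<sqinter> isImp (Var 1) (Var 2) (Var 3) \<sqinter>
       isImp (Var 0) (Var 4) (allT (Var 3)) \<sqinter> isImp (up 5 x) (allT (Var 1)) (Var 0))
   \<squnion> BExi x (isEq (up 1 x) (Var 0) (Var 0))
   \<squnion> BExis 7 x (isEq (Var 3) (Var 6) (Var 5) \<sqinter> isEq (Var 2) (Var 6) (Var 4) \<sqinter>
       isEq (Var 1) (Var 5) (Var 4) \<sqinter> isImp (Var 0) (Var 2) (Var 1) \<sqinter> isImp (up 7 x) (Var 3) (Var 0))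
   \<squnion> BExis 4 x (isEq (Var 1) (Var 3) (Var 2) \<sqinter>
       (isEq (Var 0) (succT (Var 3)) (succT (Var 2)) \<squnion> isEq (Var 0) (expT (Var 3)) (expT (Var 2))) \<sqinter>
       isImp (up 4 x) (Var 1) (Var 0))
   \<squnion> BExis 10 x (isEq (Var 5) (Var 9) (Var 8) \<sqinter> isEq (Var 4) (Var 7) (Var 6) \<sqinter>
       ((isAdd (Var 3) (Var 9) (Var 7) \<sqinter> isAdd (Var 2) (Var 8) (Var 6))
      \<squnion> (isMul (Var 3) (Var 9) (Var 7) \<sqinter> isMul (Var 2) (Var 8) (Var 6))) \<sqinter>
       isEq (Var 1) (Var 3) (Var 2) \<sqinter> isImp (Var 0) (Var 4) (Var 1) \<sqinter> isImp (up 10 x) (Var 5) (Var 0))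
   \<squnion> BExis 10 x (isEq (Var 5) (Var 9) (Var 8) \<sqinter> isEq (Var 4) (Var 7) (Var 6) \<sqinter>
       isLe (Var 3) (Var 9) (Var 7) \<sqinter> isLe (Var 2) (Var 8) (Var 6) \<sqinter>
       isImp (Var 1) (Var 3) (Var 2) \<sqinter> isImp (Var 0) (Var 4) (Var 1) \<sqinter> isImp (up 10 x) (Var 5) (Var 0)))"

text \<open>A proof is a finite set \<open>y\<close> of pairs (line number, formula) in which every formula is
  a logical axiom or follows by a rule from formulas with smaller line numbers; it is a proof of
  each formula occurring in it.\<close>

definition Proof_step :: "tm \<Rightarrow> tm \<Rightarrow> tm \<Rightarrow> fm" where
  "Proof_step y i a =
     (isLogAx a
   \<squnion> BExis 4 y (Succ (Var 3) \<preceq> up 4 i \<sqinter> Succ (Var 2) \<preceq> up 4 i \<sqinter>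
       Mem2 (Var 3) (Var 1) (up 4 y) \<sqinter> Mem2 (Var 2) (Var 0) (up 4 y) \<sqinter> isImp (Var 0) (Var 1) (up 4 a))
   \<squnion> BExis 2 y (Succ (Var 1) \<preceq> up 2 i \<sqinter> Mem2 (Var 1) (Var 0) (up 2 y) \<sqinter> up 2 a \<doteq> allT (Var 0)))"

definition Proof :: "tm \<Rightarrow> tm \<Rightarrow> fm" where
  "Proof y x = (BExi y (Mem2 (Var 0) (up 1 x) (up 1 y)) \<sqinter>
     BAll y (BAll (up 1 y) (Mem2 (Var 1) (Var 0) (up 2 y) \<rightharpoonup> Proof_step (up 2 y) (Var 1) (Var 0))))"


subsection \<open>The sentence \<open>\<Sigma>\<^sub>1\<close>-Sound\<close>

text \<open>\<open>axiom_formula Ax T\<close>: the \<open>\<Sigma>\<^sub>1\<close>-formula \<open>Ax\<close> defines the set of codes of the axioms of \<open>T\<close>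
  in the standard model. Such a formula exists iff \<open>T\<close> is recursively enumerable.\<close>

definition axiom_formula :: "fm \<Rightarrow> fm set \<Rightarrow> bool" where
  "axiom_formula Ax T \<longleftrightarrow> sigma1 Ax \<and> fv Ax \<subseteq> {0} \<and>
     (\<forall>n e. sat (case_nat n e) Ax \<longleftrightarrow> n \<in> fcode ` T)"

text \<open>Conjunctions of axioms are built by binary conjunction in any bracketing; \<open>Top\<close> is the
  empty conjunction.\<close>

definition ConjAx :: "fm \<Rightarrow> tm \<Rightarrow> fm" where
  "ConjAx Ax x = BExi (Exp (Succ x)) (Mem (up 1 x) (Var 0) \<sqinter>
     BAll (Var 0) (Mem (Var 0) (Var 1) \<rightharpoonup>
       Var 0 \<doteq> num (fcode Top) \<squnion> subst_fm 0 (Var 0) Ax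
     \<squnion> BExis 2 (Var 0) (Mem (Var 1) (Var 3) \<sqinter> Mem (Var 0) (Var 3) \<sqinter> isAnd (Var 2) (Var 1) (Var 0))))"

text \<open>With \<open>s\<close>, \<open>t\<close>, \<open>u\<close> quantified in this order, the two further quantifiers serve to name the
  codes of \<open>s \<and> t\<close> (\<open>Var 1\<close>) and of \<open>s \<and> t \<rightarrow> \<bottom>\<close> (\<open>Var 0\<close>).\<close>

definition Sigma1_Sound :: "fm \<Rightarrow> fm" where
  "Sigma1_Sound Ax = All (All (All (ConjAx Ax (Var 2) \<sqinter> Pi1_True (Var 1) \<rightharpoonup>
     All (All (isAnd (Var 1) (Var 4) (Var 3) \<sqinter> isImp (Var 0) (Var 1) Zero \<rightharpoonup>
       Neg (Proof (Var 2) (Var 0)))))))"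


section \<open>Adequacy\<close>

text \<open>The remainder of this theory verifies that, in the standard model, the formulas above define
  the notions they arithmetise (theorems \<open>Proof_adequate\<close>, \<open>ConjAx_adequate\<close>, \<open>Pi1_True_adequate\<close>,
  \<open>Sigma1_Sound_adequate\<close>), and that they have the expected complexity (\<open>delta0_Proof\<close>,
  \<open>pi1_Pi1_True\<close>). None of this enters the definitions.\<close>

lemma lift_tm_0[simp]: "lift_tm c 0 t = t" by (induction t) auto

lemma nval_up_Suc[simp]: "nval (case_nat a e) (up (Suc k) t) = nval e (up k t)"
  by (induction t) auto
lemma nval_up_numeral[simp]: "nval (case_nat a e) (up (numeral k) t) = nval e (up (pred_numeral k) t)"
  by (simp add: numeral_eq_Suc)
lemma nval_up_1[simp]: "nval (case_nat a e) (up 1 t) = nval e t"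
  by simp
lemma nval_num[simp]: "nval e (num n) = n" by (induction n) auto

lemma sat_conn[simp]:
  "sat e Top" "sat e (Neg A) \<longleftrightarrow> \<not> sat e A" "sat e (A \<sqinter> B) \<longleftrightarrow> sat e A \<and> sat e B"
  "sat e (A \<squnion> B) \<longleftrightarrow> sat e A \<or> sat e B" "sat e (Exi A) \<longleftrightarrow> (\<exists>n. sat (case_nat n e) A)"
  "sat e (BAll t A) \<longleftrightarrow> (\<forall>n\<le>nval e t. sat (case_nat n e) A)"
  "sat e (BExi t A) \<longleftrightarrow> (\<exists>n\<le>nval e t. sat (case_nat n e) A)"
  by (auto simp: Top_def Neg_def And_def Or_def Exi_def BAll_def BExi_def)

lemma sat_BExis[simp]:
  "sat e (BExis (numeral k) t A) \<longleftrightarrow> (\<exists>n\<le>nval e t. sat (case_nat n e) (BExis (pred_numeral k) (up 1 t) A))"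
  by (simp add: numeral_eq_Suc)

lemma delta0_simps[simp]:
  "delta0 Bot" "delta0 (s \<doteq> t)" "delta0 (s \<preceq> t)" "delta0 Top"
  "delta0 A \<Longrightarrow> delta0 B \<Longrightarrow> delta0 (A \<rightharpoonup> B)"
  "delta0 A \<Longrightarrow> delta0 (Neg A)"
  "delta0 A \<Longrightarrow> delta0 B \<Longrightarrow> delta0 (A \<sqinter> B)"
  "delta0 A \<Longrightarrow> delta0 B \<Longrightarrow> delta0 (A \<squnion> B)"
  "delta0 A \<Longrightarrow> delta0 (BAll t A)"
  "delta0 A \<Longrightarrow> delta0 (BExi t A)"
  by (auto intro: delta0.intros simp: Top_def Neg_def And_def Or_def BExi_def)
lemma delta0_BExis[simp]: "delta0 A \<Longrightarrow> delta0 (BExis n t A)"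
  by (induction n arbitrary: t) auto

lemma dbl_val[simp]: "nval e (dbl a b) = 2 * prod_encode (nval e a, nval e b)"
  by (simp add: dbl_def prod_encode_def triangle_def)

lemma sat_isPair[simp]: "sat e (isPair p a b) \<longleftrightarrow> nval e p = prod_encode (nval e a, nval e b)"
  by (simp add: isPair_def) arith
lemma nval_codes[simp]: "nval e (varT n) = 5 * nval e n + 1" "nval e (succT n) = 5 * nval e n + 2"
  "nval e (expT n) = 5 * nval e n + 3" "nval e (allT n) = 4 * nval e n + 4"
  by (simp_all add: varT_def succT_def expT_def allT_def del: num.simps)
lemma sat_is[simp]:
  "sat e (isAdd x a b) \<longleftrightarrow> nval e x = 5 * prod_encode (nval e a, nval e b) + 4"
  "sat e (isMul x a b) \<longleftrightarrow> nval e x = 5 * prod_encode (nval e a, nval e b) + 5"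
  "sat e (isEq x a b) \<longleftrightarrow> nval e x = 4 * prod_encode (nval e a, nval e b) + 1"
  "sat e (isLe x a b) \<longleftrightarrow> nval e x = 4 * prod_encode (nval e a, nval e b) + 2"
  "sat e (isImp x a b) \<longleftrightarrow> nval e x = 4 * prod_encode (nval e a, nval e b) + 3"
  by (auto simp: isAdd_def isMul_def isEq_def isLe_def isImp_def)

lemma pe_le: "a \<le> prod_encode (a, b)" "b \<le> prod_encode (a, b)"
  by (simp_all add: le_prod_encode_1 le_prod_encode_2)

lemma sat_isAnd[simp]:
  "sat e (isAnd x a b) \<longleftrightarrow> nval e x = 4 * prod_encode (4 * prod_encode (nval e a, 4 * prod_encode (nval e b, 0) + 3) + 3, 0) + 3"
  apply (simp add: isAnd_def)
  using pe_le(1)[of "4 * prod_encode (nval e a, 4 * prod_encode (nval e b, 0) + 3) + 3" 0]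
    pe_le(2)[of  "4 * prod_encode (nval e b, 0) + 3" "nval e a"]
  by (smt (verit) le_add1 le_trans mult_le_mono1 nat_mult_1 one_le_numeral add.commute)

lemma mem_arith: "(\<exists>a\<le>y. \<exists>b\<le>y. y = a * 2 ^ Suc z + (2 ^ z + b) \<and> Suc b \<le> 2 ^ z) \<longleftrightarrow> z \<in> set_decode (y::nat)"
proof
  assume "\<exists>a\<le>y. \<exists>b\<le>y. y = a * 2 ^ Suc z + (2 ^ z + b) \<and> Suc b \<le> 2 ^ z"
  then obtain a b where y: "y = a * 2 ^ Suc z + (2 ^ z + b)" "b < 2 ^ z" by (auto simp: less_eq_Suc_le)
  have "y = b + (2*a+1) * 2^z" using y by (simp add: algebra_simps)
  then have "y div 2 ^ z = 2 * a + 1" using y(2) by (simp only: div_mult_self1[of "2^z::nat"]) simp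
  then show "z \<in> set_decode y" by (simp add: set_decode_def)
next
  assume "z \<in> set_decode y"
  then have "odd (y div 2 ^ z)" by (simp add: set_decode_def)
  then obtain a where a: "y div 2 ^ z = 2 * a + 1" by (elim oddE)
  let ?b = "y mod 2 ^ z"
  have y: "y = (2 * a + 1) * 2 ^ z + ?b" using a by (metis div_mult_mod_eq)
  have 1: "y = a * 2 ^ Suc z + (2 ^ z + ?b)" by (subst y) (simp add: algebra_simps)
  have 2: "a \<le> a * 2 ^ Suc z" by simp
  have "a \<le> y" using 1 2 by linarith
  moreover have "?b \<le> y" by simp
  moreover have "Suc ?b \<le> 2 ^ z" by (simp add: Suc_leI)
  ultimately show "\<exists>a\<le>y. \<exists>b\<le>y. y = a * 2 ^ Suc z + (2 ^ z + b) \<and> Suc b \<le> 2 ^ z" using 1 by blast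
qed

lemma sat_Mem[simp]: "sat e (Mem z y) \<longleftrightarrow> nval e z \<in> set_decode (nval e y)"
  using mem_arith[of "nval e y" "nval e z"] by (simp add: Mem_def)

lemma mem_le: "z \<in> set_decode y \<Longrightarrow> z \<le> y"
proof -
  assume "z \<in> set_decode y"
  then have "y div 2 ^ z \<noteq> 0" by (auto simp: set_decode_def intro!: Nat.gr0I)
  then have "2 ^ z \<le> y" by (metis div_less not_less)
  then show ?thesis by (meson less_exp le_trans less_imp_le)
qed

lemma sat_Mem2[simp]: "sat e (Mem2 a b y) \<longleftrightarrow> prod_encode (nval e a, nval e b) \<in> set_decode (nval e y)"
  by (auto simp: Mem2_def dest: mem_le)
lemma sat_Mem3[simp]: "sat e (Mem3 a b c y) \<longleftrightarrow>
   prod_encode (nval e a, prod_encode (nval e b, nval e c)) \<in> set_decode (nval e y)"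
  by (auto simp: Mem3_def dest: mem_le intro: order_trans[OF pe_le(2)])

lemma mem2_le: assumes "prod_encode (a,b) \<in> set_decode y" shows "a \<le> y" "b \<le> y"
  using mem_le[OF assms] pe_le le_trans by blast+
lemma mem3_le: assumes "prod_encode (a,prod_encode (b,c)) \<in> set_decode y" shows "a \<le> y" "b \<le> y" "c \<le> y"
  using mem2_le[OF assms] pe_le le_trans by blast+

lemma set_encode_bound: "X \<subseteq> {..m} \<Longrightarrow> set_encode X \<le> 2 ^ Suc m"
proof -
  assume "X \<subseteq> {..m}"
  then have "set_encode X \<le> (\<Sum>i\<in>{..m}. 2^i)" unfolding set_encode_def
    by (intro sum_mono2) auto
  also have "\<dots> \<le> 2 ^ Suc m"
    using mask_eq_sum_exp_nat[of "Suc m"] by (simp add: lessThan_Suc_atMost[symmetric] Collect_conj_eq lessThan_def)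
  finally show ?thesis .
qed

lemma set_encode_mono: assumes "X \<subseteq> {..m}" "m \<le> k" shows "set_encode X \<le> 2 * 2 ^ k"
proof -
  have "set_encode X \<le> 2 ^ Suc k" by (rule set_encode_bound) (use assms in auto)
  then show ?thesis by simp
qed

lemma five:
  "(5*x+1 = 5*y+(1::nat)) = (x=y)"
  "(5*x+1 = 5*y+(2::nat)) = False"
  "(5*x+1 = 5*y+(3::nat)) = False"
  "(5*x+1 = 5*y+(4::nat)) = False"
  "(5*x+1 = 5*y+(5::nat)) = False"
  "(5*x+2 = 5*y+(1::nat)) = False"
  "(5*x+2 = 5*y+(2::nat)) = (x=y)"
  "(5*x+2 = 5*y+(3::nat)) = False"
  "(5*x+2 = 5*y+(4::nat)) = False"
  "(5*x+2 = 5*y+(5::nat)) = False"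
  "(5*x+3 = 5*y+(1::nat)) = False"
  "(5*x+3 = 5*y+(2::nat)) = False"
  "(5*x+3 = 5*y+(3::nat)) = (x=y)"
  "(5*x+3 = 5*y+(4::nat)) = False"
  "(5*x+3 = 5*y+(5::nat)) = False"
  "(5*x+4 = 5*y+(1::nat)) = False"
  "(5*x+4 = 5*y+(2::nat)) = False"
  "(5*x+4 = 5*y+(3::nat)) = False"
  "(5*x+4 = 5*y+(4::nat)) = (x=y)"
  "(5*x+4 = 5*y+(5::nat)) = False"
  "(5*x+5 = 5*y+(1::nat)) = False"
  "(5*x+5 = 5*y+(2::nat)) = False"
  "(5*x+5 = 5*y+(3::nat)) = False"
  "(5*x+5 = 5*y+(4::nat)) = False"
  "(5*x+5 = 5*y+(5::nat)) = (x=y)"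
  "(5*x+1 = (0::nat)) = False" "((0::nat) = 5*x+1) = False"
  "(5*x+2 = (0::nat)) = False" "((0::nat) = 5*x+2) = False"
  "(5*x+3 = (0::nat)) = False" "((0::nat) = 5*x+3) = False"
  "(5*x+4 = (0::nat)) = False" "((0::nat) = 5*x+4) = False"
  "(5*x+5 = (0::nat)) = False" "((0::nat) = 5*x+5) = False"
  by presburger+

lemma four:
  "(4*x+1 = 4*y+(1::nat)) = (x=y)"
  "(4*x+1 = 4*y+(2::nat)) = False"
  "(4*x+1 = 4*y+(3::nat)) = False"
  "(4*x+1 = 4*y+(4::nat)) = False"
  "(4*x+2 = 4*y+(1::nat)) = False"
  "(4*x+2 = 4*y+(2::nat)) = (x=y)"
  "(4*x+2 = 4*y+(3::nat)) = False"
  "(4*x+2 = 4*y+(4::nat)) = False"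
  "(4*x+3 = 4*y+(1::nat)) = False"
  "(4*x+3 = 4*y+(2::nat)) = False"
  "(4*x+3 = 4*y+(3::nat)) = (x=y)"
  "(4*x+3 = 4*y+(4::nat)) = False"
  "(4*x+4 = 4*y+(1::nat)) = False"
  "(4*x+4 = 4*y+(2::nat)) = False"
  "(4*x+4 = 4*y+(3::nat)) = False"
  "(4*x+4 = 4*y+(4::nat)) = (x=y)"
  "(4*x+1 = (0::nat)) = False" "((0::nat) = 4*x+1) = False"
  "(4*x+2 = (0::nat)) = False" "((0::nat) = 4*x+2) = False"
  "(4*x+3 = (0::nat)) = False" "((0::nat) = 4*x+3) = False"
  "(4*x+4 = (0::nat)) = False" "((0::nat) = 4*x+4) = False"
  by presburger+

lemma split_five: "(n::nat) \<noteq> 0 \<Longrightarrow> n = 5*((n-1) div 5)+1 \<or> n = 5*((n-1) div 5)+2 \<or> n = 5*((n-1) div 5)+3 \<or> n = 5*((n-1) div 5)+4 \<or> n = 5*((n-1) div 5)+5"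
proof -
  assume n: "n \<noteq> 0"
  define q r where "q = (n-1) div 5" and "r = (n-1) mod 5"
  have "n - 1 = 5 * q + r" "r < 5" unfolding q_def r_def by simp_all
  moreover from this(2) have "r = 0 \<or> r = 1 \<or> r = 2 \<or> r = 3 \<or> r = 4" by linarith
  ultimately show ?thesis using n unfolding q_def[symmetric] by auto
qed

lemma split_four: "(n::nat) \<noteq> 0 \<Longrightarrow> n = 4*((n-1) div 4)+1 \<or> n = 4*((n-1) div 4)+2 \<or> n = 4*((n-1) div 4)+3 \<or> n = 4*((n-1) div 4)+4"
proof -
  assume n: "n \<noteq> 0"
  define q r where "q = (n-1) div 4" and "r = (n-1) mod 4"
  have "n - 1 = 4 * q + r" "r < 4" unfolding q_def r_def by simp_all
  moreover from this(2) have "r = 0 \<or> r = 1 \<or> r = 2 \<or> r = 3" by linarith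
  ultimately show ?thesis using n unfolding q_def[symmetric] by auto
qed

lemma tcode_inj: "tcode s = tcode t \<longleftrightarrow> s = t"
proof (induction s arbitrary: t)
  case Zero show ?case by (cases t) (simp_all only: tcode.simps five tm.distinct simp_thms)
next
  case (Var x) show ?case by (cases t) (simp_all only: tcode.simps five tm.distinct tm.inject)
next
  case (Succ s) then show ?case by (cases t) (simp_all only: tcode.simps five tm.distinct tm.inject)
next
  case (Exp s) then show ?case by (cases t) (simp_all only: tcode.simps five tm.distinct tm.inject)
next
  case (Add s1 s2) then show ?case by (cases t) (simp_all only: tcode.simps five tm.distinct tm.inject prod_encode_eq prod.inject)
next
  case (Mul s1 s2) then show ?case by (cases t) (simp_all only: tcode.simps five tm.distinct tm.inject prod_encode_eq prod.inject)
qed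

lemma fcode_inj: "fcode s = fcode t \<longleftrightarrow> s = t"
proof (induction s arbitrary: t)
  case Bot show ?case by (cases t) (simp_all only: fcode.simps four fm.distinct simp_thms)
next
  case (Eq x y) show ?case by (cases t) (simp_all only: fcode.simps four fm.distinct fm.inject tcode_inj prod_encode_eq prod.inject)
next
  case (Le x y) show ?case by (cases t) (simp_all only: fcode.simps four fm.distinct fm.inject tcode_inj prod_encode_eq prod.inject)
next
  case (Imp s1 s2) then show ?case by (cases t) (simp_all only: fcode.simps four fm.distinct fm.inject prod_encode_eq prod.inject)
next
  case (All s) then show ?case by (cases t) (simp_all only: fcode.simps four fm.distinct fm.inject)
qed

lemma tcode_surj: "\<exists>t. n = tcode t"
proof (induction n rule: less_induct)
  case (less n)
  show ?case
  proof (cases "n = 0")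
    case True then show ?thesis by (metis tcode.simps(1))
  next
    case False
    define m where "m = (n - 1) div 5"
    have m: "m < n" using False by (simp add: m_def)
    obtain a b where ab: "prod_decode m = (a, b)" by fastforce
    then have mab: "m = prod_encode (a, b)" by (metis prod_decode_inverse)
    obtain s t u where stu: "a = tcode s" "b = tcode t" "m = tcode u"
      using less m mab pe_le by (metis le_less_trans)
    have "n = 5*m+1 \<or> n = 5*m+2 \<or> n = 5*m+3 \<or> n = 5*m+4 \<or> n = 5*m+5"
      unfolding m_def using split_five[OF False] .
    then have "n = tcode (Var m) \<or> n = tcode (Succ u) \<or> n = tcode (Exp u) \<or> n = tcode (s \<oplus> t) \<or> n = tcode (s \<otimes> t)"
      using stu mab by auto
    then show ?thesis by blast
  qed
qed

lemma fcode_surj: "\<exists>t. n = fcode t"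
proof (induction n rule: less_induct)
  case (less n)
  show ?case
  proof (cases "n = 0")
    case True then show ?thesis by (metis fcode.simps(1))
  next
    case False
    define m where "m = (n - 1) div 4"
    have m: "m < n" using False by (simp add: m_def)
    obtain a b where ab: "prod_decode m = (a, b)" by fastforce
    then have mab: "m = prod_encode (a, b)" by (metis prod_decode_inverse)
    obtain s t u where stu: "a = fcode s" "b = fcode t" "m = fcode u"
      using less m mab pe_le by (metis le_less_trans)
    obtain x y where xy: "a = tcode x" "b = tcode y" using tcode_surj by metis
    have "n = 4*m+1 \<or> n = 4*m+2 \<or> n = 4*m+3 \<or> n = 4*m+4"
      unfolding m_def using split_four[OF False] .
    then have "n = fcode (x \<doteq> y) \<or> n = fcode (x \<preceq> y) \<or> n = fcode (s \<rightharpoonup> t) \<or> n = fcode (All u)"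
      using stu xy mab by auto
    then show ?thesis by blast
  qed
qed

definition rel2 :: "nat \<Rightarrow> nat \<Rightarrow> nat \<Rightarrow> bool" where
  "rel2 F a b \<longleftrightarrow> prod_encode (a, b) \<in> set_decode F"
definition rel3 :: "nat \<Rightarrow> nat \<Rightarrow> nat \<Rightarrow> nat \<Rightarrow> bool" where
  "rel3 F a b c \<longleftrightarrow> prod_encode (a, prod_encode (b, c)) \<in> set_decode F"

primrec mapt :: "(nat \<Rightarrow> tm) \<Rightarrow> tm \<Rightarrow> tm" where
  "mapt h Zero = Zero"
| "mapt h (Var n) = h n"
| "mapt h (Succ t) = Succ (mapt h t)"
| "mapt h (Exp t) = Exp (mapt h t)"
| "mapt h (s \<oplus> t) = mapt h s \<oplus> mapt h t"
| "mapt h (s \<otimes> t) = mapt h s \<otimes> mapt h t"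

primrec mapf :: "(nat \<Rightarrow> tm \<Rightarrow> tm) \<Rightarrow> nat \<Rightarrow> fm \<Rightarrow> fm" where
  "mapf g c Bot = Bot"
| "mapf g c (s \<doteq> t) = (g c s \<doteq> g c t)"
| "mapf g c (s \<preceq> t) = (g c s \<preceq> g c t)"
| "mapf g c (A \<rightharpoonup> B) = (mapf g c A \<rightharpoonup> mapf g c B)"
| "mapf g c (All A) = All (mapf g (Suc c) A)"

definition stepT :: "(nat \<Rightarrow> tm) \<Rightarrow> (nat \<Rightarrow> nat \<Rightarrow> bool) \<Rightarrow> nat \<Rightarrow> nat \<Rightarrow> bool" where
  "stepT h R a b \<longleftrightarrow> (a = 0 \<and> b = 0) \<or> (\<exists>n. a = 5*n+1 \<and> b = tcode (h n)) \<or>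
    (\<exists>c d. R c d \<and> (a = 5*c+2 \<and> b = 5*d+2 \<or> a = 5*c+3 \<and> b = 5*d+3)) \<or>
    (\<exists>c c' d d'. R c d \<and> R c' d' \<and> (a = 5*prod_encode(c,c')+4 \<and> b = 5*prod_encode(d,d')+4
       \<or> a = 5*prod_encode(c,c')+5 \<and> b = 5*prod_encode(d,d')+5))"

lemma sat_MapT_step:
  assumes leaf: "\<And>e q c n b. sat e (leaf q c n b) \<longleftrightarrow> nval e b = tcode (h (nval e q) (nval e c) (nval e n))"
  shows "sat e (MapT_step leaf q c F a b) \<longleftrightarrow>
    stepT (h (nval e q) (nval e c)) (rel2 (nval e F)) (nval e a) (nval e b)"
proof -
  have 1: "(\<exists>c\<le>y. \<exists>d\<le>y. prod_encode (c,d) \<in> set_decode y \<and> P c d) = (\<exists>c d. rel2 y c d \<and> P c d)" for P y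
    unfolding rel2_def using mem2_le by blast
  have 2: "(\<exists>c\<le>y. \<exists>c'\<le>y. \<exists>d\<le>y. \<exists>d'\<le>y. prod_encode (c,d) \<in> set_decode y \<and> prod_encode (c',d') \<in> set_decode y \<and> P c c' d d')
    = (\<exists>c c' d d'. rel2 y c d \<and> rel2 y c' d' \<and> P c c' d d')" for P y
    unfolding rel2_def using mem2_le by blast
  have 3: "(\<exists>n\<le>a. a = Suc (5 * n) \<and> P n) = (\<exists>n. a = Suc (5*n) \<and> P n)" for P and a :: nat by auto
  show ?thesis
    by (simp add: MapT_step_def stepT_def leaf 1 2 3)
qed

lemma stepT_sound:
  assumes "\<And>a b. R a b \<Longrightarrow> stepT h R a b"
  shows "R (tcode s) b \<Longrightarrow> b = tcode (mapt h s)"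
proof (induction s arbitrary: b)
  case Zero
  from assms[OF Zero] show ?case
    unfolding stepT_def tcode.simps mapt.simps five prod_encode_eq prod.inject using TrueI by blast
next
  case (Var n)
  from assms[OF Var] show ?case
    unfolding stepT_def tcode.simps mapt.simps five prod_encode_eq prod.inject using TrueI by blast
next
  case (Succ s)
  from assms[OF Succ(2)] show ?case
    unfolding stepT_def tcode.simps mapt.simps five prod_encode_eq prod.inject using Succ(1) by blast
next
  case (Exp s)
  from assms[OF Exp(2)] show ?case
    unfolding stepT_def tcode.simps mapt.simps five prod_encode_eq prod.inject using Exp(1) by blast
next
  case (Add s t)
  from assms[OF Add(3)] show ?case
    unfolding stepT_def tcode.simps mapt.simps five prod_encode_eq prod.inject using Add(1,2) by blast
next
  case (Mul s t)
  from assms[OF Mul(3)] show ?case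
    unfolding stepT_def tcode.simps mapt.simps five prod_encode_eq prod.inject using Mul(1,2) by blast
qed

lemma pe_mono: "a \<le> a' \<Longrightarrow> b \<le> b' \<Longrightarrow> prod_encode (a,b) \<le> prod_encode (a',b')"
proof -
  assume *: "a \<le> a'" "b \<le> b'"
  have "triangle m \<le> triangle n" if "m \<le> n" for m n
    using that by (induction rule: dec_induct) auto
  with * show ?thesis unfolding prod_encode_def by (simp add: add_mono)
qed

lemma tcode_sub: "tcode s \<le> tcode (Succ s)" "tcode s \<le> tcode (Exp s)"
  "tcode s \<le> tcode (s \<oplus> t)" "tcode t \<le> tcode (s \<oplus> t)"
  "tcode s \<le> tcode (s \<otimes> t)" "tcode t \<le> tcode (s \<otimes> t)"
  using pe_le[of "tcode s" "tcode t"] pe_le[of "tcode t" "tcode s"] pe_le(2)[of "tcode t" "tcode s"] by simp_all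

lemma stepT_complete:
  fixes a b :: nat and h :: "nat \<Rightarrow> tm"
  defines "R \<equiv> \<lambda>x y. \<exists>t. x = tcode t \<and> y = tcode (mapt h t) \<and> x \<le> a \<and> y \<le> b"
  assumes "R x y" shows "stepT h R x y"
proof -
  obtain t where t: "x = tcode t" "y = tcode (mapt h t)" "x \<le> a" "y \<le> b" using assms by blast
  have RI: "R (tcode t) (tcode (mapt h t))" if "tcode t \<le> a" "tcode (mapt h t) \<le> b" for t
    using that unfolding R_def by blast
  show ?thesis
  proof (cases t)
    case (Succ s)
    then have "R (tcode s) (tcode (mapt h s))" unfolding R_def using t by auto
    then show ?thesis unfolding stepT_def using t Succ by auto
  next
    case (Exp s)
    then have "R (tcode s) (tcode (mapt h s))" unfolding R_def using t by auto
    then show ?thesis unfolding stepT_def using t Exp by auto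
  next
    case (Add s s')
    have "R (tcode s) (tcode (mapt h s))" "R (tcode s') (tcode (mapt h s'))"
      using t tcode_sub(3)[of s s'] tcode_sub(4)[of s' s] tcode_sub(3)[of "mapt h s" "mapt h s'"] tcode_sub(4)[of "mapt h s'" "mapt h s"] Add
      by (auto simp del: tcode.simps intro!: RI)
    then show ?thesis unfolding stepT_def t Add tcode.simps mapt.simps five prod_encode_eq prod.inject by blast
  next
    case (Mul s s')
    have "R (tcode s) (tcode (mapt h s))" "R (tcode s') (tcode (mapt h s'))"
      using t tcode_sub(5)[of s s'] tcode_sub(6)[of s' s] tcode_sub(5)[of "mapt h s" "mapt h s'"] tcode_sub(6)[of "mapt h s'" "mapt h s"] Mul
      by (auto simp del: tcode.simps intro!: RI)
    then show ?thesis unfolding stepT_def t Mul tcode.simps mapt.simps five prod_encode_eq prod.inject by blast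
  qed (use t in \<open>auto simp: stepT_def\<close>)
qed

lemma sat_MapT:
  assumes leaf: "\<And>e q c n b. sat e (leaf q c n b) \<longleftrightarrow> nval e b = tcode (h (nval e q) (nval e c) (nval e n))"
    and s: "nval e a = tcode s"
  shows "sat e (MapT leaf q c a b) \<longleftrightarrow> nval e b = tcode (mapt (h (nval e q) (nval e c)) s)"
proof -
  let ?h = "h (nval e q) (nval e c)"
  have 1: "(\<forall>a\<le>F. \<forall>b\<le>F. prod_encode (a,b) \<in> set_decode F \<longrightarrow> P a b) = (\<forall>a b. rel2 F a b \<longrightarrow> P a b)" for P F
    unfolding rel2_def using mem2_le by blast
  have "sat e (MapT leaf q c a b) \<longleftrightarrow>
     (\<exists>F\<le>2 * 2 ^ (2 * prod_encode (nval e a, nval e b)). rel2 F (nval e a) (nval e b) \<and>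
        (\<forall>x y. rel2 F x y \<longrightarrow> stepT ?h (rel2 F) x y))" (is "_ \<longleftrightarrow> ?R")
    by (simp add: MapT_def sat_MapT_step[where h=h, OF leaf] 1)
       (simp add: rel2_def)
  also have "\<dots> \<longleftrightarrow> nval e b = tcode (mapt ?h s)"
  proof
    assume ?R then show "nval e b = tcode (mapt ?h s)" using stepT_sound[of _ ?h s] s by auto
  next
    assume b: "nval e b = tcode (mapt ?h s)"
    let ?Q = "\<lambda>x y. \<exists>t. x = tcode t \<and> y = tcode (mapt ?h t) \<and> x \<le> nval e a \<and> y \<le> nval e b"
    let ?X = "{prod_encode (x,y) | x y. ?Q x y}"
    have sub: "?X \<subseteq> {..prod_encode (nval e a, nval e b)}" using pe_mono by auto
    then have fin: "finite ?X" using finite_subset by blast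
    have rel: "rel2 (set_encode ?X) = ?Q" by (simp add: rel2_def fin fun_eq_iff)
    have "set_encode ?X \<le> 2 * 2 ^ (2 * prod_encode (nval e a, nval e b))"
      by (rule set_encode_mono[OF sub]) simp
    moreover have "?Q (nval e a) (nval e b)" using s b by auto
    ultimately show ?R using stepT_complete[where a="nval e a" and h="?h" and b="nval e b"] rel by (intro exI[of _ "set_encode ?X"]) auto
  qed
  finally show ?thesis .
qed

lemma lift_mapt: "lift_tm c d s = mapt (\<lambda>n. Var (if n < c then n else n + d)) s" by (induction s) auto
lemma subst_mapt: "subst_tm k s t = mapt (\<lambda>n. if n < k then Var n else if n = k then lift_tm 0 k s else Var (n - 1)) t" by (induction t) auto

lemma sat_LiftT:
  assumes "nval e a = tcode s"
  shows "sat e (LiftT d c a b) \<longleftrightarrow> nval e b = tcode (lift_tm (nval e c) (nval e d) s)"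
  unfolding LiftT_def lift_mapt
  by (subst sat_MapT[where h = "\<lambda>d c n. Var (if n < c then n else n + d)", OF _ assms]) auto

lemma sat_SubstT:
  assumes "nval e a = tcode t"
  shows "sat e (SubstT s k a b) \<longleftrightarrow> nval e b = tcode (subst_tm (nval e k) (inv tcode (nval e s)) t)"
proof -
  have [simp]: "tcode (inv tcode x) = x" for x using tcode_surj[of x] f_inv_into_f[of x tcode UNIV] by auto
  have *: "sat e (LiftT k Zero s b) \<longleftrightarrow> nval e b = tcode (lift_tm 0 (nval e k) (inv tcode (nval e s)))" for e k s b
    by (subst sat_LiftT[where s="inv tcode (nval e s)"]) auto
  have 3: "(\<exists>m\<le>n. n = Suc m \<and> P m) = (\<exists>m. n = Suc m \<and> P m)" for P n by auto
  show ?thesis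
  unfolding SubstT_def subst_mapt
  apply (subst sat_MapT[where h = "\<lambda>s k n. if n < k then Var n else if n = k then lift_tm 0 k (inv tcode s) else Var (n - 1)", OF _ assms])
   apply (auto simp: * 3 less_eq_Suc_le)
  done
qed

definition stepF :: "(nat \<Rightarrow> tm \<Rightarrow> tm) \<Rightarrow> (nat \<Rightarrow> nat \<Rightarrow> nat \<Rightarrow> bool) \<Rightarrow> nat \<Rightarrow> nat \<Rightarrow> nat \<Rightarrow> bool" where
  "stepF g R c a b \<longleftrightarrow> (a = 0 \<and> b = 0) \<or>
    (\<exists>s t. a = fcode (s \<doteq> t) \<and> b = fcode (g c s \<doteq> g c t) \<or> a = fcode (s \<preceq> t) \<and> b = fcode (g c s \<preceq> g c t)) \<or>
    (\<exists>x y x' y'. R c x x' \<and> R c y y' \<and> a = 4*prod_encode(x,y)+3 \<and> b = 4*prod_encode(x',y')+3) \<or>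
    (\<exists>x x'. R (Suc c) x x' \<and> a = 4*x+4 \<and> b = 4*x'+4)"

lemma sat_MapF_step:
  assumes g: "\<And>e q c a b s. nval e a = tcode s \<Longrightarrow>
     sat e (G q c a b) \<longleftrightarrow> nval e b = tcode (g (nval e q) (nval e c) s)"
   and le: "nval e a \<le> nval e F" "nval e b \<le> nval e F"
  shows "sat e (MapF_step G q F c a b) \<longleftrightarrow>
    stepF (g (nval e q)) (rel3 (nval e F)) (nval e c) (nval e a) (nval e b)"
proof -
  have le': "prod_encode (k,prod_encode(c,d)) \<in> set_decode y \<Longrightarrow> c \<le> y \<and> d \<le> y" for k c d y
    using mem3_le by blast
  have 1: "(\<exists>c\<le>y. \<exists>d\<le>y. prod_encode (k,prod_encode(c,d)) \<in> set_decode y \<and> P c d) = (\<exists>c d. rel3 y k c d \<and> P c d)" for P y k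
    unfolding rel3_def by (metis le')
  have 2: "(\<exists>c\<le>y. \<exists>c'\<le>y. \<exists>d\<le>y. \<exists>d'\<le>y. prod_encode (k,prod_encode (c,d)) \<in> set_decode y \<and> prod_encode (k,prod_encode (c',d')) \<in> set_decode y \<and> P c c' d d')
    = (\<exists>c c' d d'. rel3 y k c d \<and> rel3 y k c' d' \<and> P c c' d d')" for P y k
    unfolding rel3_def by (metis le')
  have g': "sat e (G q c a b) \<longleftrightarrow> nval e b = tcode (g (nval e q) (nval e c) (inv tcode (nval e a)))" for e q c a b
    using tcode_surj[of "nval e a"] f_inv_into_f[of "nval e a" tcode UNIV] by (intro g) auto
  let ?a = "nval e a" and ?b = "nval e b" and ?h = "g (nval e q) (nval e c)" and ?F = "nval e F"
  have inv: "inv tcode (tcode x) = x" for x by (simp add: inv_def tcode_inj)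
  have 3: "(\<exists>c\<le>?F. \<exists>c'\<le>?F. \<exists>d\<le>?F. \<exists>d'\<le>?F. d = tcode (?h (inv tcode c)) \<and> d' = tcode (?h (inv tcode c')) \<and>
      (?a = Suc (4*prod_encode (c,c')) \<and> ?b = Suc (4*prod_encode (d,d')) \<or> ?a = Suc (Suc (4*prod_encode (c,c'))) \<and> ?b = Suc (Suc (4*prod_encode (d,d')))))
    = (\<exists>s t. ?a = fcode (s \<doteq> t) \<and> ?b = fcode (?h s \<doteq> ?h t) \<or> ?a = fcode (s \<preceq> t) \<and> ?b = fcode (?h s \<preceq> ?h t))" (is "?L = ?R")
  proof
    assume ?L then show ?R using tcode_surj inv by (auto; metis)
  next
    have *: "x \<le> Suc (4 * prod_encode (x,y))" "y \<le> Suc (4 * prod_encode (x,y))"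
      "x \<le> Suc (Suc (4 * prod_encode (x,y)))" "y \<le> Suc (Suc (4 * prod_encode (x,y)))" for x y
      using pe_le[of x y] pe_le(2)[of y x] by linarith+
    assume ?R
    then obtain s t where "?a = fcode (s \<doteq> t) \<and> ?b = fcode (?h s \<doteq> ?h t) \<or> ?a = fcode (s \<preceq> t) \<and> ?b = fcode (?h s \<preceq> ?h t)"
      by blast
    moreover from this have "tcode s \<le> ?F \<and> tcode t \<le> ?F \<and> tcode (?h s) \<le> ?F \<and> tcode (?h t) \<le> ?F"
      using le * by (auto; meson le_trans)
    ultimately show ?L
      by (intro exI[of _ "tcode s"] exI[of _ "tcode t"] exI[of _ "tcode (?h s)"] exI[of _ "tcode (?h t)"] conjI) (auto simp: inv)
  qed
  show ?thesis
    unfolding MapF_step_def stepF_def using 3 by (simp add: g' 1 2 del: fcode.simps ex_simps)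
qed

lemma tdec[simp]: "tcode (inv tcode x) = x" "inv tcode (tcode t) = t"
  using tcode_surj[of x] f_inv_into_f[of x tcode UNIV] by (auto simp: inv_def tcode_inj)
lemma fdec[simp]: "fcode (inv fcode x) = x" "inv fcode (fcode A) = A"
  using fcode_surj[of x] f_inv_into_f[of x fcode UNIV] by (auto simp: inv_def fcode_inj)

lemma stepF_sound:
  assumes "\<And>c a b. R c a b \<Longrightarrow> stepF g R c a b"
  shows "R c (fcode A) b \<Longrightarrow> b = fcode (mapf g c A)"
proof (induction A arbitrary: c b)
  case Bot from assms[OF Bot] show ?case
    unfolding stepF_def fcode.simps mapf.simps four prod_encode_eq prod.inject by blast
next
  case (Eq s t) from assms[OF Eq] show ?case
    unfolding stepF_def fcode.simps mapf.simps four prod_encode_eq prod.inject tcode_inj by blast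
next
  case (Le s t) from assms[OF Le] show ?case
    unfolding stepF_def fcode.simps mapf.simps four prod_encode_eq prod.inject tcode_inj by blast
next
  case (Imp A B) from assms[OF Imp(3)] show ?case
    unfolding stepF_def fcode.simps mapf.simps four prod_encode_eq prod.inject using Imp(1,2) by blast
next
  case (All A) from assms[OF All(2)] show ?case
    unfolding stepF_def fcode.simps mapf.simps four prod_encode_eq prod.inject using All(1) by blast
qed

lemma fcode_sub: "fcode A < fcode (A \<rightharpoonup> B)" "fcode B < fcode (A \<rightharpoonup> B)"
  "fcode A < fcode (All A)"
  using pe_le[of "fcode A" "fcode B"] pe_le(2)[of "fcode B" "fcode A"] by simp_all

lemma stepF_complete:
  fixes a b c0 :: nat and g :: "nat \<Rightarrow> tm \<Rightarrow> tm"
  defines "R \<equiv> \<lambda>c x y. \<exists>A. x = fcode A \<and> y = fcode (mapf g c A) \<and> c + x \<le> c0 + a \<and> x \<le> a \<and> y \<le> b"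
  assumes "R c x y" shows "stepF g R c x y"
proof -
  obtain A where t: "x = fcode A" "y = fcode (mapf g c A)" "c + x \<le> c0 + a" "x \<le> a" "y \<le> b" using assms by blast
  have RI: "R c (fcode t) (fcode (mapf g c t))" if "c + fcode t \<le> c0 + a" "fcode t \<le> a" "fcode (mapf g c t) \<le> b" for c t
    using that unfolding R_def by blast
  show ?thesis
  proof (cases A)
    case Bot then show ?thesis using t by (auto simp: stepF_def)
  next
    case (Eq s s') then show ?thesis using t unfolding stepF_def by (metis mapf.simps(2))
  next
    case (Le s s') then show ?thesis using t unfolding stepF_def by (metis mapf.simps(3))
  next
    case (Imp B C)
    have "R c (fcode B) (fcode (mapf g c B))" "R c (fcode C) (fcode (mapf g c C))"
      using t fcode_sub(1)[of B C] fcode_sub(2)[of C B] fcode_sub(1)[of "mapf g c B" "mapf g c C"] fcode_sub(2)[of "mapf g c C" "mapf g c B"] Imp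
      by (auto simp del: fcode.simps intro!: RI)
    then show ?thesis unfolding stepF_def t Imp fcode.simps mapf.simps four prod_encode_eq prod.inject by blast
  next
    case (All B)
    have "R (Suc c) (fcode B) (fcode (mapf g (Suc c) B))"
      using t fcode_sub(3)[of B] fcode_sub(3)[of "mapf g (Suc c) B"] All
      by (auto simp del: fcode.simps intro!: RI)
    then show ?thesis unfolding stepF_def t All fcode.simps mapf.simps four prod_encode_eq prod.inject by blast
  qed
qed

lemma sat_MapF:
  assumes G: "\<And>e q c a b s. nval e a = tcode s \<Longrightarrow>
     sat e (G q c a b) \<longleftrightarrow> nval e b = tcode (g (nval e q) (nval e c) s)"
  and s: "nval e a = fcode A"
  shows "sat e (MapF G q c a b) \<longleftrightarrow> nval e b = fcode (mapf (g (nval e q)) (nval e c) A)"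
proof -
  let ?g = "g (nval e q)"
  let ?B = "2 * prod_encode (nval e c + nval e a, 2 * prod_encode (nval e a, nval e b))"
  have 1: "(\<forall>k\<le>F. \<forall>a\<le>F. \<forall>b\<le>F. rel3 F k a b \<longrightarrow> P k a b) = (\<forall>k a b. rel3 F k a b \<longrightarrow> P k a b)" for P F
    unfolding rel3_def using mem3_le by blast
  have "sat e (MapF G q c a b) \<longleftrightarrow>
     (\<exists>F\<le>2 * 2 ^ ?B. rel3 F (nval e c) (nval e a) (nval e b) \<and>
        (\<forall>k x y. rel3 F k x y \<longrightarrow> stepF ?g (rel3 F) k x y))" (is "_ \<longleftrightarrow> ?R")
    apply (simp add: MapF_def sat_MapF_step[where g=g, OF G] 1 flip: rel3_def)
    done
  also have "\<dots> \<longleftrightarrow> nval e b = fcode (mapf ?g (nval e c) A)"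
  proof
    assume ?R then show "nval e b = fcode (mapf ?g (nval e c) A)" using stepF_sound[of _ ?g "nval e c" A] s by auto
  next
    assume b: "nval e b = fcode (mapf ?g (nval e c) A)"
    let ?Q = "\<lambda>k x y. \<exists>A. x = fcode A \<and> y = fcode (mapf ?g k A) \<and> k + x \<le> nval e c + nval e a \<and> x \<le> nval e a \<and> y \<le> nval e b"
    let ?X = "{prod_encode (k, prod_encode (x,y)) | k x y. ?Q k x y}"
    have "prod_encode (k, prod_encode (x,y)) \<le> ?B" if "k + x \<le> nval e c + nval e a" "x \<le> nval e a" "y \<le> nval e b" for k x y
      using that pe_mono[of k "nval e c + nval e a" "prod_encode (x,y)" "2 * prod_encode (nval e a, nval e b)"] pe_mono[of x "nval e a" y "nval e b"] by simp
    then have sub: "?X \<subseteq> {..?B}" by blast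
    then have fin: "finite ?X" using finite_subset by blast
    have rel: "rel3 (set_encode ?X) = ?Q" by (simp add: rel3_def fin fun_eq_iff)
    have "set_encode ?X \<le> 2 * 2 ^ ?B"
      by (rule set_encode_mono[OF sub]) simp
    moreover have "?Q (nval e c) (nval e a) (nval e b)" using s b by auto
    ultimately show ?R using stepF_complete[where a="nval e a" and g="?g" and b="nval e b" and ?c0.0="nval e c"] rel by (intro exI[of _ "set_encode ?X"]) auto
  qed
  finally show ?thesis .
qed

lemma lift_mapf: "lift_fm c d A = mapf (\<lambda>c. lift_tm c d) c A" by (induction A arbitrary: c) auto
lemma subst_mapf: "subst_fm k s A = mapf (\<lambda>k. subst_tm k s) k A" by (induction A arbitrary: k) auto

lemma sat_LiftF:
  "sat e (LiftF d c a b) \<longleftrightarrow> nval e b = fcode (lift_fm (nval e c) (nval e d) (inv fcode (nval e a)))"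
  unfolding LiftF_def lift_mapf
  by (subst sat_MapF[where g="\<lambda>d c. lift_tm c d" and A="inv fcode (nval e a)"]) (auto simp: sat_LiftT)

lemma sat_SubstF:
  "sat e (SubstF s k a b) \<longleftrightarrow> nval e b = fcode (subst_fm (nval e k) (inv tcode (nval e s)) (inv fcode (nval e a)))"
  unfolding SubstF_def subst_mapf
  by (subst sat_MapF[where g="\<lambda>s k. subst_tm k (inv tcode s)" and A="inv fcode (nval e a)"]) (auto simp: sat_SubstT)

lemma lift_tm_closed: "lift_tm c 1 s = s \<longleftrightarrow> fvt s \<subseteq> {..<c}"
  by (induction s) auto
lemma lift_fm_closed: "lift_fm c 1 A = A \<longleftrightarrow> fv A \<subseteq> {..<c}"
proof (induction A arbitrary: c)
  case (All A)
  have "fv A \<subseteq> {..<Suc c} \<longleftrightarrow> {n. Suc n \<in> fv A} \<subseteq> {..<c}"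
    by (auto simp: subset_iff less_Suc_eq_0_disj) (metis not0_implies_Suc)
  then show ?case using All by simp
qed (auto simp: lift_tm_closed[simplified])

lemma sat_Closed[simp]: "sat e (Closed x) \<longleftrightarrow> sentence (inv fcode (nval e x))"
proof -
  have "sat e (Closed x) \<longleftrightarrow> inv fcode (nval e x) = lift_fm 0 1 (inv fcode (nval e x))"
    unfolding Closed_def sat_LiftF by simp (metis fdec)
  then show ?thesis using lift_fm_closed[of 0 "inv fcode (nval e x)"] unfolding sentence_def by auto
qed

definition stepD :: "nat set \<Rightarrow> nat \<Rightarrow> bool" where
  "stepD D z \<longleftrightarrow> z = 0 \<or> (\<exists>s t. z = fcode (s \<doteq> t) \<or> z = fcode (s \<preceq> t)) \<or>
    (\<exists>a b. a \<in> D \<and> b \<in> D \<and> z = 4*prod_encode(a,b)+3) \<or>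
    (\<exists>t B. z = fcode (BAll t B) \<and> fcode B \<in> D)"

lemma tcode_lift_le: "tcode t \<le> tcode (lift_tm c d t)"
  by (induction t) (auto intro: pe_mono)

lemma sat_isDelta0_step: "sat e (isDelta0_step D z) \<longleftrightarrow> stepD (set_decode (nval e D)) (nval e z)"
proof -
  let ?z = "nval e z" and ?D = "set_decode (nval e D)"
  have pe: "x \<le> prod_encode (x,y) + k" "x \<le> 4 * prod_encode (x,y) + k" "y \<le> 4 * prod_encode (x,y) + k"
    "x \<le> Suc (4 * prod_encode (x,y))" "y \<le> Suc (4 * prod_encode (x,y))"
      "x \<le> Suc (Suc (4 * prod_encode (x,y)))" "y \<le> Suc (Suc (4 * prod_encode (x,y)))" for x y k
    using pe_le[of x y] pe_le(2)[of y x] by linarith+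
  have ex: "(\<exists>s t. P (tcode s) (tcode t)) \<longleftrightarrow> (\<exists>a b. P a b)" for P by (metis tdec(1))
  have 1: "(\<exists>a\<le>?z. \<exists>b\<le>?z. ?z = Suc (4*prod_encode(a,b)) \<or> ?z = Suc (Suc (4*prod_encode(a,b)))) \<longleftrightarrow>
     (\<exists>s t. ?z = fcode (s \<doteq> t) \<or> ?z = fcode (s \<preceq> t))"
  proof -
    have "(\<exists>a\<le>?z. \<exists>b\<le>?z. ?z = Suc (4*prod_encode(a,b)) \<or> ?z = Suc (Suc (4*prod_encode(a,b)))) \<longleftrightarrow>
       (\<exists>a b. ?z = Suc (4*prod_encode(a,b)) \<or> ?z = Suc (Suc (4*prod_encode(a,b))))" using pe(4-7) by metis
    then show ?thesis unfolding ex[of "\<lambda>a b. ?z = Suc (4*prod_encode(a,b)) \<or> ?z = Suc (Suc (4*prod_encode(a,b)))", symmetric]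
      by simp
  qed
  have 2: "(\<exists>a\<le>?z. \<exists>b\<le>?z. a \<in> ?D \<and> b \<in> ?D \<and> ?z = 4*prod_encode(a,b)+3) \<longleftrightarrow>
    (\<exists>a b. a \<in> ?D \<and> b \<in> ?D \<and> ?z = 4*prod_encode(a,b)+3)" using pe by auto
  have 3: "(\<exists>t\<le>?z. \<exists>t'\<le>?z. \<exists>l\<le>?z. \<exists>b\<le>?z. \<exists>i\<le>?z. t' = tcode (lift_tm 0 (Suc 0) (inv tcode t)) \<and> l = Suc (Suc (4 * prod_encode (1,t')))
     \<and> i = 4 * prod_encode (l,b) + 3 \<and> ?z = 4 * i + 4 \<and> b \<in> ?D) \<longleftrightarrow> (\<exists>t B. ?z = fcode (BAll t B) \<and> fcode B \<in> ?D)" (is "?L = ?R")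
  proof
    assume ?L then obtain t b where "?z = 4 * (4 * prod_encode (Suc (Suc (4 * prod_encode (1,tcode (lift_tm 0 (Suc 0) (inv tcode t))))),b) + 3) + 4" "b \<in> ?D"
      by blast
    then show ?R by (intro exI[of _ "inv tcode t"] exI[of _ "inv fcode b"]) (simp add: BAll_def)
  next
    assume ?R then obtain t B where z: "?z = fcode (BAll t B)" and B: "fcode B \<in> ?D" by blast
    let ?t' = "tcode (lift_tm 0 (Suc 0) t)" let ?l = "Suc (Suc (4 * prod_encode (1,?t')))"
    let ?i = "4 * prod_encode (?l, fcode B) + 3"
    have z': "?z = 4 * ?i + 4" using z by (simp add: BAll_def)
    have "?i \<le> ?z" using z' by simp
    moreover have "?l \<le> ?i" "fcode B \<le> ?i" using pe by auto
    moreover have "?t' \<le> ?l" using pe by auto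
    moreover have "tcode t \<le> ?t'" by (rule tcode_lift_le)
    ultimately show ?L using z' B
      by (intro exI[of _ "tcode t"] exI[of _ "?t'"] exI[of _ "?l"] exI[of _ "fcode B"] exI[of _ "?i"]) auto
  qed
  show ?thesis using 3 unfolding isDelta0_step_def stepD_def
    by (simp add: sat_LiftT[OF tdec(1)[symmetric]] 1 2 del: fcode.simps ex_simps)
qed

lemma delta0_elim: "delta0 A \<Longrightarrow> A = Bot \<or> (\<exists>s t. A = (s \<doteq> t) \<or> A = (s \<preceq> t)) \<or>
  (\<exists>B C. A = (B \<rightharpoonup> C) \<and> delta0 B \<and> delta0 C) \<or> (\<exists>t B. A = BAll t B \<and> delta0 B)"
  by (erule delta0.cases) auto

lemma fcode_BAll: "fcode B < fcode (BAll t B)"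
  unfolding BAll_def using fcode_sub(2)[of B] fcode_sub(3) less_trans by blast

lemma sat_isDelta0[simp]: "sat e (isDelta0 x) \<longleftrightarrow> delta0 (inv fcode (nval e x))"
proof -
  let ?x = "nval e x"
  have "sat e (isDelta0 x) \<longleftrightarrow>
     (\<exists>F\<le>2 * 2 ^ ?x. ?x \<in> set_decode F \<and> (\<forall>z. z \<in> set_decode F \<longrightarrow> stepD (set_decode F) z))" (is "_ \<longleftrightarrow> ?R")
    by (auto simp add: isDelta0_def sat_isDelta0_step dest: mem_le)
  also have "\<dots> \<longleftrightarrow> delta0 (inv fcode ?x)"
  proof
    assume ?R
    then obtain F where F: "?x \<in> set_decode F" "\<And>z. z \<in> set_decode F \<Longrightarrow> stepD (set_decode F) z" by blast
    have "fcode A \<in> set_decode F \<Longrightarrow> delta0 A" for A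
    proof (induction "fcode A" arbitrary: A rule: less_induct)
      case less
      from F(2)[OF less(2)] consider "A = Bot" | s t where "A = (s \<doteq> t) \<or> A = (s \<preceq> t)" |
        B C where "fcode B \<in> set_decode F" "fcode C \<in> set_decode F" "fcode A = fcode (B \<rightharpoonup> C)" |
        t B where "fcode A = fcode (BAll t B)" "fcode B \<in> set_decode F"
        unfolding stepD_def fcode_inj by (metis fdec(1) fcode.simps(1,4) fcode_inj)
      then show ?case
      proof cases
        case 3 then show ?thesis using less(1)[of B] less(1)[of C] fcode_sub(1)[of B C] fcode_sub(2)[of C B]
          by (simp only: fcode_inj) auto
      next
        case 4 then show ?thesis using less(1)[of B] fcode_BAll[of B t]
          by (simp only: fcode_inj) auto
      qed auto
    qed
    then show "delta0 (inv fcode ?x)" using F(1) by simp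
  next
    assume d: "delta0 (inv fcode ?x)"
    let ?X = "{fcode A | A. delta0 A \<and> fcode A \<le> ?x}"
    have sub: "?X \<subseteq> {..?x}" by auto
    then have fin: "finite ?X" using finite_subset by blast
    have step: "stepD ?X (fcode A)" if "delta0 A" "fcode A \<le> ?x" for A
      using delta0_elim[OF that(1)]
    proof (elim disjE exE conjE)
      fix B C assume *: "A = (B \<rightharpoonup> C)" "delta0 B" "delta0 C"
      then have "fcode B \<in> ?X" "fcode C \<in> ?X" using that(2) fcode_sub(1)[of B C] fcode_sub(2)[of C B] by auto
      then show ?thesis unfolding stepD_def * fcode.simps(4) by blast
    next
      fix B t assume *: "A = BAll t B" "delta0 B"
      then have "fcode B \<in> ?X" using that(2) fcode_BAll[of B t] by auto
      then show ?thesis unfolding stepD_def * by blast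
    qed (auto simp: stepD_def fcode_inj simp del: fcode.simps, auto)
    have "set_encode ?X \<le> 2 * 2 ^ ?x" by (rule set_encode_mono[OF sub]) simp
    moreover have "?x \<in> ?X" using d by (metis (mono_tags, lifting) fdec(1) mem_Collect_eq order_refl)
    moreover have "\<forall>z. z \<in> ?X \<longrightarrow> stepD ?X z" using step by blast
    ultimately show ?R by (intro exI[of _ "set_encode ?X"]) (unfold set_encode_inverse[OF fin], blast)
  qed
  finally show ?thesis .
qed

lemma sat_isPi1[simp]: "sat e (isPi1 x) \<longleftrightarrow> pi1 (inv fcode (nval e x))"
proof -
  let ?x = "nval e x"
  have "sat e (isPi1 x) \<longleftrightarrow>
     (\<exists>F\<le>2 * 2 ^ ?x. ?x \<in> set_decode F \<and> (\<forall>z. z \<in> set_decode F \<longrightarrow> delta0 (inv fcode z) \<or> (\<exists>a. z = 4*a+4 \<and> a \<in> set_decode F)))" (is "_ \<longleftrightarrow> ?R")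
  proof -
    have "(\<forall>z\<le>F. z \<in> set_decode F \<longrightarrow> delta0 (inv fcode z) \<or> (\<exists>a\<le>z. z = 4*a+4 \<and> a \<in> set_decode F))
       = (\<forall>z. z \<in> set_decode F \<longrightarrow> delta0 (inv fcode z) \<or> (\<exists>a. z = 4*a+4 \<and> a \<in> set_decode F))" for F
    proof -
      have "(\<exists>a\<le>z. z = 4*a+4 \<and> a \<in> set_decode F) = (\<exists>a. z = 4*a+4 \<and> a \<in> set_decode F)" for z by auto
      then show ?thesis using mem_le by auto
    qed
    then show ?thesis by (simp add: isPi1_def)
  qed
  also have "\<dots> \<longleftrightarrow> pi1 (inv fcode ?x)"
  proof
    assume ?R
    then obtain F where F: "?x \<in> set_decode F" "\<And>z. z \<in> set_decode F \<Longrightarrow> delta0 (inv fcode z) \<or> (\<exists>a. z = 4*a+4 \<and> a \<in> set_decode F)" by blast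
    have "fcode A \<in> set_decode F \<Longrightarrow> pi1 A" for A
    proof (induction "fcode A" arbitrary: A rule: less_induct)
      case less
      from F(2)[OF less(2)] consider "delta0 A" |
        B where "fcode A = fcode (All B)" "fcode B \<in> set_decode F"
        by (metis fdec fcode.simps(5))
      then show ?case
      proof cases
        case 2 then show ?thesis using less(1)[of B] fcode_sub(3)[of B]
          by (simp only: fcode_inj) (auto intro: pi1.intros)
      qed (auto intro: pi1.intros)
    qed
    then show "pi1 (inv fcode ?x)" using F(1) by simp
  next
    assume d: "pi1 (inv fcode ?x)"
    let ?X = "{fcode A | A. pi1 A \<and> fcode A \<le> ?x}"
    have sub: "?X \<subseteq> {..?x}" by auto
    then have fin: "finite ?X" using finite_subset by blast
    have step: "delta0 A \<or> (\<exists>a. fcode A = 4*a+4 \<and> a \<in> ?X)" if "pi1 A" "fcode A \<le> ?x" for A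
      using that(1)
    proof cases
      case (2 B) then have "fcode B \<in> ?X" using that(2) fcode_sub(3)[of B] by auto
      then show ?thesis unfolding 2 fcode.simps by blast
    qed auto
    have "set_encode ?X \<le> 2 * 2 ^ ?x" by (rule set_encode_mono[OF sub]) simp
    moreover have "?x \<in> ?X" using d by (metis (mono_tags, lifting) fdec(1) mem_Collect_eq order_refl)
    moreover have "\<forall>z. z \<in> ?X \<longrightarrow> delta0 (inv fcode z) \<or> (\<exists>a. z = 4*a+4 \<and> a \<in> ?X)" using step by fastforce
    ultimately show ?R by (intro exI[of _ "set_encode ?X"]) (unfold set_encode_inverse[OF fin], blast)
  qed
  finally show ?thesis .
qed

definition "succc a = 5 * a + (2::nat)"
definition "expc a = 5 * a + (3::nat)"
definition "addc a b = 5 * prod_encode (a,b) + 4"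
definition "mulc a b = 5 * prod_encode (a,b) + 5"
definition "eqc a b = 4 * prod_encode (a,b) + 1"
definition "lec a b = 4 * prod_encode (a,b) + 2"
definition "impc a b = 4 * prod_encode (a,b) + 3"
definition "allc a = 4 * a + (4::nat)"
lemmas c_defs = succc_def expc_def addc_def mulc_def eqc_def lec_def impc_def allc_def

lemma csat:
  "sat e (isAdd x a b) \<longleftrightarrow> nval e x = addc (nval e a) (nval e b)"
  "sat e (isMul x a b) \<longleftrightarrow> nval e x = mulc (nval e a) (nval e b)"
  "sat e (isEq x a b) \<longleftrightarrow> nval e x = eqc (nval e a) (nval e b)"
  "sat e (isLe x a b) \<longleftrightarrow> nval e x = lec (nval e a) (nval e b)"
  "sat e (isImp x a b) \<longleftrightarrow> nval e x = impc (nval e a) (nval e b)"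
  "nval e (succT a) = succc (nval e a)"
  "nval e (expT a) = expc (nval e a)"
  "nval e (allT a) = allc (nval e a)"
  by (simp_all add: c_defs)
lemma ccode:
  "tcode (Succ s) = succc (tcode s)" "tcode (Exp s) = expc (tcode s)"
  "tcode (s \<oplus> t) = addc (tcode s) (tcode t)" "tcode (s \<otimes> t) = mulc (tcode s) (tcode t)"
  "fcode (s \<doteq> t) = eqc (tcode s) (tcode t)" "fcode (s \<preceq> t) = lec (tcode s) (tcode t)"
  "fcode (A \<rightharpoonup> B) = impc (fcode A) (fcode B)" "fcode (All A) = allc (fcode A)"
  by (simp_all add: c_defs)

lemma cle:
  "x \<le> a \<Longrightarrow> x \<le> succc a" "x \<le> a \<Longrightarrow> x \<le> expc a" "x \<le> a \<Longrightarrow> x \<le> allc a"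
  "x \<le> a \<Longrightarrow> x \<le> addc a b" "x \<le> b \<Longrightarrow> x \<le> addc a b"
  "x \<le> a \<Longrightarrow> x \<le> mulc a b" "x \<le> b \<Longrightarrow> x \<le> mulc a b"
  "x \<le> a \<Longrightarrow> x \<le> eqc a b" "x \<le> b \<Longrightarrow> x \<le> eqc a b"
  "x \<le> a \<Longrightarrow> x \<le> lec a b" "x \<le> b \<Longrightarrow> x \<le> lec a b"
  "x \<le> a \<Longrightarrow> x \<le> impc a b" "x \<le> b \<Longrightarrow> x \<le> impc a b"
  using pe_le[of a b] pe_le(2)[of b a] by (simp_all add: c_defs)

lemmas csimp = sat_BExis sat_conn csat ccode
lemmas nois = sat_is nval_codes(2,3,4) tcode.simps(3-6) fcode.simps(2-5)

lemma lax_K: "sat e (BExis 3 x (isImp (Var 0) (Var 1) (Var 2) \<sqinter> isImp (up 3 x) (Var 2) (Var 0))) \<longleftrightarrow>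
  (\<exists>A B. nval e x = fcode (A \<rightharpoonup> B \<rightharpoonup> A))" (is "?L \<longleftrightarrow> ?R")
proof
  assume ?L then obtain a b where "nval e x = impc a (impc b a)" by (auto simp: csat simp del: nois)
  then show ?R by (intro exI[of _ "inv fcode a"] exI[of _ "inv fcode b"]) (simp add: ccode del: nois)
qed (auto simp: csat ccode intro!: cle simp del: nois; blast intro: cle order_refl)

lemma lax_S: "sat e (BExis 8 x (isImp (Var 4) (Var 6) (Var 5) \<sqinter> isImp (Var 3) (Var 7) (Var 4) \<sqinter>
       isImp (Var 2) (Var 7) (Var 6) \<sqinter> isImp (Var 1) (Var 7) (Var 5) \<sqinter>
       isImp (Var 0) (Var 2) (Var 1) \<sqinter> isImp (up 8 x) (Var 3) (Var 0))) \<longleftrightarrow>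
  (\<exists>A B C. nval e x = fcode ((A \<rightharpoonup> B \<rightharpoonup> C) \<rightharpoonup> (A \<rightharpoonup> B) \<rightharpoonup> A \<rightharpoonup> C))" (is "?L \<longleftrightarrow> ?R")
proof
  assume ?L then obtain a b c where "nval e x = impc (impc a (impc b c)) (impc (impc a b) (impc a c))" by (auto simp: csat simp del: nois)
  then show ?R by (intro exI[of _ "inv fcode a"] exI[of _ "inv fcode b"] exI[of _ "inv fcode c"]) (simp add: ccode del: nois)
next
  assume ?R then obtain A B C where "nval e x = fcode ((A \<rightharpoonup> B \<rightharpoonup> C) \<rightharpoonup> (A \<rightharpoonup> B) \<rightharpoonup> A \<rightharpoonup> C)" by blast
  then show ?L
    apply (simp add: csat ccode del: nois)
    apply (rule exI[of _ "fcode A"], rule conjI, blast intro: cle order_refl)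
    apply (rule exI[of _ "fcode B"], rule conjI, blast intro: cle order_refl)
    apply (rule exI[of _ "fcode C"], rule conjI, blast intro: cle order_refl)
    apply (simp add: cle)
    done
qed

lemma lax_DN: "sat e (BExis 3 x (isImp (Var 1) (Var 2) Zero \<sqinter> isImp (Var 0) (Var 1) Zero \<sqinter>
       isImp (up 3 x) (Var 0) (Var 2))) \<longleftrightarrow>
  (\<exists>A. nval e x = fcode (((A \<rightharpoonup> Bot) \<rightharpoonup> Bot) \<rightharpoonup> A))" (is "?L \<longleftrightarrow> ?R")
proof
  assume ?L then obtain a where "nval e x = impc (impc (impc a 0) 0) a" by (auto simp: csat simp del: nois)
  then show ?R by (intro exI[of _ "inv fcode a"]) (simp add: ccode del: nois)
next
  assume ?R then obtain A where *: "nval e x = fcode (((A \<rightharpoonup> Bot) \<rightharpoonup> Bot) \<rightharpoonup> A)" by blast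
  have d0: ?L if x: "nval e x = fcode (((A \<rightharpoonup> Bot) \<rightharpoonup> Bot) \<rightharpoonup> A)"
    apply (insert x, simp add: csat ccode del: nois)
    apply (rule exI[of _ "fcode A"], rule conjI, blast intro: cle order_refl)
    apply ((simp add: cle; fail) | (intro conjI cle order_refl; (rule refl | blast intro: cle order_refl)))
    done
  show ?L using * d0 by blast
qed

lemma subst_tm_bound: "(\<forall>s'. subst_tm k s' t = subst_tm k s t) \<or> tcode s \<le> tcode (subst_tm k s t)"
  by (induction t) (auto simp: ccode tcode_lift_le simp del: nois intro: cle)
lemma subst_fm_bound: "(\<forall>s'. subst_fm k s' A = subst_fm k s A) \<or> tcode s \<le> fcode (subst_fm k s A)"
proof (induction A arbitrary: k)
  case (Eq t u) then show ?case using subst_tm_bound[of k t s] subst_tm_bound[of k u s] by (auto simp: ccode simp del: nois intro: cle)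
next
  case (Le t u) then show ?case using subst_tm_bound[of k t s] subst_tm_bound[of k u s] by (auto simp: ccode simp del: nois intro: cle)
next
  case (Imp B C) from this[of k] show ?case by (auto simp: ccode simp del: nois intro: cle)
next
  case (All B) from this[of "Suc k"] show ?case by (auto simp: ccode simp del: nois intro: cle)
qed simp

lemma lax_Inst: "sat e (BExis 3 x (SubstF (Var 1) Zero (Var 2) (Var 0) \<sqinter> isImp (up 3 x) (allT (Var 2)) (Var 0))) \<longleftrightarrow>
  (\<exists>A s. nval e x = fcode (All A \<rightharpoonup> subst_fm 0 s A))" (is "?L \<longleftrightarrow> ?R")
proof
  assume ?L then obtain a s where "nval e x = impc (allc a) (fcode (subst_fm 0 (inv tcode s) (inv fcode a)))"
    by (auto simp: csat sat_SubstF simp del: nois)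
  then show ?R by (intro exI[of _ "inv fcode a"] exI[of _ "inv tcode s"]) (simp add: ccode del: nois)
next
  assume ?R then obtain A s where x: "nval e x = fcode (All A \<rightharpoonup> subst_fm 0 s A)" by blast
  obtain s' where s': "subst_fm 0 s' A = subst_fm 0 s A" "tcode s' \<le> fcode (subst_fm 0 s A)"
    using subst_fm_bound[of 0 A s] by (metis le0 tcode.simps(1))
  with x show ?L
    by (simp add: csat ccode sat_SubstF del: nois, intro exI[of _ "fcode A"] exI[of _ "tcode s'"])
      (simp add: cle, intro exI[of _ "tcode s'"], simp add: cle)
qed

lemma lax_Dist: "sat e (BExis 5 x (LiftF (num 1) Zero (Var 4) (Var 2) \<sqinter> isImp (Var 1) (Var 2) (Var 3) \<sqinter>
       isImp (Var 0) (Var 4) (allT (Var 3)) \<sqinter> isImp (up 5 x) (allT (Var 1)) (Var 0))) \<longleftrightarrow>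
  (\<exists>A B. nval e x = fcode (All (lift_fm 0 1 A \<rightharpoonup> B) \<rightharpoonup> A \<rightharpoonup> All B))" (is "?L \<longleftrightarrow> ?R")
proof
  assume ?L then obtain a b where "nval e x = impc (allc (impc (fcode (lift_fm 0 1 (inv fcode a))) b)) (impc a (allc b))"
    by (auto simp: csat sat_LiftF simp del: nois)
  then show ?R by (intro exI[of _ "inv fcode a"] exI[of _ "inv fcode b"]) (simp add: ccode del: nois)
next
  assume ?R then obtain A B where "nval e x = fcode (All (lift_fm 0 1 A \<rightharpoonup> B) \<rightharpoonup> A \<rightharpoonup> All B)" by blast
  then show ?L
    by (simp add: csat ccode sat_LiftF del: nois, intro exI[of _ "fcode A"] exI[of _ "fcode B"])
      (simp add: cle, intro exI[of _ "fcode B"], simp add: cle)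
qed

lemma lax_Refl: "sat e (BExi x (isEq (up 1 x) (Var 0) (Var 0))) \<longleftrightarrow>
  (\<exists>s. nval e x = fcode (s \<doteq> s))" (is "?L \<longleftrightarrow> ?R")
proof
  assume ?L then obtain a where "nval e x = eqc a a" by (auto simp: csat simp del: nois)
  then show ?R by (intro exI[of _ "inv tcode a"]) (simp add: ccode del: nois)
next
  assume ?R then obtain s where *: "nval e x = fcode (s \<doteq> s)" by blast
  have d0: ?L if x: "nval e x = fcode (s \<doteq> s)"
    apply (insert x, simp add: csat ccode del: nois)
    apply (rule exI[of _ "tcode s"], rule conjI, blast intro: cle order_refl)
    apply ((simp add: cle; fail) | (intro conjI cle order_refl; (rule refl | blast intro: cle order_refl)))
    done
  show ?L using * d0 by blast
qed

lemma lax_Eucl: "sat e (BExis 7 x (isEq (Var 3) (Var 6) (Var 5) \<sqinter> isEq (Var 2) (Var 6) (Var 4) \<sqinter>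
       isEq (Var 1) (Var 5) (Var 4) \<sqinter> isImp (Var 0) (Var 2) (Var 1) \<sqinter> isImp (up 7 x) (Var 3) (Var 0))) \<longleftrightarrow>
  (\<exists>s t u. nval e x = fcode (s \<doteq> t \<rightharpoonup> s \<doteq> u \<rightharpoonup> t \<doteq> u))" (is "?L \<longleftrightarrow> ?R")
proof
  assume ?L then obtain a b c where "nval e x = impc (eqc a b) (impc (eqc a c) (eqc b c))" by (auto simp: csat simp del: nois)
  then show ?R by (intro exI[of _ "inv tcode a"] exI[of _ "inv tcode b"] exI[of _ "inv tcode c"]) (simp add: ccode del: nois)
next
  assume ?R then obtain s t u where *: "nval e x = fcode (s \<doteq> t \<rightharpoonup> s \<doteq> u \<rightharpoonup> t \<doteq> u)" by blast
  have d0: ?L if x: "nval e x = fcode (s \<doteq> t \<rightharpoonup> s \<doteq> u \<rightharpoonup> t \<doteq> u)"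
    apply (insert x, simp add: csat ccode del: nois)
    apply (rule exI[of _ "tcode s"], rule conjI, blast intro: cle order_refl)
    apply (rule exI[of _ "tcode t"], rule conjI, blast intro: cle order_refl)
    apply (rule exI[of _ "tcode u"], rule conjI, blast intro: cle order_refl)
    apply ((simp add: cle; fail) | (intro conjI cle order_refl; (rule refl | blast intro: cle order_refl)))
    done
  show ?L using * d0 by blast
qed

lemma lax_Cong1: "sat e (BExis 4 x (isEq (Var 1) (Var 3) (Var 2) \<sqinter>
       (isEq (Var 0) (succT (Var 3)) (succT (Var 2)) \<squnion> isEq (Var 0) (expT (Var 3)) (expT (Var 2))) \<sqinter>
       isImp (up 4 x) (Var 1) (Var 0))) \<longleftrightarrow>
  (\<exists>s t. nval e x = fcode (s \<doteq> t \<rightharpoonup> Succ s \<doteq> Succ t) \<or> nval e x = fcode (s \<doteq> t \<rightharpoonup> Exp s \<doteq> Exp t))" (is "?L \<longleftrightarrow> ?R")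
proof
  assume ?L then obtain a b where "nval e x = impc (eqc a b) (eqc (succc a) (succc b)) \<or> nval e x = impc (eqc a b) (eqc (expc a) (expc b))" by (auto simp: csat simp del: nois)
  then show ?R by (intro exI[of _ "inv tcode a"] exI[of _ "inv tcode b"]) (simp add: ccode del: nois)
next
  assume ?R then obtain s t where *: "nval e x = fcode (s \<doteq> t \<rightharpoonup> Succ s \<doteq> Succ t) \<or> nval e x = fcode (s \<doteq> t \<rightharpoonup> Exp s \<doteq> Exp t)" by blast
  have d0: ?L if x: "nval e x = fcode (s \<doteq> t \<rightharpoonup> Succ s \<doteq> Succ t)"
    apply (insert x, simp add: csat ccode del: nois)
    apply (rule exI[of _ "tcode s"], rule conjI, blast intro: cle order_refl)
    apply (rule exI[of _ "tcode t"], rule conjI, blast intro: cle order_refl)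
    apply (rule exI[of _ "eqc (tcode s) (tcode t)"], rule conjI, blast intro: cle order_refl)
    apply (rule exI[of _ "eqc (succc (tcode s)) (succc (tcode t))"], rule conjI, blast intro: cle order_refl)
    apply ((simp add: cle; fail) | (intro conjI cle order_refl; (rule refl | blast intro: cle order_refl)))
    done
  have d1: ?L if x: "nval e x = fcode (s \<doteq> t \<rightharpoonup> Exp s \<doteq> Exp t)"
    apply (insert x, simp add: csat ccode del: nois)
    apply (rule exI[of _ "tcode s"], rule conjI, blast intro: cle order_refl)
    apply (rule exI[of _ "tcode t"], rule conjI, blast intro: cle order_refl)
    apply (rule exI[of _ "eqc (tcode s) (tcode t)"], rule conjI, blast intro: cle order_refl)
    apply (rule exI[of _ "eqc (expc (tcode s)) (expc (tcode t))"], rule conjI, blast intro: cle order_refl)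
    apply ((simp add: cle; fail) | (intro conjI cle order_refl; (rule refl | blast intro: cle order_refl)))
    done
  show ?L using * d0 d1 by blast
qed

lemma lax_Cong2: "sat e (BExis 10 x (isEq (Var 5) (Var 9) (Var 8) \<sqinter> isEq (Var 4) (Var 7) (Var 6) \<sqinter>
       ((isAdd (Var 3) (Var 9) (Var 7) \<sqinter> isAdd (Var 2) (Var 8) (Var 6))
      \<squnion> (isMul (Var 3) (Var 9) (Var 7) \<sqinter> isMul (Var 2) (Var 8) (Var 6))) \<sqinter>
       isEq (Var 1) (Var 3) (Var 2) \<sqinter> isImp (Var 0) (Var 4) (Var 1) \<sqinter> isImp (up 10 x) (Var 5) (Var 0))) \<longleftrightarrow>
  (\<exists>s t u v. nval e x = fcode (s \<doteq> t \<rightharpoonup> u \<doteq> v \<rightharpoonup> s \<oplus> u \<doteq> t \<oplus> v) \<or> nval e x = fcode (s \<doteq> t \<rightharpoonup> u \<doteq> v \<rightharpoonup> s \<otimes> u \<doteq> t \<otimes> v))" (is "?L \<longleftrightarrow> ?R")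
proof
  assume ?L then obtain a b c d where "nval e x = impc (eqc a b) (impc (eqc c d) (eqc (addc a c) (addc b d))) \<or> nval e x = impc (eqc a b) (impc (eqc c d) (eqc (mulc a c) (mulc b d)))" by (auto simp: csat simp del: nois)
  then show ?R by (intro exI[of _ "inv tcode a"] exI[of _ "inv tcode b"] exI[of _ "inv tcode c"] exI[of _ "inv tcode d"]) (simp add: ccode del: nois)
next
  assume ?R then obtain s t u v where *: "nval e x = fcode (s \<doteq> t \<rightharpoonup> u \<doteq> v \<rightharpoonup> s \<oplus> u \<doteq> t \<oplus> v) \<or> nval e x = fcode (s \<doteq> t \<rightharpoonup> u \<doteq> v \<rightharpoonup> s \<otimes> u \<doteq> t \<otimes> v)" by blast
  have d0: ?L if x: "nval e x = fcode (s \<doteq> t \<rightharpoonup> u \<doteq> v \<rightharpoonup> s \<oplus> u \<doteq> t \<oplus> v)"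
    apply (insert x, simp add: csat ccode del: nois)
    apply (rule exI[of _ "tcode s"], rule conjI, blast intro: cle order_refl)
    apply (rule exI[of _ "tcode t"], rule conjI, blast intro: cle order_refl)
    apply (rule exI[of _ "tcode u"], rule conjI, blast intro: cle order_refl)
    apply (rule exI[of _ "tcode v"], rule conjI, blast intro: cle order_refl)
    apply (rule exI[of _ "eqc (tcode s) (tcode t)"], rule conjI, blast intro: cle order_refl)
    apply (rule exI[of _ "eqc (tcode u) (tcode v)"], rule conjI, blast intro: cle order_refl)
    apply (rule exI[of _ "addc (tcode s) (tcode u)"], rule conjI, blast intro: cle order_refl)
    apply (rule exI[of _ "addc (tcode t) (tcode v)"], rule conjI, blast intro: cle order_refl)
    apply ((simp add: cle; fail) | (intro conjI cle order_refl; (rule refl | blast intro: cle order_refl)))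
    done
  have d1: ?L if x: "nval e x = fcode (s \<doteq> t \<rightharpoonup> u \<doteq> v \<rightharpoonup> s \<otimes> u \<doteq> t \<otimes> v)"
    apply (insert x, simp add: csat ccode del: nois)
    apply (rule exI[of _ "tcode s"], rule conjI, blast intro: cle order_refl)
    apply (rule exI[of _ "tcode t"], rule conjI, blast intro: cle order_refl)
    apply (rule exI[of _ "tcode u"], rule conjI, blast intro: cle order_refl)
    apply (rule exI[of _ "tcode v"], rule conjI, blast intro: cle order_refl)
    apply (rule exI[of _ "eqc (tcode s) (tcode t)"], rule conjI, blast intro: cle order_refl)
    apply (rule exI[of _ "eqc (tcode u) (tcode v)"], rule conjI, blast intro: cle order_refl)
    apply (rule exI[of _ "mulc (tcode s) (tcode u)"], rule conjI, blast intro: cle order_refl)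
    apply (rule exI[of _ "mulc (tcode t) (tcode v)"], rule conjI, blast intro: cle order_refl)
    apply ((simp add: cle; fail) | (intro conjI cle order_refl; (rule refl | blast intro: cle order_refl)))
    done
  show ?L using * d0 d1 by blast
qed

lemma lax_CongLe: "sat e (BExis 10 x (isEq (Var 5) (Var 9) (Var 8) \<sqinter> isEq (Var 4) (Var 7) (Var 6) \<sqinter>
       isLe (Var 3) (Var 9) (Var 7) \<sqinter> isLe (Var 2) (Var 8) (Var 6) \<sqinter>
       isImp (Var 1) (Var 3) (Var 2) \<sqinter> isImp (Var 0) (Var 4) (Var 1) \<sqinter> isImp (up 10 x) (Var 5) (Var 0))) \<longleftrightarrow>
  (\<exists>s t u v. nval e x = fcode (s \<doteq> t \<rightharpoonup> u \<doteq> v \<rightharpoonup> s \<preceq> u \<rightharpoonup> t \<preceq> v))" (is "?L \<longleftrightarrow> ?R")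
proof
  assume ?L then obtain a b c d where "nval e x = impc (eqc a b) (impc (eqc c d) (impc (lec a c) (lec b d)))" by (auto simp: csat simp del: nois)
  then show ?R by (intro exI[of _ "inv tcode a"] exI[of _ "inv tcode b"] exI[of _ "inv tcode c"] exI[of _ "inv tcode d"]) (simp add: ccode del: nois)
next
  assume ?R then obtain s t u v where *: "nval e x = fcode (s \<doteq> t \<rightharpoonup> u \<doteq> v \<rightharpoonup> s \<preceq> u \<rightharpoonup> t \<preceq> v)" by blast
  have d0: ?L if x: "nval e x = fcode (s \<doteq> t \<rightharpoonup> u \<doteq> v \<rightharpoonup> s \<preceq> u \<rightharpoonup> t \<preceq> v)"
    apply (insert x, simp add: csat ccode del: nois)
    apply (rule exI[of _ "tcode s"], rule conjI, blast intro: cle order_refl)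
    apply (rule exI[of _ "tcode t"], rule conjI, blast intro: cle order_refl)
    apply (rule exI[of _ "tcode u"], rule conjI, blast intro: cle order_refl)
    apply (rule exI[of _ "tcode v"], rule conjI, blast intro: cle order_refl)
    apply ((simp add: cle; fail) | (intro conjI cle order_refl; (rule refl | blast intro: cle order_refl)))
    done
  show ?L using * d0 by blast
qed

lemma sat_isLogAx[simp]: "sat e (isLogAx x) \<longleftrightarrow> log_ax (inv fcode (nval e x))"
proof -
  have "nval e x = fcode A \<longleftrightarrow> inv fcode (nval e x) = A" for A by auto
  note f = this
  show ?thesis
    unfolding isLogAx_def sat_conn(4) lax_K lax_S lax_DN lax_Inst lax_Dist lax_Refl lax_Eucl lax_Cong1 lax_Cong2 lax_CongLe f
    unfolding log_ax.simps ex_disj_distrib disj_assoc ..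
qed


definition prfset :: "(nat \<Rightarrow> nat \<Rightarrow> bool) \<Rightarrow> bool" where
  "prfset R \<longleftrightarrow> (\<forall>i a. R i a \<longrightarrow> log_ax (inv fcode a) \<or>
     (\<exists>j k b. j < i \<and> k < i \<and> R j b \<and> R k (impc b a)) \<or> (\<exists>j b. j < i \<and> R j b \<and> a = allc b))"

lemma sat_Proof: "sat e (Proof y x) \<longleftrightarrow> (\<exists>i. rel2 (nval e y) i (nval e x)) \<and> prfset (rel2 (nval e y))"
proof -
  let ?R = "rel2 (nval e y)"
  have le: "?R i a \<Longrightarrow> i \<le> nval e y \<and> a \<le> nval e y" for i a unfolding rel2_def using mem2_le by blast
  have 1: "(\<exists>i\<le>nval e y. ?R i (nval e x)) = (\<exists>i. ?R i (nval e x))" using le by blast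
  have 2: "(\<exists>j\<le>nval e y. \<exists>k\<le>nval e y. \<exists>b\<le>nval e y. \<exists>c\<le>nval e y. Suc j \<le> i \<and> Suc k \<le> i \<and> ?R j b \<and> ?R k c \<and> c = impc b a)
    = (\<exists>j k b. j < i \<and> k < i \<and> ?R j b \<and> ?R k (impc b a))" for i a using le by (auto simp: less_eq_Suc_le; blast)
  have 3: "(\<exists>j\<le>nval e y. \<exists>b\<le>nval e y. Suc j \<le> i \<and> ?R j b \<and> a = allc b)
    = (\<exists>j b. j < i \<and> ?R j b \<and> a = allc b)" for i a using le by (auto simp: less_eq_Suc_le)
  have 4: "(\<forall>i\<le>nval e y. \<forall>a\<le>nval e y. ?R i a \<longrightarrow> P i a) = (\<forall>i a. ?R i a \<longrightarrow> P i a)" for P using le by blast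
  have 0: "sat e (Proof y x) \<longleftrightarrow> (\<exists>i\<le>nval e y. ?R i (nval e x)) \<and> (\<forall>i\<le>nval e y. \<forall>a\<le>nval e y. ?R i a \<longrightarrow> log_ax (inv fcode a) \<or>
     (\<exists>j\<le>nval e y. \<exists>k\<le>nval e y. \<exists>b\<le>nval e y. \<exists>c\<le>nval e y. Suc j \<le> i \<and> Suc k \<le> i \<and> ?R j b \<and> ?R k c \<and> c = impc b a)
     \<or> (\<exists>j\<le>nval e y. \<exists>b\<le>nval e y. Suc j \<le> i \<and> ?R j b \<and> a = allc b))"
    unfolding rel2_def
    by (simp add: Proof_def Proof_step_def csat del: nois ex_simps HOL.simp_thms(39,40))
  show ?thesis unfolding 0 1 2 3 4 prfset_def ..
qed

lemma prfset_sound: assumes "prfset R" shows "R i a \<Longrightarrow> {} \<turnstile> inv fcode a"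
proof (induction i arbitrary: a rule: less_induct)
  case (less i)
  from assms less(2) consider "log_ax (inv fcode a)" | j k b where "j < i" "k < i" "R j b" "R k (impc b a)"
    | j b where "j < i" "R j b" "a = allc b" unfolding prfset_def by blast
  then show ?case
  proof cases
    case 1 then show ?thesis by (rule proves.Log)
  next
    case 2
    have "impc b a = fcode (inv fcode b \<rightharpoonup> inv fcode a)" by (simp add: ccode del: nois)
    then have "inv fcode (impc b a) = (inv fcode b \<rightharpoonup> inv fcode a)" using fdec(2) by metis
    then show ?thesis using less(1)[OF 2(1,3)] less(1)[OF 2(2,4)] proves.MP by metis
  next
    case 3
    have "allc b = fcode (All (inv fcode b))" by (simp add: ccode del: nois)
    then have "inv fcode a = All (inv fcode b)" using fdec(2) 3 by metis
    then show ?thesis using less(1)[OF 3(1,2)] proves.Gen by metis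
  qed
qed

lemma prfset_insert:
  assumes "prfset R" "\<forall>i a. R i a \<longrightarrow> i < m"
   "log_ax (inv fcode a) \<or> (\<exists>j k b. R j b \<and> R k (impc b a)) \<or> (\<exists>j b. R j b \<and> a = allc b)"
  shows "prfset (\<lambda>i b. R i b \<or> i = m \<and> b = a)"
  using assms unfolding prfset_def by (metis (no_types, opaque_lifting))

definition fin_prf where "fin_prf X = (finite X \<and> prfset (\<lambda>i a. (i,a) \<in> X))"

lemma fin_prf_insert:
  assumes "fin_prf X"
   "log_ax (inv fcode a) \<or> (\<exists>j k b. (j,b) \<in> X \<and> (k, impc b a) \<in> X) \<or> (\<exists>j b. (j,b) \<in> X \<and> a = allc b)"
  shows "\<exists>X i. fin_prf X \<and> (i,a) \<in> X"
proof -
  have "finite (fst ` X)" using assms(1) by (simp add: fin_prf_def)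
  then obtain m where m: "\<forall>i\<in>fst ` X. i < m" using finite_nat_set_iff_bounded by blast
  have "prfset (\<lambda>i b. (i,b) \<in> X \<or> i = m \<and> b = a)"
    using assms m by (intro prfset_insert) (auto simp: fin_prf_def)
  then have "fin_prf (insert (m,a) X)" using assms(1) by (simp add: fin_prf_def disj_commute)
  then show ?thesis by blast
qed

lemma fin_prf_Un: "fin_prf X \<Longrightarrow> fin_prf Y \<Longrightarrow> fin_prf (X \<union> Y)"
  unfolding fin_prf_def prfset_def by (simp, metis)

lemma prfset_complete: "{} \<turnstile> A \<Longrightarrow> \<exists>X i. fin_prf X \<and> (i, fcode A) \<in> X"
proof (induction rule: proves.induct)
  case (Log A) then show ?case by (intro fin_prf_insert[of "{}"]) (auto simp: fin_prf_def prfset_def)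
next
  case (MP A B)
  then obtain X Y i j where "fin_prf X" "(i, fcode A) \<in> X" "fin_prf Y" "(j, fcode (A \<rightharpoonup> B)) \<in> Y" by blast
  then show ?case by (intro fin_prf_insert[OF fin_prf_Un[of X Y]]) (auto simp: ccode simp del: nois)
next
  case (Gen A)
  then obtain X i where "fin_prf X" "(i, fcode A) \<in> X" by blast
  then show ?case by (intro fin_prf_insert[of X]) (auto simp: ccode simp del: nois)
qed simp

theorem Proof_adequate: "(\<exists>y. sat e (Proof (num y) (num (fcode A)))) \<longleftrightarrow> {} \<turnstile> A"
proof
  assume "\<exists>y. sat e (Proof (num y) (num (fcode A)))"
  then show "{} \<turnstile> A" unfolding sat_Proof using prfset_sound by fastforce
next
  assume "{} \<turnstile> A"
  then obtain X i where X: "fin_prf X" "(i, fcode A) \<in> X" using prfset_complete by blast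
  have fin: "finite (prod_encode ` X)" using X by (simp add: fin_prf_def)
  have "rel2 (set_encode (prod_encode ` X)) = (\<lambda>i a. (i,a) \<in> X)"
    unfolding rel2_def set_encode_inverse[OF fin] by (auto simp: fun_eq_iff inj_image_mem_iff[OF inj_prod_encode])
  then show "\<exists>y. sat e (Proof (num y) (num (fcode A)))"
    using X unfolding sat_Proof by (intro exI[of _ "set_encode (prod_encode ` X)"]) (auto simp: fin_prf_def)
qed

lemma fvt_nval: "(\<And>n. n \<in> fvt t \<Longrightarrow> e n = e' n) \<Longrightarrow> nval e t = nval e' t"
  by (induction t) auto
lemma fv_sat: "(\<And>n. n \<in> fv A \<Longrightarrow> e n = e' n) \<Longrightarrow> sat e A = sat e' A"
proof (induction A arbitrary: e e')
  case (All A)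
  have "sat (case_nat n e) A = sat (case_nat n e') A" for n
    by (rule All(1)) (use All(2) in \<open>auto split: nat.split\<close>)
  then show ?case by simp
next
  case (Eq s t) then show ?case using fvt_nval[of s e e'] fvt_nval[of t e e'] by simp
next
  case (Le s t) then show ?case using fvt_nval[of s e e'] fvt_nval[of t e e'] by simp
next
  case (Imp A B) from Imp(1)[of e e'] Imp(2)[of e e'] Imp(3) show ?case by simp
qed simp

lemma nval_lift: "nval e (lift_tm c d t) = nval (\<lambda>n. if n < c then e n else e (n + d)) t"
  by (induction t) auto
lemma nval_subst: "nval e (subst_tm k s t) = nval (\<lambda>n. if n < k then e n else if n = k then nval (\<lambda>n. e (n + k)) s else e (n - 1)) t"
  by (induction t) (auto simp: nval_lift)
lemma sat_subst: "sat e (subst_fm k s A) \<longleftrightarrow> sat (\<lambda>n. if n < k then e n else if n = k then nval (\<lambda>n. e (n + k)) s else e (n - 1)) A"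
proof (induction A arbitrary: e k)
  case (All A)
  have "(\<lambda>n. if n < Suc k then case_nat m e n else if n = Suc k then nval (\<lambda>n. case_nat m e (n + Suc k)) s else case_nat m e (n - 1))
     = case_nat m (\<lambda>n. if n < k then e n else if n = k then nval (\<lambda>n. e (n + k)) s else e (n - 1))" for m
    by (auto simp: fun_eq_iff split: nat.split)
  then show ?case by (simp add: All del: add_Suc_right)
qed (auto simp: nval_subst)

inductive_set conj_of :: "fm set \<Rightarrow> fm set" for T where
  "Top \<in> conj_of T"
| "A \<in> T \<Longrightarrow> A \<in> conj_of T"
| "A \<in> conj_of T \<Longrightarrow> B \<in> conj_of T \<Longrightarrow> (A \<sqinter> B) \<in> conj_of T"

lemma sat_isAnd': "sat e (isAnd x a b) \<longleftrightarrow> nval e x = fcode (inv fcode (nval e a) \<sqinter> inv fcode (nval e b))"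
  by (simp add: And_def Neg_def)

lemma fcode_And: "fcode A < fcode (A \<sqinter> B)" "fcode B < fcode (A \<sqinter> B)"
  unfolding And_def Neg_def using fcode_sub less_trans by metis+

theorem ConjAx_adequate:
  assumes "axiom_formula Ax T"
  shows "sat e (ConjAx Ax x) \<longleftrightarrow> inv fcode (nval e x) \<in> conj_of T"
proof -
  let ?x = "nval e x"
  have ax: "sat e (subst_fm 0 (Var 0) Ax) \<longleftrightarrow> e 0 \<in> fcode ` T" for e
  proof -
    have "sat e (subst_fm 0 (Var 0) Ax) = sat (case_nat (e 0) e) Ax"
      unfolding sat_subst using assms by (intro fv_sat) (auto simp: axiom_formula_def)
    then show ?thesis using assms by (simp add: axiom_formula_def)
  qed
  have b: "(\<exists>a\<le>z. \<exists>b\<le>z. a \<in> set_decode F \<and> b \<in> set_decode F \<and> z = fcode (inv fcode a \<sqinter> inv fcode b)) \<longleftrightarrow>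
     (\<exists>A B. fcode A \<in> set_decode F \<and> fcode B \<in> set_decode F \<and> z = fcode (A \<sqinter> B))" (is "?L = ?R") for z F
  proof
    assume ?L then show ?R by (metis fdec(1))
  next
    assume ?R then obtain A B where "fcode A \<in> set_decode F \<and> fcode B \<in> set_decode F \<and> z = fcode (A \<sqinter> B)" by blast
    then show ?L using fcode_And(1)[of A B] fcode_And(2)[of B A] by (intro exI[of _ "fcode A"] conjI exI[of _ "fcode B"]) auto
  qed
  have c: "(\<forall>z\<le>F. z \<in> set_decode F \<longrightarrow> P z) \<longleftrightarrow> (\<forall>z. z \<in> set_decode F \<longrightarrow> P z)" for P F using mem_le by auto
  have "sat e (ConjAx Ax x) \<longleftrightarrow> (\<exists>F\<le>2 * 2 ^ ?x. ?x \<in> set_decode F \<and> (\<forall>z. z \<in> set_decode F \<longrightarrow>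
     z = fcode Top \<or> z \<in> fcode ` T \<or> (\<exists>A B. fcode A \<in> set_decode F \<and> fcode B \<in> set_decode F \<and> z = fcode (A \<sqinter> B))))" (is "_ \<longleftrightarrow> ?R")
    unfolding b[symmetric] c[symmetric]
    by (simp add: ConjAx_def ax sat_isAnd' del: sat_isAnd)
  also have "\<dots> \<longleftrightarrow> inv fcode ?x \<in> conj_of T"
  proof
    assume ?R
    then obtain F where F: "?x \<in> set_decode F" "\<And>z. z \<in> set_decode F \<Longrightarrow> z = fcode Top \<or> z \<in> fcode ` T \<or> (\<exists>A B. fcode A \<in> set_decode F \<and> fcode B \<in> set_decode F \<and> z = fcode (A \<sqinter> B))" by blast
    have "fcode A \<in> set_decode F \<Longrightarrow> A \<in> conj_of T" for A
    proof (induction "fcode A" arbitrary: A rule: less_induct)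
      case less
      from F(2)[OF less(2)] consider "A = Top" | "A \<in> T" |
        B C where "A = (B \<sqinter> C)" "fcode B \<in> set_decode F" "fcode C \<in> set_decode F"
        by (auto simp: fcode_inj simp del: fcode.simps)
      then show ?case
      proof cases
        case 3 then show ?thesis using less(1)[of B] less(1)[of C] fcode_And(1)[of B C] fcode_And(2)[of C B] by (auto intro: conj_of.intros)
      qed (auto intro: conj_of.intros)
    qed
    then show "inv fcode ?x \<in> conj_of T" using F(1) by simp
  next
    assume d: "inv fcode ?x \<in> conj_of T"
    let ?X = "{fcode A | A. A \<in> conj_of T \<and> fcode A \<le> ?x}"
    have sub: "?X \<subseteq> {..?x}" by auto
    then have fin: "finite ?X" using finite_subset by blast
    have step: "A = Top \<or> A \<in> T \<or> (\<exists>B C. fcode B \<in> ?X \<and> fcode C \<in> ?X \<and> A = (B \<sqinter> C))" if "A \<in> conj_of T" "fcode A \<le> ?x" for A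
      using that(1)
    proof cases
      case (3 B C) then have "fcode B \<in> ?X" "fcode C \<in> ?X" using that(2) fcode_And(1)[of B C] fcode_And(2)[of C B] by auto
      then show ?thesis using 3 by blast
    qed auto
    have "set_encode ?X \<le> 2 * 2 ^ ?x" by (rule set_encode_mono[OF sub]) simp
    moreover have "?x \<in> ?X" using d by (metis (mono_tags, lifting) fdec(1) mem_Collect_eq order_refl)
    moreover have "\<forall>z. z \<in> ?X \<longrightarrow> z = fcode Top \<or> z \<in> fcode ` T \<or> (\<exists>A B. fcode A \<in> ?X \<and> fcode B \<in> ?X \<and> z = fcode (A \<sqinter> B))"
    proof (intro allI impI)
      fix z assume "z \<in> ?X" then obtain A where "z = fcode A" "A \<in> conj_of T" "fcode A \<le> ?x" by blast
      then show "z = fcode Top \<or> z \<in> fcode ` T \<or> (\<exists>A B. fcode A \<in> ?X \<and> fcode B \<in> ?X \<and> z = fcode (A \<sqinter> B))"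
        using step[of A] by blast
    qed
    ultimately show ?R by (intro exI[of _ "set_encode ?X"]) (unfold set_encode_inverse[OF fin], blast)
  qed
  finally show ?thesis .
qed

definition vstep :: "(nat \<Rightarrow> nat \<Rightarrow> nat \<Rightarrow> bool) \<Rightarrow> nat \<Rightarrow> nat \<Rightarrow> nat \<Rightarrow> bool" where
  "vstep R t e v \<longleftrightarrow> (t = 0 \<and> v = 0) \<or>
    (\<exists>a d. e = prod_encode (a,d) \<and> (t = tcode (Var 0) \<and> v = a \<or> (\<exists>n. t = tcode (Var (Suc n)) \<and> R (tcode (Var n)) d v))) \<or>
    (\<exists>s w. R s e w \<and> (t = succc s \<and> v = Suc w \<or> t = expc s \<and> v = 2 ^ w)) \<or>
    (\<exists>s s' w w'. R s e w \<and> R s' e w' \<and> (t = addc s s' \<and> v = w + w' \<or> t = mulc s s' \<and> v = w * w'))"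

definition vtab where "vtab R \<longleftrightarrow> (\<forall>t e v. R t e v \<longrightarrow> vstep R t e v)"

lemma r3le: "rel3 V t e v \<Longrightarrow> t \<le> V \<and> e \<le> V \<and> v \<le> V"
  unfolding rel3_def using mem3_le by blast

lemma sat_ValTable: "sat e (ValTable V) \<longleftrightarrow> vtab (rel3 (nval e V))"
proof -
  let ?V = "nval e V" let ?R = "rel3 ?V"
  have 0: "sat e (ValTable V) \<longleftrightarrow> (\<forall>t\<le>?V. \<forall>d\<le>?V. \<forall>v\<le>?V. ?R t d v \<longrightarrow>
     t = 0 \<and> v = 0 \<or>
     (\<exists>a\<le>?V. \<exists>d'\<le>?V. \<exists>n\<le>?V. d = prod_encode (a,d') \<and> (t = 5 * 0 + 1 \<and> v = a \<or> t = 5 * Suc n + 1 \<and> ?R (5 * n + 1) d' v)) \<or>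
     (\<exists>s\<le>?V. \<exists>w\<le>?V. ?R s d w \<and> (t = succc s \<and> v = Suc w \<or> t = expc s \<and> v = 2 ^ w)) \<or>
     (\<exists>s\<le>?V. \<exists>s'\<le>?V. \<exists>w\<le>?V. \<exists>w'\<le>?V. ?R s d w \<and> ?R s' d w' \<and> (t = addc s s' \<and> v = w + w' \<or> t = mulc s s' \<and> v = w * w')))"
    unfolding rel3_def by (simp add: ValTable_def ValTable_step_def csat del: nois ex_simps HOL.simp_thms(39,40))
  have 1: "(\<exists>a\<le>?V. \<exists>d'\<le>?V. \<exists>n\<le>?V. d = prod_encode (a,d') \<and> (t = 5 * 0 + 1 \<and> v = a \<or> t = 5 * Suc n + 1 \<and> ?R (5 * n + 1) d' v))
    \<longleftrightarrow> (\<exists>a d'. d = prod_encode (a,d') \<and> (t = tcode (Var 0) \<and> v = a \<or> (\<exists>n. t = tcode (Var (Suc n)) \<and> ?R (tcode (Var n)) d' v)))" (is "?A = ?B")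
    if "?R t d v" for t d v
  proof
    assume ?A then show ?B by auto
  next
    assume ?B
    then obtain a d' where d: "d = prod_encode (a,d')" and "t = tcode (Var 0) \<and> v = a \<or> (\<exists>n. t = tcode (Var (Suc n)) \<and> ?R (tcode (Var n)) d' v)" by blast
    then obtain n where n: "t = 5 * 0 + 1 \<and> v = a \<and> n = 0 \<or> t = 5 * Suc n + 1 \<and> ?R (5 * n + 1) d' v" by auto
    have "a \<le> ?V" "d' \<le> ?V" using d r3le[OF that] pe_le[of a d'] pe_le(2)[of d' a] by simp_all
    moreover have "n \<le> ?V" using n r3le[OF that] by auto
    ultimately show ?A using d n by blast
  qed
  have 2: "(\<exists>s\<le>?V. \<exists>w\<le>?V. ?R s d w \<and> P s w) \<longleftrightarrow> (\<exists>s w. ?R s d w \<and> P s w)" for d P using r3le by blast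
  have 3: "(\<exists>s\<le>?V. \<exists>s'\<le>?V. \<exists>w\<le>?V. \<exists>w'\<le>?V. ?R s d w \<and> ?R s' d w' \<and> P s s' w w') \<longleftrightarrow> (\<exists>s s' w w'. ?R s d w \<and> ?R s' d w' \<and> P s s' w w')" for d P using r3le by meson
  have 6: "(\<forall>t\<le>?V. \<forall>d\<le>?V. \<forall>v\<le>?V. ?R t d v \<longrightarrow> P t d v) = (\<forall>t d v. ?R t d v \<longrightarrow> P t d v)" for P using r3le by blast
  show ?thesis unfolding 0 vtab_def vstep_def 2 3 6
    by (intro iff_allI imp_cong refl arg_cong2[where f="(\<or>)"] 1)
qed

primrec envd :: "nat \<Rightarrow> nat \<Rightarrow> nat" where
  "envd e 0 = fst (prod_decode e)"
| "envd e (Suc n) = envd (snd (prod_decode e)) n"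

lemma envd_pair[simp]: "envd (prod_encode (a,d)) = case_nat a (envd d)"
proof
  fix x show "envd (prod_encode (a,d)) x = case_nat a (envd d) x" by (cases x) auto
qed

lemma vstep_var_sound:
  assumes "vtab R" shows "R (tcode (Var n)) e v \<Longrightarrow> v = envd e n"
proof (induction n arbitrary: e)
  case 0
  then have "vstep R (tcode (Var 0)) e v" using assms unfolding vtab_def by blast
  then show ?case unfolding vstep_def c_defs tcode.simps five by auto
next
  case (Suc n)
  then have "vstep R (tcode (Var (Suc n))) e v" using assms unfolding vtab_def by blast
  then obtain a d where "e = prod_encode (a,d)" "R (tcode (Var n)) d v"
    unfolding vstep_def c_defs tcode.simps five by auto
  then show ?case using Suc(1) by simp
qed

lemma vtab_sound:
  assumes "vtab R" shows "R (tcode t) e v \<Longrightarrow> v = nval (envd e) t"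
proof (induction t arbitrary: v)
  case (Var n) then show ?case using vstep_var_sound[OF assms] by simp
next
  case Zero
  then have "vstep R (tcode Zero) e v" using assms unfolding vtab_def by blast
  then show ?case unfolding vstep_def c_defs tcode.simps five by auto
next
  case (Succ t)
  then have "vstep R (tcode (Succ t)) e v" using assms unfolding vtab_def by blast
  then show ?case unfolding vstep_def c_defs tcode.simps five using Succ(1) by auto
next
  case (Exp t)
  then have "vstep R (tcode (Exp t)) e v" using assms unfolding vtab_def by blast
  then show ?case unfolding vstep_def c_defs tcode.simps five using Exp(1) by auto
next
  case (Add s t)
  then have "vstep R (tcode (Add s t)) e v" using assms unfolding vtab_def by blast
  then show ?case unfolding vstep_def c_defs tcode.simps five prod_encode_eq prod.inject using Add(1,2) by auto
next
  case (Mul s t)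
  then have "vstep R (tcode (Mul s t)) e v" using assms unfolding vtab_def by blast
  then show ?case unfolding vstep_def c_defs tcode.simps five prod_encode_eq prod.inject using Mul(1,2) by auto
qed

definition fstep :: "(nat \<Rightarrow> nat \<Rightarrow> nat \<Rightarrow> bool) \<Rightarrow> (nat \<Rightarrow> nat \<Rightarrow> nat \<Rightarrow> bool) \<Rightarrow> nat \<Rightarrow> nat \<Rightarrow> nat \<Rightarrow> bool" where
  "fstep R Q x e b \<longleftrightarrow> (x = 0 \<and> b = 0) \<or>
    (\<exists>s t v w. R s e v \<and> R t e w \<and> (x = eqc s t \<and> b = of_bool (v = w) \<or> x = lec s t \<and> b = of_bool (v \<le> w))) \<or>
    (\<exists>s t v w. Q s e v \<and> Q t e w \<and> x = impc s t \<and> b = of_bool (\<not> (v = 1 \<and> w = 0))) \<or>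
    (\<exists>a n. x = allc a \<and> b = 0 \<and> Q a (prod_encode (n,e)) 0) \<or>
    (\<exists>d c v. x = allc (impc (lec 1 (tcode (lift_tm 0 1 (inv tcode d)))) c) \<and> b = 1 \<and> R d e v \<and>
       (\<forall>n\<le>v. Q (impc (lec 1 (tcode (lift_tm 0 1 (inv tcode d)))) c) (prod_encode (n,e)) 1))"

definition ftab where "ftab R Q \<longleftrightarrow> (\<forall>x e b. Q x e b \<longrightarrow> fstep R Q x e b)"

lemma sat_TruthTable: "sat e (TruthTable V W) \<longleftrightarrow> ftab (rel3 (nval e V)) (rel3 (nval e W))"
proof -
  let ?V = "nval e V" let ?R = "rel3 ?V"
  let ?W = "nval e W" let ?Q = "rel3 ?W" let ?B = "?V + ?W"
  let ?l = "\<lambda>d. lec 1 (tcode (lift_tm 0 1 (inv tcode d)))"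
  have r: "?R t e v \<Longrightarrow> t \<le> ?B \<and> e \<le> ?B \<and> v \<le> ?B" for t e v using r3le[of ?V t e v] by auto
  have q: "?Q t e v \<Longrightarrow> t \<le> ?B \<and> e \<le> ?B \<and> v \<le> ?B" for t e v using r3le[of ?W t e v] by auto
  have 0: "sat e (TruthTable V W) \<longleftrightarrow> (\<forall>x\<le>?W. \<forall>d\<le>?W. \<forall>b\<le>?W. ?Q x d b \<longrightarrow>
     x = 0 \<and> b = 0 \<or>
     (\<exists>s\<le>?B. \<exists>t\<le>?B. \<exists>v\<le>?B. \<exists>w\<le>?B. ?R s d v \<and> ?R t d w \<and> (x = eqc s t \<and> (v = w \<and> b = 1 \<or> \<not> v = w \<and> b = 0) \<or> x = lec s t \<and> (v \<le> w \<and> b = 1 \<or> \<not> v \<le> w \<and> b = 0))) \<or>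
     (\<exists>s\<le>?B. \<exists>t\<le>?B. \<exists>v\<le>?B. \<exists>w\<le>?B. ?Q s d v \<and> ?Q t d w \<and> x = impc s t \<and> (v = 1 \<and> w = 0 \<and> b = 0 \<or> \<not> (v = 1 \<and> w = 0) \<and> b = 1)) \<or>
     (\<exists>a\<le>?B. \<exists>n\<le>?B. \<exists>d'\<le>?B. x = allc a \<and> b = 0 \<and> d' = prod_encode (n,d) \<and> ?Q a d' 0) \<or>
     (\<exists>a\<le>?B. \<exists>l\<le>?B. \<exists>c\<le>?B. \<exists>t'\<le>?B. \<exists>t\<le>?B. \<exists>v\<le>?B. x = allc a \<and> b = 1 \<and> a = impc l c \<and> l = lec 1 t' \<and> t' = tcode (lift_tm 0 1 (inv tcode t)) \<and> ?R t d v \<and>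
        (\<forall>n\<le>v. \<exists>d'\<le>?B. d' = prod_encode (n,d) \<and> ?Q a d' 1)))"
    unfolding rel3_def by (simp add: TruthTable_def TruthTable_step_def csat sat_LiftT[OF tdec(1)[symmetric]] del: nois ex_simps HOL.simp_thms(39,40))
  have 1: "(\<exists>s\<le>?B. \<exists>t\<le>?B. \<exists>v\<le>?B. \<exists>w\<le>?B. ?R s d v \<and> ?R t d w \<and> P s t v w) \<longleftrightarrow> (\<exists>s t v w. ?R s d v \<and> ?R t d w \<and> P s t v w)" for d P using r by meson
  have 2: "(\<exists>s\<le>?B. \<exists>t\<le>?B. \<exists>v\<le>?B. \<exists>w\<le>?B. ?Q s d v \<and> ?Q t d w \<and> P s t v w) \<longleftrightarrow> (\<exists>s t v w. ?Q s d v \<and> ?Q t d w \<and> P s t v w)" for d P using q by meson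
  have 3: "(\<exists>a\<le>?B. \<exists>n\<le>?B. \<exists>d'\<le>?B. x = allc a \<and> b = 0 \<and> d' = prod_encode (n,d) \<and> ?Q a d' 0) \<longleftrightarrow> (\<exists>a n. x = allc a \<and> b = 0 \<and> ?Q a (prod_encode (n,d)) 0)" for x b d
  proof -
    have "a \<le> ?B \<and> n \<le> ?B \<and> prod_encode (n,d) \<le> ?B" if "?Q a (prod_encode (n,d)) 0" for a n
      using q[OF that] pe_le(1)[of n d] by linarith
    then show ?thesis by blast
  qed
  have 4: "(\<exists>a\<le>?B. \<exists>l\<le>?B. \<exists>c\<le>?B. \<exists>t'\<le>?B. \<exists>t\<le>?B. \<exists>v\<le>?B. x = allc a \<and> b = 1 \<and> a = impc l c \<and> l = lec 1 t' \<and> t' = tcode (lift_tm 0 1 (inv tcode t)) \<and> ?R t d v \<and>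
        (\<forall>n\<le>v. \<exists>d'\<le>?B. d' = prod_encode (n,d) \<and> ?Q a d' 1)) \<longleftrightarrow>
     (\<exists>t c v. x = allc (impc (?l t) c) \<and> b = 1 \<and> ?R t d v \<and> (\<forall>n\<le>v. ?Q (impc (?l t) c) (prod_encode (n,d)) 1))" (is "?A \<longleftrightarrow> ?C") if "?Q x d b" for x d b
  proof
    assume ?A then show ?C by blast
  next
    assume ?C then obtain t c v where C: "x = allc (impc (?l t) c) \<and> b = 1 \<and> ?R t d v \<and> (\<forall>n\<le>v. ?Q (impc (?l t) c) (prod_encode (n,d)) 1)" by blast
    have xB: "x \<le> ?B" using q[OF that] by simp
    have "impc (?l t) c \<le> x" using C by (simp add: cle)
    moreover have "c \<le> impc (?l t) c" "?l t \<le> impc (?l t) c" "tcode (lift_tm 0 1 (inv tcode t)) \<le> ?l t" by (simp_all add: cle)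
    moreover have "t \<le> ?B" "v \<le> ?B" using r[of t d v] C by auto
    ultimately have "impc (?l t) c \<le> ?B" "c \<le> ?B" "?l t \<le> ?B" "tcode (lift_tm 0 1 (inv tcode t)) \<le> ?B" "t \<le> ?B" "v \<le> ?B" using xB by linarith+
    moreover have "\<forall>n\<le>v. \<exists>d'\<le>?B. d' = prod_encode (n,d) \<and> ?Q (impc (?l t) c) d' 1" using C q by blast
    ultimately show ?A using C by blast
  qed
  have 5: "(v = w \<and> b = 1 \<or> \<not> v = w \<and> b = 0) = (b = of_bool (v = w))" "(v \<le> w \<and> b = 1 \<or> \<not> v \<le> w \<and> b = 0) = (b = of_bool (v \<le> w))"
    "(v = 1 \<and> w = 0 \<and> b = 0 \<or> \<not> (v = 1 \<and> w = 0) \<and> b = 1) = (b = of_bool (\<not> (v = 1 \<and> w = 0)))" for v w b :: nat by auto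
  have 6: "(\<forall>x\<le>?W. \<forall>d\<le>?W. \<forall>b\<le>?W. ?Q x d b \<longrightarrow> P x d b) = (\<forall>x d b. ?Q x d b \<longrightarrow> P x d b)" for P using r3le by blast
  show ?thesis unfolding 0 ftab_def fstep_def 1 2 3 5 6
    by (intro iff_allI imp_cong refl arg_cong2[where f="(\<or>)"] 4)
qed

lemma ftab_sound:
  assumes "vtab R" "ftab R Q" shows "Q (fcode A) e b \<Longrightarrow> b = 0 \<and> \<not> sat (envd e) A \<or> b = 1 \<and> sat (envd e) A"
proof (induction A arbitrary: e b)
  case Bot
  then have "fstep R Q (fcode Bot) e b" using assms unfolding ftab_def by blast
  then show ?case unfolding fstep_def c_defs fcode.simps four by auto
next
  case (Eq s t)
  then have "fstep R Q (fcode (Eq s t)) e b" using assms unfolding ftab_def by blast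
  then show ?case unfolding fstep_def c_defs fcode.simps four prod_encode_eq prod.inject using vtab_sound[OF assms(1)] by fastforce
next
  case (Le s t)
  then have "fstep R Q (fcode (Le s t)) e b" using assms unfolding ftab_def by blast
  then show ?case unfolding fstep_def c_defs fcode.simps four prod_encode_eq prod.inject using vtab_sound[OF assms(1)] by fastforce
next
  case (Imp A B)
  then have "fstep R Q (fcode (Imp A B)) e b" using assms unfolding ftab_def by blast
  then obtain v w where "Q (fcode A) e v" "Q (fcode B) e w" "b = of_bool (\<not> (v = 1 \<and> w = 0))"
    unfolding fstep_def c_defs fcode.simps four prod_encode_eq prod.inject by blast
  then show ?case using Imp(1)[of e v] Imp(2)[of e w] by auto
next
  case (All A)
  then have "fstep R Q (fcode (All A)) e b" using assms unfolding ftab_def by blast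
  then consider n where "b = 0" "Q (fcode A) (prod_encode (n,e)) 0" |
     d c v where "fcode A = impc (lec 1 (tcode (lift_tm 0 1 (inv tcode d)))) c" "b = 1" "R d e v"
       "\<forall>n\<le>v. Q (fcode A) (prod_encode (n,e)) 1"
    unfolding fstep_def ccode unfolding c_defs four by (auto simp: zero_neq_one)
  then show ?case
  proof cases
    case 1 then show ?thesis using All(1)[OF 1(2)] by auto
  next
    case 2
    have "tcode (Var 0) = 1" by simp
    then have "fcode A = fcode (Var 0 \<preceq> lift_tm 0 1 (inv tcode d) \<rightharpoonup> inv fcode c)" using 2(1) by (simp only: ccode fdec)
    then have A: "A = (Var 0 \<preceq> lift_tm 0 1 (inv tcode d) \<rightharpoonup> inv fcode c)" by (simp only: fcode_inj)
    have v: "v = nval (envd e) (inv tcode d)" using vtab_sound[OF assms(1), of "inv tcode d" e v] 2(3) by simp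
    have "sat (case_nat n (envd e)) A" for n
    proof (cases "n \<le> v")
      case True then show ?thesis using All(1)[of "prod_encode (n,e)" 1] 2(4) by simp
    next
      case False then show ?thesis unfolding A using v by simp
    qed
    then show ?thesis using 2(2) by simp
  qed
qed

abbreviation "Rs X \<equiv> \<lambda>a b c. (a,b,c) \<in> X"

lemma vstep_mono: "vstep R a b c \<Longrightarrow> (\<And>a b c. R a b c \<Longrightarrow> R' a b c) \<Longrightarrow> vstep R' a b c"
  unfolding vstep_def
  by (elim disj_forward ex_forward conj_forward all_forward imp_forward) auto

lemma vtab_Un: assumes "vtab (Rs X)" "vtab (Rs Y)" shows "vtab (Rs (X \<union> Y))"
proof -
  have "vstep (Rs X) t e v \<Longrightarrow> vstep (Rs (X \<union> Y)) t e v" "vstep (Rs Y) t e v \<Longrightarrow> vstep (Rs (X \<union> Y)) t e v" for t e v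
    by (erule vstep_mono, simp)+
  then show ?thesis using assms unfolding vtab_def by blast
qed

lemma vtab_ins: assumes "vtab (Rs X)" "vstep (Rs X) a b c" shows "vtab (Rs (insert (a,b,c) X))"
proof -
  have "vstep (Rs X) t e v \<Longrightarrow> vstep (Rs (insert (a,b,c) X)) t e v" for t e v
    by (erule vstep_mono, simp)
  then show ?thesis using assms unfolding vtab_def by blast
qed

lemma ex_vtab_var: "\<exists>X. finite X \<and> vtab (Rs X) \<and> (tcode (Var n), e, envd e n) \<in> X"
proof (induction n arbitrary: e)
  case 0
  obtain a d where e: "e = prod_encode (a,d)" by (metis prod_decode_inverse surj_pair)
  have "vstep (Rs {}) (tcode (Var 0)) e (envd e 0)" unfolding vstep_def e by (auto simp del: tcode.simps)
  then have "vtab (Rs {(tcode (Var 0), e, envd e 0)})" by (intro vtab_ins) (auto simp: vtab_def)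
  then show ?case by blast
next
  case (Suc n)
  obtain a d where e: "e = prod_encode (a,d)" by (metis prod_decode_inverse surj_pair)
  from Suc[of d] obtain X where X: "finite X" "vtab (Rs X)" "(tcode (Var n), d, envd d n) \<in> X" by blast
  then have "vstep (Rs X) (tcode (Var (Suc n))) e (envd e (Suc n))" unfolding vstep_def e by (auto simp del: tcode.simps)
  then have "vtab (Rs (insert (tcode (Var (Suc n)), e, envd e (Suc n)) X))" by (intro vtab_ins X)
  then show ?case using X(1) by blast
qed

lemma ex_vtab: "\<exists>X. finite X \<and> vtab (Rs X) \<and> (tcode t, e, nval (envd e) t) \<in> X"
proof (induction t)
  case (Var n) then show ?case using ex_vtab_var by simp
next
  case Zero
  have "vtab (Rs {(tcode Zero, e, nval (envd e) Zero)})" by (intro vtab_ins) (auto simp: vtab_def vstep_def)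
  then show ?case by blast
next
  case (Succ t)
  then obtain X where X: "finite X" "vtab (Rs X)" "(tcode t, e, nval (envd e) t) \<in> X" by blast
  then have "vtab (Rs (insert (tcode (Succ t), e, nval (envd e) (Succ t)) X))"
    by (intro vtab_ins) (auto simp: vstep_def ccode simp del: nois)
  then show ?case using X(1) by blast
next
  case (Exp t)
  then obtain X where X: "finite X" "vtab (Rs X)" "(tcode t, e, nval (envd e) t) \<in> X" by blast
  then have "vtab (Rs (insert (tcode (Exp t), e, nval (envd e) (Exp t)) X))"
    by (intro vtab_ins) (auto simp: vstep_def ccode simp del: nois)
  then show ?case using X(1) by blast
next
  case (Add s t)
  then obtain X Y where X: "finite X" "vtab (Rs X)" "(tcode t, e, nval (envd e) t) \<in> X" "finite Y" "vtab (Rs Y)" "(tcode s, e, nval (envd e) s) \<in> Y" by blast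
  then have "vtab (Rs (insert (tcode (Add s t), e, nval (envd e) (Add s t)) (X \<union> Y)))"
    by (intro vtab_ins vtab_Un X, unfold vstep_def ccode nval.simps)
      (rule disjI2, rule disjI2, rule disjI2, rule exI[of _ "tcode s"], rule exI[of _ "tcode t"],
        rule exI[of _ "nval (envd e) s"], rule exI[of _ "nval (envd e) t"], use X in simp)
  then show ?case using X(1,4) by (metis finite_insert finite_Un insertI1)
next
  case (Mul s t)
  then obtain X Y where X: "finite X" "vtab (Rs X)" "(tcode t, e, nval (envd e) t) \<in> X" "finite Y" "vtab (Rs Y)" "(tcode s, e, nval (envd e) s) \<in> Y" by blast
  then have "vtab (Rs (insert (tcode (Mul s t), e, nval (envd e) (Mul s t)) (X \<union> Y)))"
    by (intro vtab_ins vtab_Un X, unfold vstep_def ccode nval.simps)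
      (rule disjI2, rule disjI2, rule disjI2, rule exI[of _ "tcode s"], rule exI[of _ "tcode t"],
        rule exI[of _ "nval (envd e) s"], rule exI[of _ "nval (envd e) t"], use X in simp)
  then show ?case using X(1,4) by (metis finite_insert finite_Un insertI1)
qed

definition tabs where "tabs X Y \<longleftrightarrow> finite X \<and> finite Y \<and> vtab (Rs X) \<and> ftab (Rs X) (Rs Y)"

lemma fstep_mono: "fstep R Q a b c \<Longrightarrow> (\<And>a b c. R a b c \<Longrightarrow> R' a b c) \<Longrightarrow> (\<And>a b c. Q a b c \<Longrightarrow> Q' a b c) \<Longrightarrow> fstep R' Q' a b c"
  unfolding fstep_def
  by (elim disj_forward ex_forward conj_forward all_forward imp_forward) auto

lemma tabs_Un: assumes "tabs X Y" "tabs X' Y'" shows "tabs (X \<union> X') (Y \<union> Y')"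
proof -
  have "fstep (Rs X) (Rs Y) t e v \<Longrightarrow> fstep (Rs (X \<union> X')) (Rs (Y \<union> Y')) t e v"
     "fstep (Rs X') (Rs Y') t e v \<Longrightarrow> fstep (Rs (X \<union> X')) (Rs (Y \<union> Y')) t e v" for t e v
    by (erule fstep_mono, simp, simp)+
  then have "ftab (Rs (X \<union> X')) (Rs (Y \<union> Y'))" using assms unfolding tabs_def ftab_def by blast
  then show ?thesis using assms vtab_Un unfolding tabs_def by blast
qed

lemma tabs_ins: assumes "tabs X Y" "fstep (Rs X) (Rs Y) a b c" shows "tabs X (insert (a,b,c) Y)"
proof -
  have "fstep (Rs X) (Rs Y) t e v \<Longrightarrow> fstep (Rs X) (Rs (insert (a,b,c) Y)) t e v" for t e v
    by (erule fstep_mono, simp, simp)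
  then have "ftab (Rs X) (Rs (insert (a,b,c) Y))" using assms unfolding tabs_def ftab_def by blast
  then show ?thesis using assms unfolding tabs_def by blast
qed

lemma tabs_UN: "(\<And>n. n \<le> (m::nat) \<Longrightarrow> \<exists>X Y. tabs X Y \<and> P n \<in> Y) \<Longrightarrow> \<exists>X Y. tabs X Y \<and> (\<forall>n\<le>m. P n \<in> Y)"
proof (induction m)
  case 0 then show ?case by auto
next
  case (Suc m)
  then obtain X Y X' Y' where "tabs X Y" "\<forall>n\<le>m. P n \<in> Y" "tabs X' Y'" "P (Suc m) \<in> Y'" by (metis le_SucI order_refl)
  then have "tabs (X \<union> X') (Y \<union> Y')" "\<forall>n\<le>Suc m. P n \<in> Y \<union> Y'" using tabs_Un by (auto simp: le_Suc_eq)
  then show ?case by blast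
qed

lemma tabs_v: "tabs X Y \<Longrightarrow> finite V \<Longrightarrow> vtab (Rs V) \<Longrightarrow> tabs (X \<union> V) Y"
  using tabs_Un[of X Y V "{}"] by (simp add: tabs_def ftab_def)

lemma ex_tabs: "delta0 A \<Longrightarrow> \<exists>X Y. tabs X Y \<and> (fcode A, e, of_bool (sat (envd e) A)) \<in> Y"
proof (induction arbitrary: e rule: delta0.induct)
  case 1
  have "tabs {} {(fcode Bot, e, 0)}" by (intro tabs_ins) (auto simp: tabs_def ftab_def vtab_def fstep_def)
  then show ?case by (metis insertI1 of_bool_eq(1) sat.simps(1))
next
  case (2 s t)
  obtain V W where V: "finite V" "vtab (Rs V)" "(tcode s, e, nval (envd e) s) \<in> V" "finite W" "vtab (Rs W)" "(tcode t, e, nval (envd e) t) \<in> W"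
    using ex_vtab by meson
  have "tabs (V \<union> W) {}" using V vtab_Un by (simp add: tabs_def ftab_def)
  then have "tabs (V \<union> W) {(fcode (s \<doteq> t), e, of_bool (sat (envd e) (s \<doteq> t)))}"
    by (rule tabs_ins) (use V in \<open>auto simp: fstep_def ccode simp del: nois\<close>)
  then show ?case by blast
next
  case (3 s t)
  obtain V W where V: "finite V" "vtab (Rs V)" "(tcode s, e, nval (envd e) s) \<in> V" "finite W" "vtab (Rs W)" "(tcode t, e, nval (envd e) t) \<in> W"
    using ex_vtab by meson
  have "tabs (V \<union> W) {}" using V vtab_Un by (simp add: tabs_def ftab_def)
  then have "tabs (V \<union> W) {(fcode (s \<preceq> t), e, of_bool (sat (envd e) (s \<preceq> t)))}"
    by (rule tabs_ins) (use V in \<open>auto simp: fstep_def ccode simp del: nois\<close>)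
  then show ?case by blast
next
  case (4 A B)
  obtain X Y where X: "tabs X Y" "(fcode A, e, of_bool (sat (envd e) A)) \<in> Y" using 4(3) by blast
  obtain X' Y' where Y: "tabs X' Y'" "(fcode B, e, of_bool (sat (envd e) B)) \<in> Y'" using 4(4) by blast
  have "tabs (X \<union> X') (insert (fcode (A \<rightharpoonup> B), e, of_bool (sat (envd e) (A \<rightharpoonup> B))) (Y \<union> Y'))"
  proof (intro tabs_ins tabs_Un X Y)
    show "fstep (Rs (X \<union> X')) (Rs (Y \<union> Y')) (fcode (A \<rightharpoonup> B)) e (of_bool (sat (envd e) (A \<rightharpoonup> B)))"
      unfolding fstep_def using X(2) Y(2)
      apply -
      apply (rule disjI2, rule disjI2, rule disjI1)
      apply (rule exI[of _ "fcode A"], rule exI[of _ "fcode B"], rule exI[of _ "of_bool (sat (envd e) A)"], rule exI[of _ "of_bool (sat (envd e) B)"])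
      by (simp add: ccode(7) del: nois)
  qed
  then show ?case by blast
next
  case (5 A t)
  let ?l = "Var 0 \<preceq> up 1 t" let ?v = "nval (envd e) t"
  obtain V where V: "finite V" "vtab (Rs V)" "(tcode t, e, ?v) \<in> V" using ex_vtab by meson
  have body: "\<exists>X Y. tabs X Y \<and> (fcode (?l \<rightharpoonup> A), prod_encode (n,e), of_bool (sat (case_nat n (envd e)) A)) \<in> Y" if n: "n \<le> ?v" for n
  proof -
    let ?e = "prod_encode (n,e)"
    obtain X Y where X: "tabs X Y" "(fcode A, ?e, of_bool (sat (envd ?e) A)) \<in> Y" using 5(2) by blast
    obtain V W where V: "finite V" "vtab (Rs V)" "(tcode (Var 0), ?e, nval (envd ?e) (Var 0)) \<in> V" "finite W" "vtab (Rs W)" "(tcode (up 1 t), ?e, nval (envd ?e) (up 1 t)) \<in> W"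
      using ex_vtab by meson
    have "tabs (V \<union> W) {}" using V vtab_Un by (simp add: tabs_def ftab_def)
    then have l: "tabs (V \<union> W) {(fcode ?l, ?e, of_bool (sat (envd ?e) ?l))}"
      by (rule tabs_ins) (use V in \<open>auto simp: fstep_def ccode simp del: nois tcode.simps\<close>)
    have sl: "sat (envd ?e) ?l" using n by simp
    have "tabs (V \<union> W \<union> X) (insert (fcode (?l \<rightharpoonup> A), ?e, of_bool (sat (envd ?e) A)) ({(fcode ?l, ?e, of_bool (sat (envd ?e) ?l))} \<union> Y))"
    proof (rule tabs_ins[OF tabs_Un[OF l X(1)]])
      show "fstep (Rs (V \<union> W \<union> X)) (Rs ({(fcode ?l, ?e, of_bool (sat (envd ?e) ?l))} \<union> Y)) (fcode (?l \<rightharpoonup> A)) ?e (of_bool (sat (envd ?e) A))"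
        unfolding fstep_def
        apply (rule disjI2, rule disjI2, rule disjI1)
        apply (rule exI[of _ "fcode ?l"], rule exI[of _ "fcode A"], rule exI[of _ 1], rule exI[of _ "of_bool (sat (envd ?e) A)"])
        using X(2) sl by (simp add: ccode(7) del: nois sat.simps)
    qed
    then show ?thesis by (metis envd_pair insertI1)
  qed
  have fc: "fcode (BAll t A) = allc (impc (lec 1 (tcode (lift_tm 0 1 (inv tcode (tcode t))))) (fcode A))"
    by (simp add: BAll_def c_defs)
  have fc': "fcode (?l \<rightharpoonup> A) = impc (lec 1 (tcode (lift_tm 0 1 (inv tcode (tcode t))))) (fcode A)"
    by (simp add: c_defs)
  show ?case
  proof (cases "sat (envd e) (BAll t A)")
    case True
    then have "\<exists>X Y. tabs X Y \<and> (\<forall>n\<le>?v. (fcode (?l \<rightharpoonup> A), prod_encode (n,e), 1) \<in> Y)"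
      using body by (intro tabs_UN) fastforce
    then obtain X Y where X: "tabs X Y" "\<forall>n\<le>?v. (fcode (?l \<rightharpoonup> A), prod_encode (n,e), 1) \<in> Y" by blast
    have "tabs (X \<union> V) (insert (fcode (BAll t A), e, 1) Y)"
    proof (intro tabs_ins tabs_v V X)
      show "fstep (Rs (X \<union> V)) (Rs Y) (fcode (BAll t A)) e 1"
        unfolding fstep_def fc using X(2) V(3) unfolding fc' by blast
    qed
    then show ?thesis using True by (metis insertI1 of_bool_eq(2))
  next
    case False
    then obtain n where n: "n \<le> ?v" "\<not> sat (case_nat n (envd e)) A" by auto
    then obtain X Y where X: "tabs X Y" "(fcode (?l \<rightharpoonup> A), prod_encode (n,e), 0) \<in> Y" using body[of n] by auto
    have "tabs X (insert (fcode (BAll t A), e, 0) Y)"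
    proof (intro tabs_ins X)
      show "fstep (Rs X) (Rs Y) (fcode (BAll t A)) e 0"
        unfolding fstep_def fc using X(2) unfolding fc' by blast
    qed
    then show ?thesis using False by (metis insertI1 of_bool_eq(1))
  qed
qed

lemma ex_tabs_pi1: "pi1 A \<Longrightarrow> \<not> sat (envd e) A \<Longrightarrow> \<exists>X Y. tabs X Y \<and> (fcode A, e, 0) \<in> Y"
proof (induction arbitrary: e rule: pi1.induct)
  case (1 A) then show ?case using ex_tabs[of A e] by auto
next
  case (2 A)
  then obtain n where "\<not> sat (envd (prod_encode (n,e))) A" by auto
  then obtain X Y where X: "tabs X Y" "(fcode A, prod_encode (n,e), 0) \<in> Y" using 2 by blast
  have "tabs X (insert (fcode (All A), e, 0) Y)"
    by (intro tabs_ins X) (use X in \<open>auto simp: fstep_def ccode simp del: nois\<close>)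
  then show ?case by blast
qed

theorem Pi1_True_adequate:
  "sat e (Pi1_True x) \<longleftrightarrow> (let A = inv fcode (nval e x) in sentence A \<and> pi1 A \<and> true_N A)"
proof -
  define A where "A = inv fcode (nval e x)"
  have x: "nval e x = fcode A" by (simp add: A_def)
  have 0: "sat e (Pi1_True x) \<longleftrightarrow> sentence A \<and> pi1 A \<and> (\<forall>V W. vtab (rel3 V) \<and> ftab (rel3 V) (rel3 W) \<longrightarrow> \<not> rel3 W (fcode A) 0 0)"
    unfolding rel3_def by (auto simp: Pi1_True_def sat_ValTable sat_TruthTable x rel3_def[abs_def])
  have tr: "true_N A \<longleftrightarrow> sat (envd 0) A" if "sentence A"
    using that fv_sat[of A "envd 0"] unfolding true_N_def sentence_def by auto
  have "(\<forall>V W. vtab (rel3 V) \<and> ftab (rel3 V) (rel3 W) \<longrightarrow> \<not> rel3 W (fcode A) 0 0) \<longleftrightarrow> sat (envd 0) A" (is "?L \<longleftrightarrow> _") if pi: "pi1 A"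
  proof
    assume ?L
    show "sat (envd 0) A"
    proof (rule ccontr)
      assume "\<not> sat (envd 0) A"
      then obtain X Y where X: "tabs X Y" "(fcode A, 0, 0) \<in> Y" using ex_tabs_pi1[OF pi] by blast
      let ?f = "\<lambda>(a,b,c). prod_encode (a, prod_encode (b,c))"
      have inj: "inj ?f" by (auto simp: inj_def)
      have *: "rel3 (set_encode (?f ` X)) = Rs X" if "finite X" for X
      proof -
        have "finite (?f ` X)" using that by simp
        then show ?thesis unfolding rel3_def by (auto simp: fun_eq_iff inj_image_mem_iff[OF inj, of "(_,_,_)", simplified])
      qed
      show False using \<open>?L\<close>[rule_format, of "set_encode (?f ` X)" "set_encode (?f ` Y)"] X unfolding tabs_def by (simp add: *)
    qed
  next
    assume "sat (envd 0) A" then show ?L using ftab_sound by fastforce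
  qed
  then show ?thesis using 0 tr unfolding A_def[symmetric] Let_def by blast
qed

theorem Sigma1_Sound_adequate:
  assumes "axiom_formula Ax T"
  shows "sat e (Sigma1_Sound Ax) \<longleftrightarrow>
    (\<forall>A B. A \<in> conj_of T \<and> sentence B \<and> pi1 B \<and> true_N B \<longrightarrow> \<not> {} \<turnstile> (A \<sqinter> B \<rightharpoonup> Bot))"
proof -
  have pr: "(\<exists>y. sat (case_nat v (case_nat w (case_nat y e))) (Proof (Var 2) (Var 0))) \<longleftrightarrow> {} \<turnstile> inv fcode v" for v w e
    using Proof_adequate[of e "inv fcode v"] unfolding sat_Proof by simp
  have im: "4 * prod_encode (fcode C, 0) + 3 = fcode (C \<rightharpoonup> Bot)" for C by simp
  show ?thesis
    apply (simp add: Sigma1_Sound_def ConjAx_adequate[OF assms] Pi1_True_adequate Let_def sat_isAnd' del: sat_isAnd fcode.simps nval_codes)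
    apply (simp only: im)
    using pr by (metis fdec)
qed


lemmas d0_defs = isPair_def isAdd_def isMul_def isEq_def isLe_def isImp_def isAnd_def Mem_def Mem2_def Mem3_def

lemma d0_basic[simp]: "delta0 (isPair p a b)" "delta0 (isAdd x a b)" "delta0 (isMul x a b)" "delta0 (isEq x a b)"
  "delta0 (isLe x a b)" "delta0 (isImp x a b)" "delta0 (isAnd x a b)" "delta0 (Mem a b)" "delta0 (Mem2 a b c)" "delta0 (Mem3 a b c d)"
  by (simp_all add: d0_defs)
lemma d0_MapT: "(\<And>q c a b. delta0 (l q c a b)) \<Longrightarrow> delta0 (MapT l q c a b)"
  by (simp add: MapT_def MapT_step_def)
lemma d0_MapF: "(\<And>q c a b. delta0 (l q c a b)) \<Longrightarrow> delta0 (MapF l q c a b)"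
  by (simp add: MapF_def MapF_step_def)
lemma d0_syn[simp]: "delta0 (LiftT q c a b)" "delta0 (SubstT q c a b)" "delta0 (LiftF q c a b)" "delta0 (SubstF q c a b)"
proof -
  show 1: "delta0 (LiftT q c a b)" for q c a b unfolding LiftT_def by (intro d0_MapT) simp
  show 2: "delta0 (SubstT q c a b)" for q c a b unfolding SubstT_def by (intro d0_MapT) (simp add: 1)
  show "delta0 (LiftF q c a b)" "delta0 (SubstF q c a b)" unfolding LiftF_def SubstF_def by (intro d0_MapF 1 2)+
qed
lemma d0_more[simp]: "delta0 (Closed x)" "delta0 (isDelta0 x)" "delta0 (isPi1 x)" "delta0 (ValTable V)" "delta0 (TruthTable V W)"
  "delta0 (isLogAx x)"
  by (simp_all add: Closed_def isDelta0_def isDelta0_step_def isPi1_def ValTable_def ValTable_step_def TruthTable_def TruthTable_step_def isLogAx_def)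
theorem delta0_Proof: "delta0 (Proof y x)" by (simp add: Proof_def Proof_step_def)
theorem pi1_Pi1_True: "pi1 (Pi1_True x)" unfolding Pi1_True_def by (intro pi1.intros) simp

end

theory Submission
  imports Defs
begin

text \<open>Let \<open>S\<close> be a finite conjunction of axioms that proves \<open>\<Sigma>\<^sub>1\<close>-soundness. By diagonalisation there
  are \<open>\<Pi>\<^sub>1\<close>-sentences \<open>K n\<close> saying: ``\<open>K n\<close> is \<open>\<Pi>\<^sub>1\<close>-true, and \<open>S \<and> K n \<rightarrow> \<bottom>\<close> has a proof of size at
  most \<open>exp (exp (exp (exp n)))\<close>''. By pure logic, \<open>K n\<close> contradicts \<open>\<Sigma>\<^sub>1\<close>-soundness, uniformly in \<open>n\<close>;
  hence \<open>S \<and> K n \<rightarrow> \<bottom>\<close> is an instance of one provable formula and has a proof of size about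
  \<open>exp (exp (c * n))\<close>. So the second conjunct of \<open>K n\<close> is true for large \<open>n\<close>, and the first one holds by
  infinite descent on the tables that might refute it. Thus the theory proves the false \<open>\<Sigma>\<^sub>1\<close>-sentence
  \<open>\<not> K n\<close>. No arithmetic has to be carried out inside the theory.\<close>

section \<open>Derived rules of the calculus\<close>

primrec peval :: "(fm \<Rightarrow> bool) \<Rightarrow> fm \<Rightarrow> bool" where
  "peval v Bot \<longleftrightarrow> False"
| "peval v (s \<doteq> t) \<longleftrightarrow> v (s \<doteq> t)"
| "peval v (s \<preceq> t) \<longleftrightarrow> v (s \<preceq> t)"
| "peval v (A \<rightharpoonup> B) \<longleftrightarrow> (peval v A \<longrightarrow> peval v B)"
| "peval v (All A) \<longleftrightarrow> v (All A)"

lemma peval_conn[simp]: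
  "peval v Top" "peval v (Neg A) \<longleftrightarrow> \<not> peval v A" "peval v (A \<sqinter> B) \<longleftrightarrow> peval v A \<and> peval v B"
  "peval v (A \<squnion> B) \<longleftrightarrow> peval v A \<or> peval v B"
  by (auto simp: Top_def Neg_def And_def Or_def)

text \<open>Hypotheses are combined by modus ponens only, while generalisation stays inside
  \<open>T\<close>; hence the deduction theorem \<open>derives_imp\<close> holds even for open
  hypotheses.\<close>

inductive derives :: "fm set \<Rightarrow> fm set \<Rightarrow> fm \<Rightarrow> bool" for T where
  hyp: "A \<in> G \<Longrightarrow> derives T G A"
| ax: "T \<turnstile> A \<Longrightarrow> derives T G A"
| mp: "derives T G A \<Longrightarrow> derives T G (A \<rightharpoonup> B) \<Longrightarrow> derives T G B"

lemma derives_K: "derives T G B \<Longrightarrow> derives T G (A \<rightharpoonup> B)"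
  by (rule derives.mp[OF _ derives.ax]) (auto intro: proves.Log log_ax.K)

lemma proves_I: "T \<turnstile> (A \<rightharpoonup> A)"
  by (rule proves.MP[OF _ proves.MP[OF _ proves.Log[OF log_ax.S]]]) (rule proves.Log[OF log_ax.K])+

lemma derives_imp: "derives T (insert A G) B \<Longrightarrow> derives T G (A \<rightharpoonup> B)"
proof (induction "insert A G" B rule: derives.induct)
  case (hyp B)
  then show ?case by (metis insert_iff derives.hyp derives.ax derives_K proves_I)
next
  case (ax B)
  then show ?case by (metis derives.ax derives_K)
next
  case (mp B C)
  then show ?case by (metis derives.mp derives.ax log_ax.S proves.Log)
qed

lemma derives_mono: "derives T G A \<Longrightarrow> G \<subseteq> H \<Longrightarrow> derives T H A"
  by (induction rule: derives.induct) (auto intro: derives.intros)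

lemma derives_dn: "derives T (insert (Neg A) G) Bot \<Longrightarrow> derives T G A"
  by (metis Neg_def derives.mp derives.ax derives_imp log_ax.DN proves.Log)

lemma derives_empty: "derives T G A \<Longrightarrow> G = {} \<Longrightarrow> T \<turnstile> A"
  by (induction rule: derives.induct) (auto intro: proves.MP)

primrec atoms :: "fm \<Rightarrow> fm set" where
  "atoms Bot = {}"
| "atoms (s \<doteq> t) = {s \<doteq> t}"
| "atoms (s \<preceq> t) = {s \<preceq> t}"
| "atoms (A \<rightharpoonup> B) = atoms A \<union> atoms B"
| "atoms (All A) = {All A}"

definition lit :: "(fm \<Rightarrow> bool) \<Rightarrow> fm \<Rightarrow> fm" where
  "lit v A = (if v A then A else Neg A)"

text \<open>Kalmar's argument: once every atom is decided by a literal hypothesis, induction on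
  \<open>A\<close> decides \<open>A\<close> in the same way as \<open>v\<close>.\<close>

lemma kalmar: "derives T (lit v ` atoms A) (if peval v A then A else Neg A)"
proof (induction A)
  case Bot
  then show ?case by (simp add: Neg_def derives.ax proves_I)
next
  case (Imp A B)
  let ?G = "lit v ` atoms (A \<rightharpoonup> B)"
  have A: "derives T ?G (if peval v A then A else Neg A)"
    by (rule derives_mono[OF Imp(1)]) auto
  have B: "derives T ?G (if peval v B then B else Neg B)"
    by (rule derives_mono[OF Imp(2)]) auto
  show ?case
  proof (cases "peval v A")
    case False
    have "derives T (insert A ?G) B"
      by (rule derives_dn, rule derives.mp[of _ _ A])
        (use A False in \<open>auto intro: derives.hyp simp: Neg_def elim!: derives_mono\<close>)
    then show ?thesis using False derives_imp by simp
  next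
    case True
    show ?thesis
    proof (cases "peval v B")
      case True
      then show ?thesis using B derives_K by simp
    next
      case False
      have "derives T (insert (A \<rightharpoonup> B) ?G) Bot"
        by (rule derives.mp[of _ _ B], rule derives.mp[of _ _ A])
          (use A B False True in \<open>auto intro: derives.hyp simp: Neg_def elim!: derives_mono\<close>)
      then show ?thesis using False True derives_imp by (simp add: Neg_def)
    qed
  qed
qed (auto simp: lit_def intro: derives.hyp)

lemma derives_cases:
  "derives T (insert A G) B \<Longrightarrow> derives T (insert (Neg A) G) B \<Longrightarrow> derives T G B"
proof (rule derives_dn)
  let ?H = "insert (Neg B) G"
  assume "derives T (insert A G) B" "derives T (insert (Neg A) G) B"
  then have "derives T (insert A ?H) B" "derives T (insert (Neg A) ?H) B"
    by (blast intro: derives_mono)+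
  then have a: "derives T ?H (A \<rightharpoonup> B)" "derives T ?H (Neg A \<rightharpoonup> B)"
    by (auto intro: derives_imp)
  have n: "derives T H (Neg B)" if "?H \<subseteq> H" for H using that by (auto intro: derives.hyp)
  have "derives T (insert A ?H) Bot"
    by (rule derives.mp[of _ _ B], rule derives.mp[of _ _ A])
      (use derives_mono[OF a(1), of "insert A ?H"] n[of "insert A ?H"] in \<open>auto intro: derives.hyp simp: Neg_def\<close>)
  then have "derives T ?H (Neg A)" unfolding Neg_def[of A] by (rule derives_imp)
  then have "derives T ?H B" using a(2) derives.mp by blast
  then show "derives T ?H Bot" using n[of ?H] derives.mp unfolding Neg_def by blast
qed

text \<open>Literals are removed one atom at a time: changing \<open>v\<close> at the new atom
  leaves the literals over \<open>F\<close> alone, so \<open>derives_cases\<close> applies.\<close>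

lemma derives_elim:
  "finite F \<Longrightarrow> (\<And>v. derives T (lit v ` F) A) \<Longrightarrow> derives T {} A"
proof (induction F rule: finite_induct)
  case (insert a F)
  have "derives T (lit v ` F) A" for v
  proof (rule derives_cases[of _ a])
    have 1: "lit (v(a := b)) ` F = lit v ` F" for b
      using insert(2) by (auto simp: lit_def image_iff split: if_splits)
    show "derives T (insert a (lit v ` F)) A" "derives T (insert (Neg a) (lit v ` F)) A"
      using insert(4)[of "v(a := True)"] insert(4)[of "v(a := False)"] unfolding image_insert 1 by (simp_all add: lit_def)
  qed
  then show ?case using insert(3) by blast
qed simp

lemma finite_atoms: "finite (atoms A)" by (induction A) auto

text \<open>Since \<open>peval\<close> treats universal formulas as atoms, this covers all
  first-order instances of tautologies; the propositional steps below rest on it.\<close>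

theorem taut: assumes "\<And>v. peval v A" shows "T \<turnstile> A"
proof -
  have "derives T (lit v ` atoms A) A" for v using kalmar[of T v A] assms by simp
  then show ?thesis using derives_empty derives_elim finite_atoms by blast
qed

lemma taut1: "T \<turnstile> A \<Longrightarrow> (\<And>v. peval v A \<Longrightarrow> peval v B) \<Longrightarrow> T \<turnstile> B"
  by (rule proves.MP[OF _ taut]) auto
lemma taut2: "T \<turnstile> A \<Longrightarrow> T \<turnstile> B \<Longrightarrow> (\<And>v. peval v A \<Longrightarrow> peval v B \<Longrightarrow> peval v C) \<Longrightarrow> T \<turnstile> C"
  by (rule taut1[of _ "A \<sqinter> B"]) (auto intro: proves.MP[OF _ proves.MP[OF _ taut]])

lemma imp_trans: "T \<turnstile> (A \<rightharpoonup> B) \<Longrightarrow> T \<turnstile> (B \<rightharpoonup> C) \<Longrightarrow> T \<turnstile> (A \<rightharpoonup> C)"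
  by (rule taut2[of T "A \<rightharpoonup> B" "B \<rightharpoonup> C"]) auto

section \<open>Quantifier rules for de Bruijn formulas\<close>

lemma subst_tm_lift: "subst_tm k s (lift_tm k 1 t) = t" by (induction t) auto
lemma subst_fm_lift: "subst_fm k s (lift_fm k 1 A) = A"
  by (induction A arbitrary: k) (auto simp: subst_tm_lift[simplified])
lemma subst_tm_var: "subst_tm k (Var 0) (lift_tm (Suc k) 1 t) = t" by (induction t) auto
lemma subst_fm_var: "subst_fm k (Var 0) (lift_fm (Suc k) 1 A) = A"
  by (induction A arbitrary: k) (auto simp: subst_tm_var[simplified])

lemma all_lift: "T \<turnstile> (All (lift_fm 0 1 A) \<rightharpoonup> A)"
  using proves.Log[OF log_ax.Inst[of "lift_fm 0 1 A" Zero]] by (simp add: subst_fm_lift[simplified])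

text \<open>The body of the lifted formula is \<open>lift_fm 1 1 A\<close>, and instantiating it
  with \<open>Var 0\<close> gives back \<open>A\<close>. This opens a universal premise under the
  binder of \<open>dist\<close>.\<close>

lemma inst_lifted: "T \<turnstile> (lift_fm 0 1 (All A) \<rightharpoonup> A)"
  using proves.Log[OF log_ax.Inst[of "lift_fm 1 1 A" "Var 0"]] subst_fm_var[of 0 A] by simp

lemma dist: "T \<turnstile> (lift_fm 0 1 A \<rightharpoonup> B) \<Longrightarrow> T \<turnstile> (A \<rightharpoonup> All B)"
  by (rule proves.MP[OF proves.Gen proves.Log[OF log_ax.Dist]])

lemma all_mono: "T \<turnstile> (A \<rightharpoonup> B) \<Longrightarrow> T \<turnstile> (All A \<rightharpoonup> All B)"
  by (rule dist) (rule taut2[OF inst_lifted[of T A]], auto)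

lemma all_mono2: assumes "T \<turnstile> (A \<rightharpoonup> B \<rightharpoonup> C)" shows "T \<turnstile> (All A \<rightharpoonup> All B \<rightharpoonup> All C)"
proof -
  have "T \<turnstile> (All A \<sqinter> All B \<rightharpoonup> All C)"
  proof (rule dist)
    have "lift_fm 0 1 (All A \<sqinter> All B) = (lift_fm 0 1 (All A) \<sqinter> lift_fm 0 1 (All B))"
      by (simp add: And_def Neg_def)
    then show "T \<turnstile> (lift_fm 0 1 (All A \<sqinter> All B) \<rightharpoonup> C)"
      by (auto intro!: taut2[OF taut2[OF inst_lifted[of T A] inst_lifted[of T B]] assms, of "lift_fm 0 1 (All A) \<sqinter> lift_fm 0 1 (All B) \<rightharpoonup> A \<sqinter> B"])
  qed
  then show ?thesis by (rule taut1) auto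
qed

text \<open>An unbounded denial refutes the bounded existential by mere weakening, whatever the
  bound: no fact about \<open>\<preceq>\<close> or about \<open>t\<close> enters.\<close>

lemma BExi_neg: assumes "T \<turnstile> (A \<rightharpoonup> Neg B)" shows "T \<turnstile> (All A \<rightharpoonup> Neg (BExi t B))"
proof -
  have "T \<turnstile> (All A \<rightharpoonup> BAll t (Neg B))" unfolding BAll_def
    by (rule all_mono, rule taut1[OF assms]) auto
  then show ?thesis unfolding BExi_def by (rule taut1) auto
qed

section \<open>Deduction theorem and finite conjunctions of axioms\<close>

lemma lift_sentence: "sentence S \<Longrightarrow> lift_fm 0 1 S = S"
  using lift_fm_closed[of 0 S] by (simp add: sentence_def)

text \<open>\<open>Gen\<close> is harmless because lifting fixes the sentence \<open>S\<close>, so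
  that \<open>dist\<close> moves the quantifier past it.\<close>

lemma deduction: assumes "sentence S" shows "insert S T \<turnstile> A \<Longrightarrow> T \<turnstile> (S \<rightharpoonup> A)"
proof (induction rule: proves.induct)
  case (Ax A)
  then show ?case by (metis insertE proves.Ax proves_I taut1 peval.simps(4))
next
  case (Log A)
  then show ?case by (metis proves.Log taut1 peval.simps(4))
next
  case (MP A B)
  show ?case by (rule taut2[OF MP(3,4)]) auto
next
  case (Gen A)
  show ?case by (rule dist) (use Gen(2) lift_sentence[OF assms] in simp)
qed

lemma proves_mono: "T \<turnstile> A \<Longrightarrow> T \<subseteq> U \<Longrightarrow> U \<turnstile> A"
  by (induction rule: proves.induct) (auto intro: proves.intros)

lemma sentence_conn[simp]: "sentence (A \<sqinter> B) \<longleftrightarrow> sentence A \<and> sentence B" "sentence Top"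
  by (auto simp: sentence_def And_def Neg_def Top_def)

lemma conj_of_sentence: assumes "\<forall>A\<in>T. sentence A" shows "S \<in> conj_of T \<Longrightarrow> sentence S"
  by (induction rule: conj_of.induct) (use assms in auto)

lemma conj_of_proves: "S \<in> conj_of T \<Longrightarrow> T \<turnstile> S"
proof (induction rule: conj_of.induct)
  case (3 A B)
  show ?case by (rule taut2[OF 3(3,4)]) auto
qed (auto intro: taut proves.Ax)

text \<open>Modus ponens conjoins two supports, and generalisation keeps the support because it is a
  sentence. The outcome is provability in pure logic, which is what \<open>Proof\<close>
  arithmetises.\<close>

lemma finite_support:
  assumes "\<forall>A\<in>T. sentence A"
  shows "T \<turnstile> A \<Longrightarrow> \<exists>S\<in>conj_of T. {} \<turnstile> (S \<rightharpoonup> A)"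
proof (induction rule: proves.induct)
  case (Ax A)
  then show ?case by (auto intro: conj_of.intros proves_I)
next
  case (Log A)
  have "{} \<turnstile> (Top \<rightharpoonup> A)" by (rule taut1[OF proves.Log[OF Log]]) auto
  then show ?case by (auto intro: conj_of.intros)
next
  case (MP A B)
  then obtain S S' where S: "S \<in> conj_of T" "S' \<in> conj_of T" "{} \<turnstile> (S \<rightharpoonup> A)" "{} \<turnstile> (S' \<rightharpoonup> A \<rightharpoonup> B)" by blast
  have "{} \<turnstile> (S \<sqinter> S' \<rightharpoonup> B)" by (rule taut2[OF S(3,4)]) auto
  then show ?case using S by (auto intro: conj_of.intros)
next
  case (Gen A)
  then obtain S where S: "S \<in> conj_of T" "{} \<turnstile> (S \<rightharpoonup> A)" by blast
  have "{} \<turnstile> (S \<rightharpoonup> All A)"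
    by (rule dist) (use S lift_sentence conj_of_sentence[OF assms] in simp)
  then show ?case using S by blast
qed

section \<open>Free variables, lifting and substitution\<close>

text \<open>Such a bound simply grows by one under a binder, so the simplifier can compute it
  through the large arithmetised formulas.\<close>

definition tm_below :: "nat \<Rightarrow> tm \<Rightarrow> bool" where "tm_below c t \<longleftrightarrow> fvt t \<subseteq> {..<c}"
definition fm_below :: "nat \<Rightarrow> fm \<Rightarrow> bool" where "fm_below c A \<longleftrightarrow> fv A \<subseteq> {..<c}"

lemma sentence_below: "sentence A \<longleftrightarrow> fm_below 0 A" by (simp add: sentence_def fm_below_def)

lemma tm_below_simps[simp]:
  "tm_below c Zero" "tm_below c (Var n) \<longleftrightarrow> n < c" "tm_below c (Succ t) \<longleftrightarrow> tm_below c t" "tm_below c (Exp t) \<longleftrightarrow> tm_below c t"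
  "tm_below c (s \<oplus> t) \<longleftrightarrow> tm_below c s \<and> tm_below c t" "tm_below c (s \<otimes> t) \<longleftrightarrow> tm_below c s \<and> tm_below c t"
  by (auto simp: tm_below_def)
lemma tm_below_num[simp]: "tm_below c (num n)" by (induction n) auto
lemma tm_below_up_Suc[simp]: "tm_below (Suc c) (up (Suc k) t) \<longleftrightarrow> tm_below c (up k t)"
  by (induction t) auto
lemma tm_below_up_numeral[simp]: "tm_below (Suc c) (up (numeral k) t) \<longleftrightarrow> tm_below c (up (pred_numeral k) t)"
  by (simp add: numeral_eq_Suc)

lemma fm_below_All[simp]: "fm_below c (All A) \<longleftrightarrow> fm_below (Suc c) A"
  unfolding fm_below_def by (auto simp: subset_iff less_Suc_eq_0_disj) (metis not0_implies_Suc)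
lemma fm_below_simps[simp]:
  "fm_below c Bot" "fm_below c (s \<doteq> t) \<longleftrightarrow> tm_below c s \<and> tm_below c t" "fm_below c (s \<preceq> t) \<longleftrightarrow> tm_below c s \<and> tm_below c t"
  "fm_below c (A \<rightharpoonup> B) \<longleftrightarrow> fm_below c A \<and> fm_below c B"
  by (auto simp: fm_below_def tm_below_def)
lemma fm_below_conn[simp]:
  "fm_below c Top" "fm_below c (Neg A) \<longleftrightarrow> fm_below c A" "fm_below c (A \<sqinter> B) \<longleftrightarrow> fm_below c A \<and> fm_below c B"
  "fm_below c (A \<squnion> B) \<longleftrightarrow> fm_below c A \<and> fm_below c B" "fm_below c (Exi A) \<longleftrightarrow> fm_below (Suc c) A"
  "fm_below c (BAll t A) \<longleftrightarrow> tm_below c t \<and> fm_below (Suc c) A"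
  "fm_below c (BExi t A) \<longleftrightarrow> tm_below c t \<and> fm_below (Suc c) A"
  by (auto simp: Top_def Neg_def And_def Or_def Exi_def BAll_def BExi_def)
lemma fm_below_BExis[simp]:
  "fm_below c (BExis (numeral k) t A) \<longleftrightarrow> tm_below c t \<and> fm_below (Suc c) (BExis (pred_numeral k) (up 1 t) A)"
  by (simp add: numeral_eq_Suc)

lemma tm_below_codes[simp]:
  "tm_below c (varT t) \<longleftrightarrow> tm_below c t" "tm_below c (succT t) \<longleftrightarrow> tm_below c t"
  "tm_below c (expT t) \<longleftrightarrow> tm_below c t" "tm_below c (allT t) \<longleftrightarrow> tm_below c t"
  "tm_below c (dbl s t) \<longleftrightarrow> tm_below c s \<and> tm_below c t"
  by (auto simp: varT_def succT_def expT_def allT_def dbl_def simp del: num.simps)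

lemma fm_below_is[simp]:
  "fm_below c (isPair x a b) \<longleftrightarrow> tm_below c x \<and> tm_below c a \<and> tm_below c b"
  "fm_below c (isAdd x a b) \<longleftrightarrow> tm_below c x \<and> tm_below c a \<and> tm_below c b"
  "fm_below c (isMul x a b) \<longleftrightarrow> tm_below c x \<and> tm_below c a \<and> tm_below c b"
  "fm_below c (isEq x a b) \<longleftrightarrow> tm_below c x \<and> tm_below c a \<and> tm_below c b"
  "fm_below c (isLe x a b) \<longleftrightarrow> tm_below c x \<and> tm_below c a \<and> tm_below c b"
  "fm_below c (isImp x a b) \<longleftrightarrow> tm_below c x \<and> tm_below c a \<and> tm_below c b"
  by (auto simp: isPair_def isAdd_def isMul_def isEq_def isLe_def isImp_def simp del: num.simps)
lemma fm_below_isAnd[simp]: "fm_below c (isAnd x a b) \<longleftrightarrow> tm_below c x \<and> tm_below c a \<and> tm_below c b"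
  by (auto simp: isAnd_def)

lemma fm_below_Mem[simp]: "fm_below c (Mem z y) \<longleftrightarrow> tm_below c z \<and> tm_below c y"
  by (auto simp: Mem_def)
lemma fm_below_Mem2[simp]: "fm_below c (Mem2 a b y) \<longleftrightarrow> tm_below c a \<and> tm_below c b \<and> tm_below c y"
  by (auto simp: Mem2_def)
lemma fm_below_Mem3[simp]: "fm_below c (Mem3 a b d y) \<longleftrightarrow> tm_below c a \<and> tm_below c b \<and> tm_below c d \<and> tm_below c y"
  by (auto simp: Mem3_def)

lemma fm_below_MapT:
  assumes "\<And>c q d n b. tm_below c q \<Longrightarrow> tm_below c d \<Longrightarrow> tm_below c n \<Longrightarrow> tm_below c b \<Longrightarrow> fm_below c (l q d n b)"
    and "tm_below c q" "tm_below c d" "tm_below c a" "tm_below c b"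
  shows "fm_below c (MapT l q d a b)"
  using assms(2-) by (simp add: MapT_def MapT_step_def assms(1))
lemma fm_below_MapF:
  assumes "\<And>c q d n b. tm_below c q \<Longrightarrow> tm_below c d \<Longrightarrow> tm_below c n \<Longrightarrow> tm_below c b \<Longrightarrow> fm_below c (l q d n b)"
    and "tm_below c q" "tm_below c d" "tm_below c a" "tm_below c b"
  shows "fm_below c (MapF l q d a b)"
  using assms(2-) by (simp add: MapF_def MapF_step_def assms(1))
lemma fm_below_LiftT[simp]: "tm_below c q \<Longrightarrow> tm_below c d \<Longrightarrow> tm_below c a \<Longrightarrow> tm_below c b \<Longrightarrow> fm_below c (LiftT q d a b)"
  unfolding LiftT_def by (rule fm_below_MapT) auto
lemma fm_below_SubstT[simp]: "tm_below c q \<Longrightarrow> tm_below c d \<Longrightarrow> tm_below c a \<Longrightarrow> tm_below c b \<Longrightarrow> fm_below c (SubstT q d a b)"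
  unfolding SubstT_def by (rule fm_below_MapT) auto
lemma fm_below_LiftF[simp]: "tm_below c q \<Longrightarrow> tm_below c d \<Longrightarrow> tm_below c a \<Longrightarrow> tm_below c b \<Longrightarrow> fm_below c (LiftF q d a b)"
  unfolding LiftF_def by (rule fm_below_MapF) auto
lemma fm_below_SubstF[simp]: "tm_below c q \<Longrightarrow> tm_below c d \<Longrightarrow> tm_below c a \<Longrightarrow> tm_below c b \<Longrightarrow> fm_below c (SubstF q d a b)"
  unfolding SubstF_def by (rule fm_below_MapF) auto

lemma fm_below_Closed[simp]: "tm_below c x \<Longrightarrow> fm_below c (Closed x)"
  by (simp add: Closed_def del: num.simps)
lemma fm_below_isDelta0[simp]: "tm_below c x \<Longrightarrow> fm_below c (isDelta0 x)"
  by (simp add: isDelta0_def isDelta0_step_def del: num.simps)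
lemma fm_below_isPi1[simp]: "tm_below c x \<Longrightarrow> fm_below c (isPi1 x)"
  by (simp add: isPi1_def)
lemma fm_below_ValTable[simp]: "tm_below c V \<Longrightarrow> fm_below c (ValTable V)"
  by (simp add: ValTable_def ValTable_step_def)
lemma fm_below_TruthTable[simp]: "tm_below c V \<Longrightarrow> tm_below c W \<Longrightarrow> fm_below c (TruthTable V W)"
  by (simp add: TruthTable_def TruthTable_step_def del: num.simps)
lemma fm_below_isLogAx[simp]: "tm_below c x \<Longrightarrow> fm_below c (isLogAx x)"
  by (simp add: isLogAx_def del: num.simps)
lemma fm_below_Proof[simp]: "tm_below c y \<Longrightarrow> tm_below c x \<Longrightarrow> fm_below c (Proof y x)"
  by (simp add: Proof_def Proof_step_def)

lemma subst_tm_same: "tm_below (Suc k) t \<Longrightarrow> subst_tm k (Var 0) t = t" by (induction t) auto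
lemma subst_fm_same: "fm_below (Suc k) A \<Longrightarrow> subst_fm k (Var 0) A = A"
  by (induction A arbitrary: k) (auto simp: subst_tm_same)

lemma fm_below_ConjAx[simp]: "fm_below 1 A \<Longrightarrow> tm_below c x \<Longrightarrow> fm_below c (ConjAx A x)"
  unfolding ConjAx_def
  by (simp add: subst_fm_same del: num.simps) (auto simp: fm_below_def)

lemma tm_below_lift: "tm_below c t \<Longrightarrow> tm_below (Suc c) (lift_tm k 1 t)" by (induction t) auto
lemma fm_below_lift: "fm_below c A \<Longrightarrow> fm_below (Suc c) (lift_fm k 1 A)"
  by (induction A arbitrary: k c) (auto simp: tm_below_lift[simplified])
lemma lift_tm_below: "tm_below c t \<Longrightarrow> lift_tm c d t = t" by (induction t) auto
lemma subst_tm_below: "tm_below k t \<Longrightarrow> subst_tm k s t = t" by (induction t) auto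
lemma subst_fm_below: "fm_below k A \<Longrightarrow> subst_fm k s A = A"
  by (induction A arbitrary: k) (auto simp: subst_tm_below)
lemma tm_below_subst: "tm_below 0 s \<Longrightarrow> tm_below (Suc k) t \<Longrightarrow> tm_below k (subst_tm k s t)"
proof (induction t)
  case (Var n)
  have "tm_below k s" using Var(1) by (auto simp: tm_below_def)
  then show ?case using Var lift_tm_below[of 0 s] by auto
qed auto
lemma fm_below_subst: "tm_below 0 s \<Longrightarrow> fm_below (Suc k) A \<Longrightarrow> fm_below k (subst_fm k s A)"
  by (induction A arbitrary: k) (auto simp: tm_below_subst)

text \<open>Commutation with the lifted bound inside \<open>BAll\<close>; this is what keeps
  \<open>\<Delta>\<^sub>0\<close>-formulas closed under lifting.\<close>

lemma lift_tm_up: "lift_tm (Suc c) d (up 1 t) = up 1 (lift_tm c d t)" by (induction t) auto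
lemma up_up: "up 1 (up k t) = up (Suc k) t" by (induction t) auto
lemma subst_tm_up: "subst_tm (Suc k) s (up 1 t) = up 1 (subst_tm k s t)"
  by (induction t) (auto simp: up_up[simplified])
lemma delta0_lift: "delta0 A \<Longrightarrow> delta0 (lift_fm c d A)"
  by (induction arbitrary: c rule: delta0.induct)
    (auto simp: BAll_def lift_tm_up[simplified] intro: delta0.intros delta0.intros(5)[unfolded BAll_def, simplified])
lemma delta0_subst: "delta0 A \<Longrightarrow> delta0 (subst_fm k s A)"
  by (induction arbitrary: k rule: delta0.induct)
    (auto simp: BAll_def subst_tm_up[simplified] intro: delta0.intros delta0.intros(5)[unfolded BAll_def, simplified])
lemma pi1_subst: "pi1 A \<Longrightarrow> pi1 (subst_fm k s A)"
  by (induction arbitrary: k rule: pi1.induct) (auto intro: pi1.intros delta0_subst)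

lemma sat_lift: "sat e (lift_fm c d A) \<longleftrightarrow> sat (\<lambda>n. if n < c then e n else e (n + d)) A"
proof (induction A arbitrary: e c)
  case (All A)
  have "(\<lambda>n. if n < Suc c then case_nat m e n else case_nat m e (n + d)) = case_nat m (\<lambda>n. if n < c then e n else e (n + d))" for m
    by (auto simp: fun_eq_iff split: nat.split)
  then show ?case by (simp add: All)
qed (auto simp: nval_lift)

section \<open>Proofs involving bounded quantifiers\<close>

lemma BAll_mono: "T \<turnstile> (A \<rightharpoonup> B) \<Longrightarrow> T \<turnstile> (BAll t A \<rightharpoonup> BAll t B)"
  unfolding BAll_def by (rule all_mono) (rule taut1, auto)
lemma BExi_mono: "T \<turnstile> (A \<rightharpoonup> B) \<Longrightarrow> T \<turnstile> (BExi t A \<rightharpoonup> BExi t B)"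
  unfolding BExi_def by (rule taut1[OF BAll_mono[of T "Neg B" "Neg A"]], rule taut1) auto

text \<open>The axiom formula occurs only positively in \<open>ConjAx\<close>.\<close>

lemma ConjAx_mono:
  assumes "T \<turnstile> (A \<rightharpoonup> B)" "fm_below 1 A" "fm_below 1 B"
  shows "T \<turnstile> (ConjAx A x \<rightharpoonup> ConjAx B x)"
proof -
  have s: "subst_fm 0 (Var 0) A = A" "subst_fm 0 (Var 0) B = B"
    using subst_fm_same[of 0] assms by simp_all
  have "T \<turnstile> (BAll t (M \<rightharpoonup> E \<squnion> A \<squnion> C) \<rightharpoonup> BAll t (M \<rightharpoonup> E \<squnion> B \<squnion> C))" for t M E C
    by (rule BAll_mono, rule taut1[OF assms(1)]) auto
  note b = this
  have c: "T \<turnstile> (D \<sqinter> BAll t (M \<rightharpoonup> E \<squnion> A \<squnion> C) \<rightharpoonup> D \<sqinter> BAll t (M \<rightharpoonup> E \<squnion> B \<squnion> C))" for t M E C D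
    by (rule taut1[OF b[of t M E C]]) auto
  show ?thesis unfolding ConjAx_def s by (rule BExi_mono, rule c)
qed

lemma fv_BExi_num: "fv (BExi (num w) A) = {n. Suc n \<in> fv A}"
proof -
  have "fvt (lift_tm 0 1 (num w)) = {}" by (induction w) auto
  then show ?thesis by (auto simp: BExi_def BAll_def Neg_def)
qed

text \<open>A \<open>\<Sigma>\<^sub>1\<close>-formula is approximated by \<open>\<Delta>\<^sub>0\<close>-formulas implying it by pure logic; \<open>w\<close> bounds
  the witnesses.\<close>

lemma sigma1_bounded:
  assumes "sigma1 A"
  obtains B :: "nat \<Rightarrow> fm" where "\<And>w. delta0 (B w)" "\<And>w. fv (B w) \<subseteq> fv A" "\<And>w. {} \<turnstile> (B w \<rightharpoonup> A)"
    "\<And>e. sat e A \<Longrightarrow> \<exists>w0. \<forall>w\<ge>w0. sat e (B w)"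
  using assms
proof (induction arbitrary: thesis rule: sigma1.induct)
  case (1 A)
  show ?case by (rule 1(2)[of "\<lambda>w. A"]) (use 1(1) in \<open>simp_all add: proves_I\<close>)
next
  case (2 A)
  obtain B :: "nat \<Rightarrow> fm" where B: "\<And>w. delta0 (B w)" "\<And>w. fv (B w) \<subseteq> fv A" "\<And>w. {} \<turnstile> (B w \<rightharpoonup> A)"
    "\<And>e. sat e A \<Longrightarrow> \<exists>w0. \<forall>w\<ge>w0. sat e (B w)" by (rule 2(2), erule that)
  show ?case
  proof (rule 2(3)[of "\<lambda>w. BExi (num w) (B w)"])
    fix w
    show "delta0 (BExi (num w) (B w))" by (intro delta0_simps B(1))
    show "fv (BExi (num w) (B w)) \<subseteq> fv (Exi A)" unfolding fv_BExi_num
      using B(2)[of w] by (auto simp: Exi_def Neg_def)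
    have "{} \<turnstile> (All (Neg A) \<rightharpoonup> Neg (BExi (num w) (B w)))"
      by (rule BExi_neg, rule taut1[OF B(3)[of w]]) auto
    then show "{} \<turnstile> (BExi (num w) (B w) \<rightharpoonup> Exi A)" unfolding Exi_def by (rule taut1) auto
  next
    fix e assume "sat e (Exi A)"
    then obtain n where "sat (case_nat n e) A" by auto
    then obtain w0 where "\<forall>w\<ge>w0. sat (case_nat n e) (B w)" using B(4) by blast
    then have "sat e (BExi (num w) (B w))" if "w \<ge> max n w0" for w
      using that unfolding sat_conn nval_num by (intro exI[of _ n]) simp
    then show "\<exists>w0. \<forall>w\<ge>w0. sat e (BExi (num w) (B w))" by blast
  qed
qed

lemma Neg_All: "T \<turnstile> (Neg A \<rightharpoonup> B) \<Longrightarrow> T \<turnstile> (Neg (All A) \<rightharpoonup> Exi B)"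
  unfolding Exi_def by (rule taut1[OF all_mono[of T "Neg B" A]], rule taut1[of T "Neg A \<rightharpoonup> B"]) auto

text \<open>The class \<open>sigma1\<close> is syntactic, and the negation of \<open>All A\<close>
  need not have the form \<open>Exi B\<close>. The provable implication suffices to pass from a
  refutation of \<open>A\<close> to a proof of a \<open>\<Sigma>\<^sub>1\<close>-formula.\<close>

lemma pi1_Neg: "pi1 A \<Longrightarrow> \<exists>B. sigma1 B \<and> fv B = fv A \<and> {} \<turnstile> (Neg A \<rightharpoonup> B) \<and> (\<forall>e. sat e B \<longleftrightarrow> \<not> sat e A)"
proof (induction rule: pi1.induct)
  case (1 A)
  then show ?case
    by (intro exI[of _ "Neg A"]) (simp add: proves_I sigma1.intros(1) delta0_simps, simp add: Neg_def)
next
  case (2 A)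
  then obtain B where B: "sigma1 B" "fv B = fv A" "{} \<turnstile> (Neg A \<rightharpoonup> B)" "\<forall>e. sat e B \<longleftrightarrow> \<not> sat e A" by blast
  have "fv (Exi B) = fv (All A)" using B(2) by (simp add: Exi_def Neg_def)
  moreover have "sigma1 (Exi B)" "{} \<turnstile> (Neg (All A) \<rightharpoonup> Exi B)" using B sigma1.intros(2) Neg_All by blast+
  moreover have "\<forall>e. sat e (Exi B) \<longleftrightarrow> \<not> sat e (All A)" using B(4) by simp
  ultimately show ?case by blast
qed

section \<open>The self-referential sentence\<close>

text \<open>Expresses that \<open>c\<close> codes the numeral of \<open>n\<close>: every pair in the
  table \<open>F\<close> is the initial one or rests on the pair one step below. \<open>F\<close> is
  an argument so that \<open>Diag\<close> can bound it.\<close>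

definition NumCode :: "tm \<Rightarrow> tm \<Rightarrow> tm \<Rightarrow> fm" where
  "NumCode n c F = (Mem2 n c F \<sqinter> BAll F (BAll (up 1 F) (Mem2 (Var 1) (Var 0) (up 2 F) \<rightharpoonup>
     (Var 1 \<doteq> Zero \<sqinter> Var 0 \<doteq> Zero) \<squnion> BExis 2 (up 2 F) (Mem2 (Var 1) (Var 0) (up 4 F) \<sqinter>
       Var 3 \<doteq> Succ (Var 1) \<sqinter> Var 2 \<doteq> succT (Var 0)))))"

text \<open>Codes of instances at the numeral of \<open>n\<close> are at most
  \<open>2 ^ (c * Suc n)\<close>, and coding a set costs one more exponential. Two further ones
  absorb the unknown constant \<open>c\<close> for large \<open>n\<close>.\<close>

abbreviation exp4 :: "tm \<Rightarrow> tm" where "exp4 t \<equiv> Exp (Exp (Exp (Exp t)))"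

text \<open>If \<open>q\<close> codes a pair \<open>\<langle>z, m\<rangle>\<close>, then \<open>t\<close> is the code of the formula \<open>z\<close> with the numeral of
  \<open>q\<close> substituted for the variable 0.\<close>

definition Diag :: "tm \<Rightarrow> tm \<Rightarrow> fm" where
  "Diag q t = BExi q (BExi (up 1 q) (BExi (exp4 (up 2 q)) (BExi (exp4 (up 3 q))
     (isPair (up 4 q) (Var 3) (Var 2) \<sqinter> NumCode (up 4 q) (Var 1) (Var 0) \<sqinter>
      SubstF (Var 1) Zero (Var 3) (up 4 t)))))"

text \<open>With \<open>q\<close> as the variable 0: the formula \<open>t\<close> diagonalised at \<open>q\<close> is refuted, together with
  a conjunction \<open>s\<close> of axioms, by a proof \<open>u\<close> bounded in terms of \<open>q\<close>. The variables \<open>s\<close>, \<open>t\<close>, \<open>u\<close> and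
  the codes of \<open>s \<and> t\<close> and \<open>s \<and> t \<rightarrow> \<bottom>\<close> are bound in the same order as in \<open>Sigma1_Sound\<close>, so that
  the two formulas can be played off against each other without any substitution.\<close>

definition Refuted :: "fm \<Rightarrow> fm" where
  "Refuted Ax = BExi (exp4 (Var 0)) (BExi (exp4 (Var 1)) (BExi (exp4 (Var 2))
     (ConjAx Ax (Var 2) \<sqinter> Diag (Var 3) (Var 1) \<sqinter> BExi (exp4 (Var 3)) (BExi (exp4 (Var 4))
       (isAnd (Var 1) (Var 4) (Var 3) \<sqinter> isImp (Var 0) (Var 1) Zero \<sqinter> Proof (Var 2) (Var 0))))))"

text \<open>The matrix of \<open>Pi1_True (Var 1)\<close>: below the quantifiers over the two
  tables, the tested formula has become \<open>Var 3\<close>.\<close>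

definition True_mat :: fm where
  "True_mat = (Closed (Var 3) \<sqinter> isPi1 (Var 3) \<sqinter>
     (ValTable (Var 1) \<sqinter> TruthTable (Var 1) (Var 0) \<rightharpoonup> Neg (Mem3 (Var 3) Zero Zero (Var 0))))"

text \<open>\<open>Self\<close> asserts of the diagonalised formula \<open>t\<close> both \<open>Refuted\<close> and, by means of all tables \<open>V\<close>
  and \<open>W\<close>, \<open>Pi1_True\<close>. It is \<open>\<Pi>\<^sub>1\<close> because the quantifiers over \<open>s\<close>, \<open>t\<close>, \<open>u\<close>, \<open>V\<close>, \<open>W\<close> (variables 4
  to 0; \<open>s\<close> and \<open>u\<close> are dummies) come first. The liftings skip unused variables.\<close>

definition Self_mat :: "fm \<Rightarrow> fm" where
  "Self_mat Ax = (lift_fm 0 1 (lift_fm 0 1 (lift_fm 0 1 (lift_fm 0 1 (lift_fm 0 1 (Refuted Ax))))) \<sqinter>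
     (lift_fm 0 1 (lift_fm 0 1 (Diag (Var 3) (Var 1))) \<rightharpoonup> True_mat))"

definition Self :: "fm \<Rightarrow> fm" where
  "Self Ax = All (All (All (All (All (Self_mat Ax)))))"

lemma Pi1_True_mat: "Pi1_True (Var 1) = All (All True_mat)"
  by (simp add: Pi1_True_def True_mat_def eval_nat_numeral)

text \<open>\<open>Refuted\<close> supplies \<open>s\<close>, \<open>t\<close>, \<open>u\<close>;
  the other conjunct of \<open>Self\<close> turns \<open>Diag\<close> into \<open>Pi1_True\<close>;
  soundness then denies that \<open>u\<close> is a proof. \<open>Diag\<close> is never unfolded and
  its parameter stays a free variable.\<close>

lemma Self_refutable:
  assumes snd: "T \<turnstile> Sigma1_Sound Ax" and ax: "T \<turnstile> (Ax' \<rightharpoonup> Ax)" and b: "fm_below 1 Ax" "fm_below 1 Ax'"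
  shows "T \<turnstile> (Self Ax' \<rightharpoonup> Bot)"
proof -
  let ?D = "Diag (Var 3) (Var 1)"
  let ?Y = "isAnd (Var 1) (Var 4) (Var 3) \<sqinter> isImp (Var 0) (Var 1) Zero" and ?P = "Proof (Var 2) (Var 0)"
  let ?X = "ConjAx Ax' (Var 2) \<sqinter> ?D \<sqinter> BExi (exp4 (Var 3)) (BExi (exp4 (Var 4))
       (isAnd (Var 1) (Var 4) (Var 3) \<sqinter> isImp (Var 0) (Var 1) Zero \<sqinter> ?P))"
  let ?S = "ConjAx Ax (Var 2) \<sqinter> Pi1_True (Var 1) \<rightharpoonup> All (All (?Y \<rightharpoonup> Neg ?P))"
  \<comment> \<open>Project to the first conjunct, then strip the five vacuous quantifiers one by
    one.\<close>
  have "T \<turnstile> (Self Ax' \<rightharpoonup> All (All (All (All (All (lift_fm 0 1 (lift_fm 0 1 (lift_fm 0 1 (lift_fm 0 1 (lift_fm 0 1 (Refuted Ax')))))))))))"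
    unfolding Self_def Self_mat_def by (rule all_mono)+ (rule taut, simp)
  then have "T \<turnstile> (Self Ax' \<rightharpoonup> All (All (All (All (lift_fm 0 1 (lift_fm 0 1 (lift_fm 0 1 (lift_fm 0 1 (Refuted Ax')))))))))"
    by (rule imp_trans[OF _ all_mono[OF all_mono[OF all_mono[OF all_mono[OF all_lift]]]]])
  then have "T \<turnstile> (Self Ax' \<rightharpoonup> All (All (All (lift_fm 0 1 (lift_fm 0 1 (lift_fm 0 1 (Refuted Ax')))))))"
    by (rule imp_trans[OF _ all_mono[OF all_mono[OF all_mono[OF all_lift]]]])
  then have "T \<turnstile> (Self Ax' \<rightharpoonup> All (All (lift_fm 0 1 (lift_fm 0 1 (Refuted Ax')))))"
    by (rule imp_trans[OF _ all_mono[OF all_mono[OF all_lift]]])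
  then have "T \<turnstile> (Self Ax' \<rightharpoonup> All (lift_fm 0 1 (Refuted Ax')))"
    by (rule imp_trans[OF _ all_mono[OF all_lift]])
  then have 1: "T \<turnstile> (Self Ax' \<rightharpoonup> Refuted Ax')"
    by (rule imp_trans[OF _ all_lift])
  \<comment> \<open>\<open>Diag\<close> does not mention the tables, so \<open>Dist\<close> moves
    both table quantifiers inward, where they form \<open>Pi1_True\<close>.\<close>
  have "T \<turnstile> (All (All (lift_fm 0 1 (lift_fm 0 1 ?D) \<rightharpoonup> True_mat)) \<rightharpoonup> ?D \<rightharpoonup> Pi1_True (Var 1))"
    unfolding Pi1_True_mat
    by (rule imp_trans[OF all_mono[OF proves.Log[OF log_ax.Dist]] proves.Log[OF log_ax.Dist]])
  then have "T \<turnstile> (All (All (Self_mat Ax')) \<rightharpoonup> ?D \<rightharpoonup> Pi1_True (Var 1))"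
    unfolding Self_mat_def by (rule imp_trans[rotated]) ((rule all_mono)+, rule taut, simp)
  then have 2: "T \<turnstile> (Self Ax' \<rightharpoonup> All (All (All (?D \<rightharpoonup> Pi1_True (Var 1)))))"
    unfolding Self_def by (rule all_mono[OF all_mono[OF all_mono]])
  have "T \<turnstile> (All (All (?Y \<rightharpoonup> Neg ?P)) \<rightharpoonup> Neg (BExi (exp4 (Var 3)) (BExi (exp4 (Var 4))
       (isAnd (Var 1) (Var 4) (Var 3) \<sqinter> isImp (Var 0) (Var 1) Zero \<sqinter> ?P))))"
    by (rule BExi_neg)+ (rule taut, simp)
  then have "T \<turnstile> (?S \<rightharpoonup> (?D \<rightharpoonup> Pi1_True (Var 1)) \<rightharpoonup> Neg ?X)"
    by (rule taut2[OF _ ConjAx_mono[OF ax b(2,1)], of _ "Var 2"]) auto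
  then have "T \<turnstile> (All (All (All ?S)) \<rightharpoonup> All (All (All (?D \<rightharpoonup> Pi1_True (Var 1)))) \<rightharpoonup> All (All (All (Neg ?X))))"
    by (intro all_mono2)
  then have "T \<turnstile> (All (All (All (?D \<rightharpoonup> Pi1_True (Var 1)))) \<rightharpoonup> All (All (All (Neg ?X))))"
    using proves.MP[OF snd] unfolding Sigma1_Sound_def by simp
  moreover have "T \<turnstile> (All (All (All (Neg ?X))) \<rightharpoonup> Neg (Refuted Ax'))"
    unfolding Refuted_def by (intro BExi_neg proves_I)
  ultimately have "T \<turnstile> (All (All (All (?D \<rightharpoonup> Pi1_True (Var 1)))) \<rightharpoonup> Neg (Refuted Ax'))"
    by (rule taut2) auto
  from taut2[OF this 2, of "Self Ax' \<rightharpoonup> Neg (Refuted Ax')"] have "T \<turnstile> (Self Ax' \<rightharpoonup> Neg (Refuted Ax'))" by auto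
  from taut2[OF this 1] show ?thesis by auto
qed

section \<open>Free variables, complexity and meaning of these formulas\<close>

lemma NumCode_below[simp]: "tm_below c n \<Longrightarrow> tm_below c d \<Longrightarrow> tm_below c F \<Longrightarrow> fm_below c (NumCode n d F)"
  by (simp add: NumCode_def)
lemma Diag_below[simp]: "tm_below c q \<Longrightarrow> tm_below c t \<Longrightarrow> fm_below c (Diag q t)"
  by (simp add: Diag_def)
lemma Refuted_below: "fm_below 1 Ax \<Longrightarrow> fm_below (Suc 0) (Refuted Ax)"
  by (simp add: Refuted_def)
lemma Self_mat_below: assumes "fm_below 1 Ax" shows "fm_below 6 (Self_mat Ax)"
proof -
  have "fm_below (Suc (Suc (Suc (Suc (Suc (Suc 0)))))) (Self_mat Ax)" unfolding Self_mat_def True_mat_def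
    using Refuted_below[OF assms] by (simp add: fm_below_lift del: One_nat_def)
  then show ?thesis by (simp add: eval_nat_numeral)
qed
lemma Self_below: "fm_below 1 Ax \<Longrightarrow> fm_below 1 (Self Ax)"
  using Self_mat_below by (simp add: Self_def eval_nat_numeral)

lemma delta0_Diag: "delta0 (Diag q t)" by (simp add: Diag_def NumCode_def)
lemma delta0_ConjAx: assumes "delta0 A" shows "delta0 (ConjAx A x)"
  using delta0_subst[OF assms] by (simp add: ConjAx_def)
lemma delta0_Self_mat: "delta0 Ax \<Longrightarrow> delta0 (Self_mat Ax)"
  unfolding Self_mat_def True_mat_def Refuted_def
  by (intro delta0_simps delta0_lift d0_basic d0_more delta0_Proof delta0_Diag delta0_ConjAx)

lemma sat_NumCode_iff: "sat e (NumCode n c F) \<longleftrightarrow> prod_encode (nval e n, nval e c) \<in> set_decode (nval e F) \<and>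
    (\<forall>i\<le>nval e F. \<forall>a\<le>nval e F. prod_encode (i, a) \<in> set_decode (nval e F) \<longrightarrow> i = 0 \<and> a = 0 \<or>
      (\<exists>j\<le>nval e F. \<exists>b\<le>nval e F. prod_encode (j, b) \<in> set_decode (nval e F) \<and> i = Suc j \<and> a = 5 * b + 2))"
  by (simp add: NumCode_def)

lemma sat_NumCode: assumes "sat e (NumCode n c F)" shows "nval e c = tcode (num (nval e n))"
proof -
  let ?F = "nval e F"
  have step: "i = 0 \<and> a = 0 \<or> (\<exists>j b. prod_encode (j, b) \<in> set_decode ?F \<and> i = Suc j \<and> a = 5 * b + 2)"
    if "prod_encode (i, a) \<in> set_decode ?F" for i a
    using assms that mem2_le[OF that] unfolding sat_NumCode_iff by blast
  have "prod_encode (i, a) \<in> set_decode ?F \<Longrightarrow> a = tcode (num i)" for i a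
  proof (induction i arbitrary: a)
    case 0 then show ?case using step[OF 0] by auto
  next
    case (Suc i) then show ?case using step[OF Suc(2)] by auto
  qed
  then show ?thesis using assms unfolding sat_NumCode_iff by blast
qed

definition num_set :: "nat \<Rightarrow> nat" where
  "num_set n = set_encode ((\<lambda>i. prod_encode (i, tcode (num i))) ` {..n})"

lemma sat_NumCode_num: assumes "nval e F = num_set (nval e n)" "nval e c = tcode (num (nval e n))"
  shows "sat e (NumCode n c F)"
proof -
  have d: "prod_encode (i, a) \<in> set_decode (num_set k) \<longleftrightarrow> i \<le> k \<and> a = tcode (num i)" for i a k
    unfolding num_set_def by (subst set_encode_inverse) auto
  have "i = 0 \<and> a = 0 \<or> (\<exists>j\<le>num_set k. \<exists>b\<le>num_set k. prod_encode (j, b) \<in> set_decode (num_set k) \<and> i = Suc j \<and> a = 5 * b + 2)"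
    if "prod_encode (i, a) \<in> set_decode (num_set k)" for i a k
  proof (cases i)
    case 0 then show ?thesis using that d by simp
  next
    case (Suc j)
    then have j: "prod_encode (j, tcode (num j)) \<in> set_decode (num_set k)" "a = 5 * tcode (num j) + 2"
      using that d by simp_all
    show ?thesis using mem2_le[OF j(1)] j Suc by blast
  qed
  then show ?thesis unfolding sat_NumCode_iff using assms d by simp
qed

lemma sat_Diag_iff: "sat e (Diag q t) \<longleftrightarrow> (\<exists>z\<le>nval e q. \<exists>m\<le>nval e q. \<exists>c\<le>2^2^2^2^nval e q. \<exists>F\<le>2^2^2^2^nval e q.
    nval e q = prod_encode (z, m) \<and> sat (case_nat F (case_nat c (case_nat m (case_nat z e)))) (NumCode (up 4 q) (Var 1) (Var 0)) \<and>
    nval e t = fcode (subst_fm 0 (inv tcode c) (inv fcode z)))"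
  by (simp add: Diag_def sat_SubstF)

text \<open>This direction holds for every \<open>q\<close>. Only the converse
  \<open>sat_Diag_num\<close> needs the numeral of \<open>q\<close> and its table to fit under the
  bounds.\<close>

lemma sat_Diag:
  assumes "sat e (Diag q t)" "nval e q = prod_encode (z, m)"
  shows "nval e t = fcode (subst_fm 0 (num (nval e q)) (inv fcode z))"
proof -
  obtain c F m' where "sat (case_nat F (case_nat c (case_nat m' (case_nat z e)))) (NumCode (up 4 q) (Var 1) (Var 0))"
    and t: "nval e t = fcode (subst_fm 0 (inv tcode c) (inv fcode z))"
    using assms unfolding sat_Diag_iff by (auto simp only: prod_encode_eq prod.inject)
  from sat_NumCode[OF this(1)] have "c = tcode (num (nval e q))" by simp
  then show ?thesis using t by simp
qed

lemma sat_Diag_num: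
  assumes q: "nval e q = prod_encode (z, m)" and t: "nval e t = fcode (subst_fm 0 (num (nval e q)) (inv fcode z))"
    and b: "tcode (num (nval e q)) \<le> 2^2^2^2^nval e q" "num_set (nval e q) \<le> 2^2^2^2^nval e q"
  shows "sat e (Diag q t)"
proof -
  have "sat (case_nat (num_set (nval e q)) (case_nat (tcode (num (nval e q))) (case_nat m (case_nat z e))))
      (NumCode (up 4 q) (Var 1) (Var 0))"
    by (rule sat_NumCode_num) simp_all
  moreover have "z \<le> nval e q" "m \<le> nval e q" using q pe_le by simp_all
  ultimately show ?thesis unfolding sat_Diag_iff using b q t tdec(2) by metis
qed

section \<open>Truth of the self-referential sentence\<close>

text \<open>Semantic counterpart of substituting the numeral of \<open>n\<close> for the variable
  \<open>k\<close>.\<close>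

definition insert_val :: "nat \<Rightarrow> nat \<Rightarrow> (nat \<Rightarrow> nat) \<Rightarrow> nat \<Rightarrow> nat" where
  "insert_val k n e i = (if i < k then e i else if i = k then n else e (i - 1))"

lemma insert_val_simps[simp]: "insert_val 0 n e = case_nat n e" "insert_val (Suc k) n (case_nat a e) = case_nat a (insert_val k n e)"
  by (auto simp: insert_val_def fun_eq_iff split: nat.split)

lemma sat_subst_num: "sat e (subst_fm k (num n) A) \<longleftrightarrow> sat (insert_val k n e) A"
proof -
  have "(\<lambda>i. if i < k then e i else if i = k then nval (\<lambda>n. e (n + k)) (num n) else e (i - 1)) = insert_val k n e"
    by (auto simp: fun_eq_iff insert_val_def)
  then show ?thesis unfolding sat_subst by simp
qed

text \<open>A member \<open>z\<close> of the set coded by \<open>W\<close> satisfies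
  \<open>2 ^ z \<le> W\<close>, so an assignment listed in \<open>W\<close> is strictly smaller than
  \<open>W\<close>. This drives the descent in \<open>Self_true\<close>.\<close>

lemma rel3_less: assumes "rel3 W a b c" shows "b < W"
proof -
  let ?z = "prod_encode (a, prod_encode (b, c))"
  have "W div 2 ^ ?z \<noteq> 0" using assms by (auto simp: rel3_def set_decode_def intro!: Nat.gr0I)
  then have "2 ^ ?z \<le> W" by (metis div_less not_less)
  moreover have "b \<le> ?z" using pe_le le_trans by blast
  ultimately show ?thesis using less_exp[of ?z] by linarith
qed

lemma ftab_All: assumes "ftab R Q" "Q (fcode (All A)) e 0" shows "\<exists>n. Q (fcode A) (prod_encode (n, e)) 0"
proof -
  have "fstep R Q (fcode (All A)) e 0" using assms unfolding ftab_def by blast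
  then show ?thesis unfolding fstep_def c_defs fcode.simps four by auto
qed

text \<open>Asserting its own truth does not make a sentence true. But tables showing
  it false would contain an assignment giving smaller tables that do the same.\<close>

lemma Self_true:
  assumes Ax: "fm_below 1 Ax" "delta0 Ax" and n: "n = prod_encode (fcode (Self Ax), m)"
    and ref: "\<And>e. sat (case_nat n e) (Refuted Ax)"
  shows "sat e (subst_fm 0 (num n) (Self Ax))"
proof -
  let ?K = "subst_fm 0 (num n) (Self Ax)"
  define D where "D = subst_fm 5 (num n) (Self_mat Ax)"
  have K: "?K = All (All (All (All (All D))))" by (simp add: Self_def D_def eval_nat_numeral)
  have s: "sentence ?K" using fm_below_subst[of "num n" 0 "Self Ax"] Self_below[OF Ax(1)] by (simp add: sentence_below)
  have p: "pi1 ?K" unfolding Self_def by (intro pi1_subst pi1.intros delta0_Self_mat Ax)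
  define G where "G V W \<longleftrightarrow> (vtab (rel3 V) \<and> ftab (rel3 V) (rel3 W) \<longrightarrow> \<not> rel3 W (fcode ?K) 0 0)" for V W
  have D: "sat (case_nat W (case_nat V (case_nat u (case_nat t (case_nat s e))))) D" if "G V W" for V W u t s e
  proof -
    have "sat (case_nat W (case_nat V (case_nat u (case_nat t (case_nat s (case_nat n e)))))) (Self_mat Ax)"
      unfolding Self_mat_def sat_conn
    proof
      let ?e = "case_nat u (case_nat t (case_nat s (case_nat n e)))"
      show "sat (case_nat W (case_nat V ?e)) (lift_fm 0 1 (lift_fm 0 1 (lift_fm 0 1 (lift_fm 0 1 (lift_fm 0 1 (Refuted Ax))))))"
        using ref[of e] by (simp add: sat_lift)
      \<comment> \<open>\<open>Diag\<close> forces \<open>t\<close> to be the code of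
        \<open>?K\<close> itself, a \<open>\<Pi>\<^sub>1\<close>-sentence, so
        \<open>True_mat\<close> reduces to \<open>G V W\<close>.\<close>
      have "sat (case_nat W (case_nat V ?e)) True_mat" if "sat ?e (Diag (Var 3) (Var 1))"
      proof -
        have "t = fcode ?K" using sat_Diag[OF that, of "fcode (Self Ax)" m] n by (simp add: eval_nat_numeral)
        then show ?thesis using s p \<open>G V W\<close>
          by (simp add: True_mat_def sat_ValTable sat_TruthTable G_def rel3_def eval_nat_numeral del: fcode.simps)
      qed
      then show "sat (case_nat W (case_nat V ?e)) (lift_fm 0 1 (lift_fm 0 1 (Diag (Var 3) (Var 1))) \<rightharpoonup> True_mat)"
        by (simp add: sat_lift)
    qed
    then show ?thesis by (simp add: D_def sat_subst_num eval_nat_numeral)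
  qed
  have "G V W" for V W
  proof (induction W arbitrary: V rule: less_induct)
    case (less W)
    show ?case unfolding G_def
    proof (intro impI notI, elim conjE)
      assume tab: "vtab (rel3 V)" "ftab (rel3 V) (rel3 W)" and "rel3 W (fcode ?K) 0 0"
      \<comment> \<open>The value 0 is traced through the five quantifiers of \<open>?K\<close>. The
        innermost one ranges over \<open>W\<close>, so \<open>W'\<close> is the outermost component
        of the resulting assignment.\<close>
      then obtain s t u V' W' where r: "rel3 W (fcode D)
          (prod_encode (W', prod_encode (V', prod_encode (u, prod_encode (t, prod_encode (s, 0)))))) 0"
        unfolding K using ftab_All[OF tab(2)] by meson
      then have "W' < W" using rel3_less[OF r] pe_le(1) le_less_trans by blast
      \<comment> \<open>By induction \<open>D\<close> is true at this assignment, although the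
        tables give it the value 0.\<close>
      from D[OF less[OF this]] ftab_sound[OF tab r] show False by simp
    qed
  qed
  then show ?thesis unfolding K using D by simp
qed

section \<open>The size of proofs of instances\<close>

text \<open>This class is closed under sums, products and pairing, hence contains the codes of all
  numeral instances of a fixed formula. \<open>Suc n\<close> lets it contain constants even at
  0.\<close>

definition exp_bounded :: "(nat \<Rightarrow> nat) \<Rightarrow> bool" where
  "exp_bounded f \<longleftrightarrow> (\<exists>c. \<forall>n. f n \<le> 2 ^ (c * Suc n))"

lemma exp_bounded_mono: "exp_bounded g \<Longrightarrow> (\<And>n. f n \<le> g n) \<Longrightarrow> exp_bounded f"
  unfolding exp_bounded_def using le_trans by blast

lemma exp_bounded_const: "exp_bounded (\<lambda>n. c)"
proof -
  have "c \<le> 2 ^ (c * Suc n)" for n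
    using less_exp[of "c * Suc n"] le_add1[of c "c * n"] by (simp only: mult_Suc_right)
  then show ?thesis unfolding exp_bounded_def by blast
qed

lemma exp_bounded_add: assumes "exp_bounded f" "exp_bounded g" shows "exp_bounded (\<lambda>n. f n + g n)"
proof -
  obtain c d where b: "f n \<le> 2 ^ (c * Suc n)" "g n \<le> 2 ^ (d * Suc n)" for n
    using assms unfolding exp_bounded_def by blast
  have "f n + g n \<le> 2 ^ ((c + d + 1) * Suc n)" for n
  proof -
    let ?m = "(c + d) * Suc n"
    have "(2::nat) ^ (c * Suc n) \<le> 2 ^ ?m" "(2::nat) ^ (d * Suc n) \<le> 2 ^ ?m"
      by (rule power_increasing[OF mult_le_mono1]; simp)+
    then have "f n \<le> 2 ^ ?m" "g n \<le> 2 ^ ?m" using b[of n] le_trans by blast+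
    then have "f n + g n \<le> 2 ^ Suc ?m" by simp
    also have "\<dots> \<le> 2 ^ ((c + d + 1) * Suc n)" by (rule power_increasing) (auto simp: algebra_simps)
    finally show ?thesis .
  qed
  then show ?thesis unfolding exp_bounded_def by blast
qed

lemma exp_bounded_mult: assumes "exp_bounded f" "exp_bounded g" shows "exp_bounded (\<lambda>n. f n * g n)"
proof -
  obtain c d where b: "f n \<le> 2 ^ (c * Suc n)" "g n \<le> 2 ^ (d * Suc n)" for n
    using assms unfolding exp_bounded_def by blast
  have "f n * g n \<le> 2 ^ ((c + d) * Suc n)" for n
    using mult_le_mono[OF b(1)[of n] b(2)[of n]] by (simp only: power_add[symmetric] add_mult_distrib[symmetric])
  then show ?thesis unfolding exp_bounded_def by blast
qed

lemma exp_bounded_pair: assumes "exp_bounded f" "exp_bounded g" shows "exp_bounded (\<lambda>n. prod_encode (f n, g n))"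
proof (rule exp_bounded_mono)
  show "exp_bounded (\<lambda>n. (f n + g n) * (f n + g n + 1) + f n)"
    by (intro exp_bounded_add exp_bounded_mult exp_bounded_const assms)
  show "prod_encode (f n, g n) \<le> (f n + g n) * (f n + g n + 1) + f n" for n
    by (simp add: prod_encode_def triangle_def)
qed

lemma exp_bounded_num: "exp_bounded (\<lambda>n. tcode (num n))"
proof -
  have "tcode (num n) + 1 \<le> 2 ^ (3 * n)" for n by (induction n) (auto simp: power_add)
  moreover have "2 ^ (3 * n) \<le> (2::nat) ^ (3 * Suc n)" for n by (rule power_increasing) auto
  ultimately have "tcode (num n) \<le> 2 ^ (3 * Suc n)" for n by (meson add_leD1 le_trans)
  then show ?thesis unfolding exp_bounded_def by blast
qed

lemma exp_bounded_id: "exp_bounded (\<lambda>n. n)"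
proof (rule exp_bounded_mono[OF exp_bounded_num])
  show "n \<le> tcode (num n)" for n by (induction n) auto
qed

lemma exp_bounded_subst_tm: "exp_bounded (\<lambda>n. tcode (subst_tm k (num n) t))"
proof (induction t)
  case (Var i)
  have "lift_tm 0 k (num n) = num n" for n by (rule lift_tm_below) simp
  then show ?case by (cases i k rule: linorder_cases) (simp_all add: exp_bounded_const exp_bounded_num del: tcode.simps)
qed (unfold subst_tm.simps tcode.simps,
   (intro exp_bounded_add exp_bounded_mult exp_bounded_pair exp_bounded_const; assumption)+)

lemma exp_bounded_subst_fm: "exp_bounded (\<lambda>n. fcode (subst_fm k (num n) A))"
proof (induction A arbitrary: k)
  case Bot show ?case by (simp add: exp_bounded_const)
next
  case (Eq s t) show ?case unfolding subst_fm.simps fcode.simps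
    by (intro exp_bounded_add exp_bounded_mult exp_bounded_pair exp_bounded_const exp_bounded_subst_tm)
next
  case (Le s t) show ?case unfolding subst_fm.simps fcode.simps
    by (intro exp_bounded_add exp_bounded_mult exp_bounded_pair exp_bounded_const exp_bounded_subst_tm)
next
  case (Imp A B) show ?case unfolding subst_fm.simps fcode.simps
    by (intro exp_bounded_add exp_bounded_mult exp_bounded_pair exp_bounded_const Imp)
next
  case (All A) show ?case unfolding subst_fm.simps fcode.simps
    by (intro exp_bounded_add exp_bounded_mult exp_bounded_pair exp_bounded_const All)
qed

text \<open>The outermost \<open>2 ^ Suc\<close> pays for \<open>set_encode\<close>. The constant
  \<open>c\<close> serves as \<open>n0\<close>: if \<open>c \<le> n\<close>, then \<open>c * Suc n +
  1 \<le> (n + 1)^2 \<le> 2 ^ (2 * n) \<le> 2 ^ 2 ^ n\<close>.\<close>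

lemma exp_bounded_tower: assumes "exp_bounded f" shows "\<exists>n0. \<forall>n\<ge>n0. 2 ^ Suc (f n) \<le> (2::nat)^2^2^2^n"
proof -
  obtain c where c: "f n \<le> 2 ^ (c * Suc n)" for n using assms unfolding exp_bounded_def by blast
  have "2 ^ Suc (f n) \<le> (2::nat)^2^2^2^n" if "n \<ge> c" for n
  proof -
    have "c * Suc n \<le> n * Suc n" using that by (rule mult_le_mono1)
    then have "c * Suc n + 1 \<le> (n + 1)^2" by (simp add: power2_eq_square)
    also have "\<dots> \<le> (2 ^ n)^2" by (rule power_mono) (simp_all add: Suc_leI)
    also have "\<dots> = 2 ^ (2 * n)" by (simp add: power_mult[symmetric] mult.commute)
    also have "\<dots> \<le> 2 ^ 2 ^ n"
    proof (rule power_increasing)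
      show "2 * n \<le> 2 ^ n"
      proof (cases n)
        case (Suc k) then show ?thesis unfolding Suc power_Suc by (intro mult_le_mono2 Suc_leI less_exp)
      qed simp
    qed simp
    finally have 1: "(2::nat) ^ (c * Suc n + 1) \<le> 2 ^ 2 ^ 2 ^ n" by (rule power_increasing) simp
    have "f n + 1 \<le> 2 ^ (c * Suc n) + 2 ^ (c * Suc n)" by (intro add_mono c one_le_power) simp
    then have "Suc (f n) \<le> 2 ^ (c * Suc n + 1)" by (simp only: Suc_eq_plus1 power_add power_one_right mult_2_right)
    then show ?thesis using 1 by (intro power_increasing) simp_all
  qed
  then show ?thesis by blast
qed

lemma num_set_bound: "\<exists>n0. \<forall>n\<ge>n0. num_set n \<le> 2^2^2^2^n"
proof -
  have "num_set n \<le> 2 ^ Suc (prod_encode (n, tcode (num n)))" for n unfolding num_set_def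
  proof (rule set_encode_bound, clarsimp)
    fix i assume "i \<le> n"
    moreover have "tcode (num i) \<le> tcode (num n)" using \<open>i \<le> n\<close> by (rule lift_Suc_mono_le[rotated]) simp
    ultimately show "prod_encode (i, tcode (num i)) \<le> prod_encode (n, tcode (num n))" by (rule pe_mono)
  qed
  note b = this
  have "exp_bounded (\<lambda>n. prod_encode (n, tcode (num n)))"
    by (intro exp_bounded_pair exp_bounded_id exp_bounded_num)
  from exp_bounded_tower[OF this] show ?thesis by (meson b le_trans)
qed

text \<open>A fixed proof of the generalisation is extended by two lines only; this is why the
  self-referential sentence has the free variable \<open>q\<close>.\<close>

lemma instance_proof_bound:
  assumes "{} \<turnstile> All B"
  shows "\<exists>n0. \<forall>n\<ge>n0. \<exists>u\<le>2^2^2^2^n. \<forall>e. nval e y = u \<longrightarrow> nval e x = fcode (subst_fm 0 (num n) B) \<longrightarrow> sat e (Proof y x)"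
proof -
  obtain X i where X: "fin_prf X" "(i, fcode (All B)) \<in> X" using prfset_complete[OF assms] by blast
  have fin: "finite X" and ps: "prfset (\<lambda>i a. (i, a) \<in> X)" using X by (simp_all add: fin_prf_def)
  have "finite (fst ` X)" "finite (prod_encode ` X)" using fin by simp_all
  \<comment> \<open>Line \<open>m\<close> will hold the instance axiom and line \<open>Suc m\<close>
    its conclusion; \<open>M\<close> bounds the contribution of the fixed proof.\<close>
  then obtain m M where m: "\<forall>i\<in>fst ` X. i < m" and M: "\<forall>i\<in>prod_encode ` X. i < M"
    using finite_nat_set_iff_bounded by meson
  define r where "r n = fcode (subst_fm 0 (num n) B)" for n
  define ax where "ax n = fcode (All B \<rightharpoonup> subst_fm 0 (num n) B)" for n
  define Y where "Y n = insert (Suc m, r n) (insert (m, ax n) X)" for n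
  define f where "f n = M + (prod_encode (m, ax n) + prod_encode (Suc m, r n))" for n
  have p: "prfset (\<lambda>i a. (i, a) \<in> Y n)" for n
  proof -
    have "prfset (\<lambda>i b. (i, b) \<in> X \<or> i = m \<and> b = ax n)"
    proof (rule prfset_insert[OF ps])
      show "\<forall>i a. (i, a) \<in> X \<longrightarrow> i < m" using m by force
      show "log_ax (inv fcode (ax n)) \<or> (\<exists>j k b. (j, b) \<in> X \<and> (k, impc b (ax n)) \<in> X) \<or> (\<exists>j b. (j, b) \<in> X \<and> ax n = allc b)"
        by (simp add: ax_def log_ax.Inst del: fcode.simps)
    qed
    then have "prfset (\<lambda>i b. ((i, b) \<in> X \<or> i = m \<and> b = ax n) \<or> i = Suc m \<and> b = r n)"
    proof (rule prfset_insert)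
      show "\<forall>i a. (i, a) \<in> X \<or> i = m \<and> a = ax n \<longrightarrow> i < Suc m" using m by force
      have "impc (fcode (All B)) (r n) = ax n" by (simp add: r_def ax_def impc_def)
      then show "log_ax (inv fcode (r n)) \<or>
        (\<exists>j k b. ((j, b) \<in> X \<or> j = m \<and> b = ax n) \<and> ((k, impc b (r n)) \<in> X \<or> k = m \<and> impc b (r n) = ax n)) \<or>
        (\<exists>j b. ((j, b) \<in> X \<or> j = m \<and> b = ax n) \<and> r n = allc b)" using X(2) by metis
    qed
    moreover have "(\<lambda>i a. (i, a) \<in> Y n) = (\<lambda>i b. ((i, b) \<in> X \<or> i = m \<and> b = ax n) \<or> i = Suc m \<and> b = r n)"
      by (auto simp: Y_def fun_eq_iff)
    ultimately show ?thesis by simp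
  qed
  have rel: "rel2 (set_encode (prod_encode ` Y n)) = (\<lambda>i a. (i, a) \<in> Y n)" for n
  proof -
    have "finite (prod_encode ` Y n)" using fin by (simp add: Y_def)
    from set_encode_inverse[OF this] show ?thesis
      unfolding rel2_def by (auto simp: fun_eq_iff inj_image_mem_iff[OF inj_prod_encode])
  qed
  have s: "sat e (Proof y x)" if "nval e y = set_encode (prod_encode ` Y n)" "nval e x = r n" for e n
    using that p[of n] unfolding sat_Proof by (auto simp: rel) (auto simp: Y_def)
  have "exp_bounded f"
  proof -
    have "exp_bounded ax" "exp_bounded r" unfolding ax_def r_def fcode.simps(4)
      by (intro exp_bounded_add exp_bounded_mult exp_bounded_pair exp_bounded_const exp_bounded_subst_fm)+
    then show ?thesis unfolding f_def by (intro exp_bounded_add exp_bounded_pair exp_bounded_const)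
  qed
  from exp_bounded_tower[OF this] obtain n0 where n0: "\<forall>n\<ge>n0. 2 ^ Suc (f n) \<le> (2::nat)^2^2^2^n" ..
  have "set_encode (prod_encode ` Y n) \<le> 2 ^ Suc (f n)" for n
    by (rule set_encode_bound) (use M in \<open>auto simp: Y_def f_def intro: less_imp_le trans_le_add1\<close>)
  then have u: "set_encode (prod_encode ` Y n) \<le> 2^2^2^2^n" if "n \<ge> n0" for n
    using n0[rule_format, OF that] by (rule le_trans)
  show ?thesis
  proof (rule exI[of _ n0], intro allI impI)
    fix n assume n: "n \<ge> n0"
    show "\<exists>u\<le>2^2^2^2^n. \<forall>e. nval e y = u \<longrightarrow> nval e x = fcode (subst_fm 0 (num n) B) \<longrightarrow> sat e (Proof y x)"
      using s u[OF n] unfolding r_def by blast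
  qed
qed

section \<open>The second incompleteness theorem\<close>

text \<open>A fixed conjunction uses finitely many axioms, so from some \<open>w0\<close> on the
  witness bound is large enough for all of them.\<close>

lemma conj_of_bounded:
  fixes B :: "nat \<Rightarrow> fm"
  assumes Ax: "axiom_formula Ax T" and B: "\<And>e. sat e Ax \<Longrightarrow> \<exists>w0. \<forall>w\<ge>w0. sat e (B w)"
  shows "S \<in> conj_of T \<Longrightarrow> \<exists>w0. \<forall>w\<ge>w0. S \<in> conj_of {A. sat (case_nat (fcode A) e) (B w)}"
proof (induction rule: conj_of.induct)
  case 1
  show ?case by (blast intro: conj_of.intros(1))
next
  case (2 A)
  then have "sat (case_nat (fcode A) e) Ax" using Ax by (simp add: axiom_formula_def)
  from B[OF this] obtain w0 where "\<forall>w\<ge>w0. sat (case_nat (fcode A) e) (B w)" ..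
  then show ?case by (intro exI[of _ w0]) (auto intro: conj_of.intros(2))
next
  case (3 A C)
  then obtain v w where "\<forall>u\<ge>v. A \<in> conj_of {A. sat (case_nat (fcode A) e) (B u)}"
    "\<forall>u\<ge>w. C \<in> conj_of {A. sat (case_nat (fcode A) e) (B u)}" by blast
  then show ?case by (intro exI[of _ "max v w"]) (auto intro: conj_of.intros(3))
qed

lemma sat_BExiI: "n \<le> nval e t \<Longrightarrow> sat (case_nat n e) A \<Longrightarrow> sat e (BExi t A)"
  by auto

theorem theorem2p9:
  fixes T :: "fm set" and Ax :: fm
  assumes "\<forall>A\<in>T. sentence A"
    and "axiom_formula Ax T"
    and "sigma1_sound T"
  shows "\<not> T \<turnstile> Sigma1_Sound Ax"
proof
  assume "T \<turnstile> Sigma1_Sound Ax"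
  then obtain S where S: "S \<in> conj_of T" "{} \<turnstile> (S \<rightharpoonup> Sigma1_Sound Ax)"
    using finite_support[OF assms(1)] by blast
  have sS: "sentence S" using conj_of_sentence[OF assms(1) S(1)] .
  have ax: "sigma1 Ax" "fv Ax \<subseteq> {0}" using assms(2) by (simp_all add: axiom_formula_def)
  obtain B :: "nat \<Rightarrow> fm" where B: "\<And>w. delta0 (B w)" "\<And>w. fv (B w) \<subseteq> fv Ax" "\<And>w. {} \<turnstile> (B w \<rightharpoonup> Ax)"
    "\<And>e. sat e Ax \<Longrightarrow> \<exists>w0. \<forall>w\<ge>w0. sat e (B w)" using sigma1_bounded[OF ax(1)] by metis
  \<comment> \<open>\<open>S\<close> remains a conjunction of axioms when \<open>Ax\<close> is
    replaced by the \<open>\<Delta>\<^sub>0\<close>-formula \<open>B w\<close>, which is needed to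
    make the self-referential sentence \<open>\<Pi>\<^sub>1\<close>.\<close>
  obtain w where w: "S \<in> conj_of {A. sat (case_nat (fcode A) (\<lambda>_. 0)) (B w)}" (is "_ \<in> conj_of ?T'")
    using conj_of_bounded[OF assms(2) B(4) S(1)] by blast
  define Ax' where "Ax' = B w"
  have fv': "fv Ax' \<subseteq> {0}" using B(2)[of w] ax(2) by (auto simp: Ax'_def)
  have bel: "fm_below 1 Ax" "fm_below 1 Ax'" using ax(2) fv' by (auto simp: fm_below_def)
  have "sat (case_nat n e) Ax' \<longleftrightarrow> n \<in> fcode ` ?T'" for n e
  proof -
    have "sat (case_nat n e) Ax' = sat (case_nat n (\<lambda>_. 0)) Ax'"
      by (rule fv_sat) (use fv' in auto)
    also have "\<dots> \<longleftrightarrow> n \<in> fcode ` ?T'"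
      using image_eqI[of n fcode "inv fcode n" ?T'] by (auto simp: Ax'_def)
    finally show ?thesis .
  qed
  then have "axiom_formula Ax' ?T'"
    unfolding axiom_formula_def using fv' sigma1.intros(1)[OF B(1)[of w]] Ax'_def by blast
  from ConjAx_adequate[OF this] w have conj: "sat e (ConjAx Ax' x)" if "nval e x = fcode S" for e x
    using that by simp
  \<comment> \<open>Working over the single axiom \<open>S\<close> leads to one fixed proof in pure
    logic with the diagonal parameter still free, as \<open>instance_proof_bound\<close>
    requires.\<close>
  have "{S} \<turnstile> Sigma1_Sound Ax"
    by (rule proves.MP[OF proves.Ax proves_mono[OF S(2)]]) auto
  moreover have "{S} \<turnstile> (Ax' \<rightharpoonup> Ax)" unfolding Ax'_def by (rule proves_mono[OF B(3)]) simp
  ultimately have "{S} \<turnstile> (Self Ax' \<rightharpoonup> Bot)" using Self_refutable bel by blast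
  then have "{} \<turnstile> (S \<rightharpoonup> Self Ax' \<rightharpoonup> Bot)" by (rule deduction[OF sS])
  then have "{} \<turnstile> (S \<sqinter> Self Ax' \<rightharpoonup> Bot)" by (rule taut1) auto
  then have ref: "{} \<turnstile> All (S \<sqinter> Self Ax' \<rightharpoonup> Bot)" by (rule proves.Gen)
  define K where "K n = subst_fm 0 (num n) (Self Ax')" for n
  have sub: "subst_fm 0 (num n) (S \<sqinter> Self Ax' \<rightharpoonup> Bot) = (S \<sqinter> K n \<rightharpoonup> Bot)" for n
    using subst_fm_below[of 0 S] sS by (simp add: sentence_below K_def And_def Neg_def)
  have bound: "\<exists>n0. \<forall>n\<ge>n0. fcode (subst_fm 0 (num n) A) \<le> 2^2^2^2^n" for A
  proof -
    obtain n0 where n0: "\<forall>n\<ge>n0. 2 ^ Suc (fcode (subst_fm 0 (num n) A)) \<le> (2::nat)^2^2^2^n"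
      using exp_bounded_tower[OF exp_bounded_subst_fm] ..
    have "m \<le> 2 ^ Suc m" for m :: nat using less_exp[of "Suc m"] by simp
    then show ?thesis using n0 le_trans by meson
  qed
  obtain n1 where n1: "\<forall>n\<ge>n1. num_set n \<le> 2^2^2^2^n" using num_set_bound ..
  obtain n2 where n2: "\<forall>n\<ge>n2. \<exists>u\<le>2^2^2^2^n. \<forall>e. nval e (Var 2) = u \<longrightarrow> nval e (Var 0) = fcode (S \<sqinter> K n \<rightharpoonup> Bot) \<longrightarrow> sat e (Proof (Var 2) (Var 0))"
    using instance_proof_bound[OF ref] unfolding sub ..
  obtain n3 where n3: "\<forall>n\<ge>n3. fcode (S \<sqinter> K n \<rightharpoonup> Bot) \<le> 2^2^2^2^n" using bound[of "S \<sqinter> Self Ax' \<rightharpoonup> Bot"] unfolding sub ..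
  obtain n4 where n4: "\<forall>n\<ge>n4. 2 ^ Suc (tcode (num n)) \<le> (2::nat)^2^2^2^n" using exp_bounded_tower[OF exp_bounded_num] ..
  \<comment> \<open>The second component of the diagonal parameter is padding: it pushes
    \<open>n\<close> beyond all thresholds without changing the formula being diagonalised.\<close>
  define m where "m = n1 + n2 + n3 + n4"
  define n where "n = prod_encode (fcode (Self Ax'), m)"
  let ?b = "(2::nat)^2^2^2^n"
  have "m \<le> n" using pe_le by (simp add: n_def)
  then have n: "n \<ge> n1" "n \<ge> n2" "n \<ge> n3" "n \<ge> n4" by (simp_all add: m_def)
  obtain u where u: "u \<le> ?b" "\<And>e. nval e (Var 2) = u \<Longrightarrow> nval e (Var 0) = fcode (S \<sqinter> K n \<rightharpoonup> Bot) \<Longrightarrow> sat e (Proof (Var 2) (Var 0))"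
    using n2 n(2) by blast
  have c: "fcode (S \<sqinter> K n \<rightharpoonup> Bot) \<le> ?b" using n3 n(3) by blast
  have b: "fcode (S \<sqinter> K n) \<le> ?b" using less_le_trans[OF fcode_sub(1) c] by simp
  have s: "fcode S \<le> ?b" "fcode (K n) \<le> ?b"
    using less_le_trans[OF fcode_And(1) b] less_le_trans[OF fcode_And(2) b] by simp_all
  have "tcode (num n) \<le> 2 ^ Suc (tcode (num n))" using less_exp[of "Suc (tcode (num n))"] by simp
  then have t: "tcode (num n) \<le> ?b" using n4 n(4) le_trans by blast
  have "sat (case_nat n e) (Refuted Ax')" for e
  proof -
    \<comment> \<open>The witnesses for \<open>s\<close>, \<open>t\<close>, \<open>u\<close> are
      \<open>S\<close>, \<open>K n\<close> and the short proof; \<open>?f\<close> adds the codes of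
      the conjunction and of its negation.\<close>
    let ?e = "case_nat u (case_nat (fcode (K n)) (case_nat (fcode S) (case_nat n e)))"
    let ?f = "case_nat (fcode (S \<sqinter> K n \<rightharpoonup> Bot)) (case_nat (fcode (S \<sqinter> K n)) ?e)"
    have 1: "sat ?e (ConjAx Ax' (Var 2))" by (rule conj) simp
    have 2: "sat ?e (Diag (Var 3) (Var 1))"
      by (rule sat_Diag_num[of _ _ "fcode (Self Ax')" m]) (use n1 n(1) t in \<open>simp_all add: n_def[symmetric] K_def\<close>)
    have 3: "sat ?f (isAnd (Var 1) (Var 4) (Var 3))" unfolding sat_isAnd' by simp
    have 4: "sat ?f (isImp (Var 0) (Var 1) Zero)" by simp
    have 5: "sat ?f (Proof (Var 2) (Var 0))" by (rule u(2)) simp_all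
    have 6: "sat ?e (BExi (exp4 (Var 3)) (BExi (exp4 (Var 4))
        (isAnd (Var 1) (Var 4) (Var 3) \<sqinter> isImp (Var 0) (Var 1) Zero \<sqinter> Proof (Var 2) (Var 0))))"
    proof (rule sat_BExiI, rule_tac [2] sat_BExiI)
      show "sat ?f (isAnd (Var 1) (Var 4) (Var 3) \<sqinter> isImp (Var 0) (Var 1) Zero \<sqinter> Proof (Var 2) (Var 0))"
        using 3 4 5 by (simp only: sat_conn(3))
    qed (use b c in \<open>simp_all del: fcode.simps\<close>)
    show ?thesis unfolding Refuted_def
    proof (rule sat_BExiI, rule_tac [2] sat_BExiI, rule_tac [3] sat_BExiI)
      show "sat ?e (ConjAx Ax' (Var 2) \<sqinter> Diag (Var 3) (Var 1) \<sqinter> BExi (exp4 (Var 3)) (BExi (exp4 (Var 4))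
        (isAnd (Var 1) (Var 4) (Var 3) \<sqinter> isImp (Var 0) (Var 1) Zero \<sqinter> Proof (Var 2) (Var 0))))"
        using 1 2 6 by (simp only: sat_conn(3))
    qed (use s u(1) in \<open>simp_all del: fcode.simps\<close>)
  qed
  then have Kt: "sat e (K n)" for e unfolding K_def using Self_true[OF bel(2) _ n_def] B(1)[of w] by (simp add: Ax'_def)
  have "pi1 (K n)" unfolding K_def Self_def by (intro pi1_subst pi1.intros delta0_Self_mat) (simp add: Ax'_def B(1))
  then obtain C where C: "sigma1 C" "fv C = fv (K n)" "{} \<turnstile> (Neg (K n) \<rightharpoonup> C)" "\<forall>e. sat e C \<longleftrightarrow> \<not> sat e (K n)"
    using pi1_Neg by blast
  have "sentence C" using fm_below_subst[of "num n" 0 "Self Ax'"] Self_below[OF bel(2)] C(2)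
    by (simp add: sentence_def fm_below_def K_def)
  moreover have "T \<turnstile> C"
  proof -
    \<comment> \<open>Instantiating the open refutation at \<open>n\<close> makes \<open>T\<close>
      refute \<open>K n\<close>, hence prove \<open>C\<close>, which is false because
      \<open>K n\<close> is true.\<close>
    have "{} \<turnstile> (S \<sqinter> K n \<rightharpoonup> Bot)" using proves.MP[OF ref proves.Log[OF log_ax.Inst]] sub by metis
    then have "{} \<turnstile> (S \<rightharpoonup> C)" using C(3) by (rule taut2) auto
    then have "T \<turnstile> (S \<rightharpoonup> C)" by (rule proves_mono) simp
    then show ?thesis using conj_of_proves[OF S(1)] proves.MP by blast
  qed
  ultimately have "true_N C" using C(1) assms(3) unfolding sigma1_sound_def by blast
  then show False using C(4) Kt unfolding true_N_def by blast
qed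

end
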